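(* Let $d,m$ be positive integers with $m>d/2$. There exist constants $A,B>0$, depending only on $d$ and $m$, such that $$|\widetilde{\chi_h}(y)|\le A\,e^{-B|y|},\qquad y\in\mathbb{R}^d,\ h\in(0,1],$$ where $|y|=|y_1|+\cdots+|y_d|$ and $\widetilde{\chi_h}$ is the Lagrange function for cardinal interpolation on $\mathbb{Z}^d$ with the scaled Matérn kernel $\Phi_h$.
   Context: $\|\cdot\|$ is the Euclidean norm on $\mathbb{R}^d$. The Matérn kernel is $\Phi(x)=\Phi_{m,d}(x)=\|x\|^{m-d/2}K_{m-d/2}(\|x\|)$, $x\in\mathbb{R}^d$ (value at $0$ by continuity), where $K_\nu$ is the modified Bessel function of the third kind (Macdonald function) of order $\nu$; up to a constant factor it is the fundamental solution of $(1-\Delta)^m$ in $\mathbb{R}^d$. It is continuous and decays exponentially. For $h>0$, $\Phi_h(x):=\Phi(hx)$, and $$\mathcal{S}(\Phi_h)=\Big\{\sum_{j\in\mathbb{Z}^d}c_j\,\Phi_h(\cdot-j):\ c\in\ell_\infty(\mathbb{Z}^d)\Big\}.$$ The symbol $\sigma_m(t,h):=\sum_{k\in\mathbb{Z}^d}\Phi_h(k)e^{ik\cdot t}$ is positive for all $t\in\mathbb{R}^d$, $h>0$. The Lagrange function $\widetilde{\chi_h}$ is the unique element of $\mathcal{S}(\Phi_h)$ with $\widetilde{\chi_h}(j)=\delta_{j0}$ for all $j\in\mathbb{Z}^d$; explicitly, $\widetilde{\chi_h}(y)=\sum_{k\in\mathbb{Z}^d}a_k^h\,\Phi_h(y-k)$,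 where $\{a_k^h\}_{k\in\mathbb{Z}^d}\in\ell_1$ is the sequence of Fourier coefficients of $1/\sigma_m(\cdot,h)$. *)

theory Defs
  imports "HOL-Analysis.Analysis"
begin

text \<open>The modified Bessel function of the third kind (Macdonald function) of real order \<open>\<nu>\<close>,
  through its standard integral representation; only arguments \<open>z > 0\<close> are meaningful
  (the integral diverges for \<open>z \<le> 0\<close>).\<close>

definition bessel_K :: "real \<Rightarrow> real \<Rightarrow> real" where
  "bessel_K \<nu> z = (LBINT t:{0..}. exp (- z * cosh t) * cosh (\<nu> * t))"

text \<open>The Matern kernel \<open>\<Phi>\<^sub>m\<^sub>,\<^sub>d\<close>, with \<open>d = CARD('d)\<close>. The limit is the value at the origin by
  continuity; it exists for \<open>m > d/2\<close>.\<close>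

definition matern_profile :: "real \<Rightarrow> real \<Rightarrow> real" where
  "matern_profile \<nu> r = r powr \<nu> * bessel_K \<nu> r"

definition matern :: "nat \<Rightarrow> real ^ 'd \<Rightarrow> real" where
  "matern m x =
     (let \<nu> = real m - real CARD('d) / 2
      in if x = 0 then Lim (at_right 0) (matern_profile \<nu>) else matern_profile \<nu> (norm x))"

definition scaled_matern :: "nat \<Rightarrow> real \<Rightarrow> real ^ 'd \<Rightarrow> real" where
  "scaled_matern m h x = matern m (h *\<^sub>R x)"

definition lattice_point :: "int ^ 'd \<Rightarrow> real ^ 'd" where
  "lattice_point k = (\<chi> i. real_of_int (k $ i))"

text \<open>Coefficients are taken real. For \<open>m > d/2\<close> and \<open>h > 0\<close> every series below converges
  absolutely, since the kernel decays exponentially.\<close>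

definition cardinal_space :: "nat \<Rightarrow> real \<Rightarrow> (real ^ 'd \<Rightarrow> real) set" where
  "cardinal_space m h =
     {(\<lambda>x. \<Sum>\<^sub>\<infinity>j. c j * scaled_matern m h (x - lattice_point j)) | c :: int ^ 'd \<Rightarrow> real.
        bounded (range c)}"

definition lagrange_fun :: "nat \<Rightarrow> real \<Rightarrow> real ^ 'd \<Rightarrow> real" where
  "lagrange_fun m h =
     (THE f. f \<in> cardinal_space m h \<and>
        (\<forall>j. f (lattice_point j) = (if j = 0 then 1 else 0)))"

end

theory Submission
  imports Defs "HOL-Probability.Probability" "HOL-Complex_Analysis.Complex_Analysis"
begin

text \<open>
  Writing the Matern kernel as a mixture of Gaussians and applying Poisson summation to each Gaussian gives,
  with \<open>q\<^sub>k(z) = h\<^sup>2 + \<Sum>\<^sub>j (z\<^sub>j + 2 \<pi> k\<^sub>j)\<^sup>2\<close>,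
  \<open>\<Sum>\<^sub>k \<Phi>\<^sub>h(y - k) exp (i k t) = C \<Sum>\<^sub>k exp (i y (t + 2 \<pi> k)) / q\<^sub>k(t)\<^sup>m\<close>.
  Hence the Lagrange function at \<open>y\<close> is the mean over the torus of the quotient of this series by the same
  series at \<open>y = 0\<close>. After multiplication by \<open>q\<^sub>0\<^sup>m\<close> numerator and denominator extend holomorphically to a
  tube around the torus, the denominator is at least 1 at real points, and all estimates are uniform in
  \<open>h \<in> [0, 1]\<close>. Since the quotient is periodic, the contour in a single coordinate \<open>t\<^sub>i\<close> can be shifted by
  \<open>\<plusminus>b/2\<close>, which yields decay like \<open>exp (- b |y\<^sub>i| / 2)\<close>; taking the largest coordinate of \<open>y\<close> gives decay in
  \<open>|y|\<close>. The same shift shows that the Fourier coefficients of the reciprocal symbol are summable, and convolving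
  with them gives uniqueness of the interpolant with bounded coefficients.
\<close>

text \<open>The obstacle is uniformity as \<open>h\<close> tends to 0. The symbol then blows up at
  the origin, and the nearest complex zeros of \<open>q\<^sub>0\<close>, at distance
  \<open>h\<close>, leave the Poisson series no common strip of holomorphy. The factor
  \<open>q\<^sub>0^m\<close> cures this but singles out \<open>k = 0\<close>, so numerator and
  denominator lose their periodicity. Their quotient keeps it, because it agrees with the quotient
  of the full series wherever \<open>q\<^sub>0\<close> is nonzero; this is so on the vertical sides
  \<open>Re = \<plusminus> pi\<close> of the rectangle, the only place where periodicity enters the
  contour shift. The detour through Gaussians reduces everything to one coordinate, since Gaussians
  factor, and spares all decay estimates for Bessel functions. Shifting a single coordinate keeps
  the complex analysis in one variable; the price is the dimension \<open>d\<close> in the final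
  rate \<open>b / (2 * d)\<close>. Uniqueness cannot be bypassed: \<open>lagrange_fun\<close> is a
  definite description, so nothing is known about it before its interpolant is shown to exist and to
  be unique.\<close>

no_notation fps_nth (infixl "$" 75)

section \<open>Infinite sums and integrals\<close>

text \<open>Integration theory exchanges integrals with series over \<open>nat\<close>. The index
  type is coded by \<open>to_nat\<close>, which need not be onto, so \<open>g\<close> is padded with
  0 at numbers that code no index.\<close>

lemma infsum_suminf_countable:
  fixes f :: "'i::countable \<Rightarrow> 'b::banach"
  assumes "(\<lambda>k. norm (f k)) summable_on UNIV"
  defines "g \<equiv> \<lambda>n::nat. if n \<in> range (to_nat :: 'i \<Rightarrow> nat) then f (from_nat n) else 0"
  shows "summable (\<lambda>n. norm (g n))" "(\<Sum>\<^sub>\<infinity>k. f k) = (\<Sum>n. g n)"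
proof -
  have inj: "inj (to_nat :: 'i \<Rightarrow> nat)" by simp
  have "(\<lambda>n. norm (g n)) summable_on range (to_nat :: 'i \<Rightarrow> nat)"
    by (subst summable_on_reindex[OF inj]) (use assms(1) in \<open>simp add: o_def g_def\<close>)
  hence "(\<lambda>n. norm (g n)) summable_on UNIV"
    by (rule summable_on_cong_neutral[THEN iffD1, rotated -1]) (auto simp: g_def)
  thus s: "summable (\<lambda>n. norm (g n))"
    by (rule summable_on_imp_summable)
  have "(\<Sum>\<^sub>\<infinity>k. f k) = infsum g (range (to_nat :: 'i \<Rightarrow> nat))"
    by (subst infsum_reindex[OF inj]) (simp add: o_def g_def)
  also have "\<dots> = infsum g UNIV"
    by (rule infsum_cong_neutral) (auto simp: g_def)
  also have "\<dots> = (\<Sum>n. g n)"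
    using norm_summable_imp_has_sum[OF s summable_sums[OF summable_norm_cancel[OF s]]] infsumI by blast
  finally show "(\<Sum>\<^sub>\<infinity>k. f k) = (\<Sum>n. g n)" .
qed

lemma
  fixes f :: "'i::countable \<Rightarrow> 'a \<Rightarrow> 'b::{banach,second_countable_topology}"
  assumes int: "\<And>k. integrable M (f k)"
    and pt: "\<And>x. x \<in> space M \<Longrightarrow> (\<lambda>k. norm (f k x)) summable_on UNIV"
    and sm: "(\<lambda>k. \<integral>x. norm (f k x) \<partial>M) summable_on UNIV"
  shows integrable_infsum: "integrable M (\<lambda>x. \<Sum>\<^sub>\<infinity>k. f k x)"
    and integral_infsum: "(\<integral>x. (\<Sum>\<^sub>\<infinity>k. f k x) \<partial>M) = (\<Sum>\<^sub>\<infinity>k. \<integral>x. f k x \<partial>M)"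
proof -
  define g where "g = (\<lambda>n x. if n \<in> range (to_nat :: 'i \<Rightarrow> nat) then f (from_nat n) x else 0)"
  have gi: "integrable M (g n)" for n
    using int by (cases "n \<in> range (to_nat :: 'i \<Rightarrow> nat)") (auto simp: g_def)
  have gs: "summable (\<lambda>n. norm (g n x))" "(\<Sum>\<^sub>\<infinity>k. f k x) = (\<Sum>n. g n x)" if "x \<in> space M" for x
    using infsum_suminf_countable[OF pt[OF that]] by (simp_all add: g_def)
  have "(\<lambda>k. norm (\<integral>x. norm (f k x) \<partial>M)) summable_on UNIV"
    using sm by (simp add: integral_nonneg_AE)
  from infsum_suminf_countable(1)[OF this]
  have "summable (\<lambda>n. norm (if n \<in> range (to_nat :: 'i \<Rightarrow> nat) then \<integral>x. norm (f (from_nat n) x) \<partial>M else 0))" .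
  moreover have "norm (if n \<in> range (to_nat :: 'i \<Rightarrow> nat) then \<integral>x. norm (f (from_nat n) x) \<partial>M else 0)
      = (\<integral>x. norm (g n x) \<partial>M)" for n
    by (auto simp: g_def integral_nonneg_AE)
  ultimately have s2: "summable (\<lambda>n. \<integral>x. norm (g n x) \<partial>M)" by simp
  have "(\<lambda>k. norm (\<integral>x. f k x \<partial>M)) summable_on UNIV"
    by (rule summable_on_comparison_test[OF sm]) auto
  from infsum_suminf_countable(2)[OF this]
  have e: "(\<Sum>\<^sub>\<infinity>k. \<integral>x. f k x \<partial>M) = (\<Sum>n. \<integral>x. g n x \<partial>M)"
    by (rule trans) (auto intro!: suminf_cong simp: g_def)
  have "integrable M (\<lambda>x. \<Sum>n. g n x)"
    by (rule integrable_suminf[OF gi _ s2]) (use gs in auto)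
  thus "integrable M (\<lambda>x. \<Sum>\<^sub>\<infinity>k. f k x)"
    by (subst Bochner_Integration.integrable_cong[OF refl gs(2)])
  have "(\<integral>x. (\<Sum>\<^sub>\<infinity>k. f k x) \<partial>M) = (\<integral>x. (\<Sum>n. g n x) \<partial>M)"
    by (rule Bochner_Integration.integral_cong) (use gs in auto)
  also have "\<dots> = (\<Sum>n. \<integral>x. g n x \<partial>M)"
    by (rule integral_suminf[OF gi _ s2]) (use gs in auto)
  finally show "(\<integral>x. (\<Sum>\<^sub>\<infinity>k. f k x) \<partial>M) = (\<Sum>\<^sub>\<infinity>k. \<integral>x. f k x \<partial>M)" using e by simp
qed

text \<open>\<open>vec_nth\<close> identifies \<open>int ^ 'd\<close> with a function space over
  which absolutely convergent sums of products factor. All later passages from sums over one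
  coordinate to sums over the lattice go through this.\<close>

lemma
  fixes f :: "'d::finite \<Rightarrow> int \<Rightarrow> 'c :: {real_normed_field,banach,second_countable_topology}"
  assumes "\<And>i. (\<lambda>n. norm (f i n)) summable_on UNIV"
  shows infsum_prod_vec: "(\<Sum>\<^sub>\<infinity>k::int^'d. \<Prod>i\<in>UNIV. f i (k $ i)) = (\<Prod>i\<in>UNIV. \<Sum>\<^sub>\<infinity>n. f i n)"
    and norm_summable_on_prod_vec: "(\<lambda>k::int^'d. norm (\<Prod>i\<in>UNIV. f i (k $ i))) summable_on UNIV"
proof -
  have bij: "bij_betw (vec_nth :: int^'d \<Rightarrow> _) UNIV (PiE UNIV (\<lambda>_. UNIV))"
    by (rule bij_betw_byWitness[where f' = vec_lambda]) auto
  show "(\<Sum>\<^sub>\<infinity>k::int^'d. \<Prod>i\<in>UNIV. f i (k $ i)) = (\<Prod>i\<in>UNIV. \<Sum>\<^sub>\<infinity>n. f i n)"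
    using infsum_reindex_bij_betw[OF bij, of "\<lambda>g. \<Prod>i\<in>UNIV. f i (g i)"]
      infsum_prod_PiE_abs[of UNIV f "\<lambda>_. UNIV"] assms by simp
  have "(\<lambda>g. norm (\<Prod>i\<in>UNIV. f i (g i))) summable_on (PiE UNIV (\<lambda>_. UNIV))"
    using abs_summable_on_prod_PiE[of UNIV "\<lambda>_. UNIV" f] assms
    by (simp add: abs_summable_equivalent)
  thus "(\<lambda>k::int^'d. norm (\<Prod>i\<in>UNIV. f i (k $ i))) summable_on UNIV"
    using summable_on_reindex_bij_betw[OF bij, of "\<lambda>g. norm (\<Prod>i\<in>UNIV. f i (g i))"] by simp
qed

section \<open>The theta transformation formula\<close>

lemma symmetric_cos_moments_zero:
  fixes f :: "real \<Rightarrow> real"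
  assumes cont: "continuous_on {0..1} f" and sym: "\<And>x. f (1 - x) = f x"
    and zero: "\<And>n::nat. integral {0..1} (\<lambda>x. f x * cos (2 * pi * x) ^ n) = 0"
    and x: "x \<in> {0..1}"
  shows "f x = 0"
proof -
  \<comment> \<open>A function symmetric about 1/2 is a continuous function of the cosine, so Weierstrass approximation
    by algebraic polynomials suffices.\<close>
  define \<phi> where "\<phi> = (\<lambda>u. f (arccos u / (2 * pi)))"
  have \<phi>c: "continuous_on {-1..1} \<phi>"
    unfolding \<phi>_def
  proof (rule continuous_on_compose2[OF cont])
    have "0 \<le> arccos u \<and> arccos u \<le> pi * 2" if "u \<in> {-1..1}" for u
      using that arccos_lbound[of u] arccos_ubound[of u] pi_gt_zero
      by (auto intro: order_trans)
    thus "(\<lambda>u. arccos u / (2 * pi)) ` {-1..1} \<subseteq> {0..1}"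
      by (auto simp: field_simps)
  qed (auto intro!: continuous_intros)
  have f\<phi>: "f y = \<phi> (cos (2 * pi * y))" if y: "y \<in> {0..1}" for y
  proof (cases "y \<le> 1/2")
    case True
    thus ?thesis using y by (simp add: \<phi>_def arccos_cos)
  next
    case False
    have "cos (2 * pi * y) = cos (2 * pi * (1 - y))"
      by (simp add: right_diff_distrib cos_diff)
    moreover have "arccos (cos (2 * pi * (1 - y))) = 2 * pi * (1 - y)"
      using y False by (intro arccos_cos) auto
    ultimately show ?thesis by (simp add: \<phi>_def sym)
  qed
  have fi: "(\<lambda>x. f x * g x) integrable_on {0..1}" if "continuous_on {0..1} g" for g
    by (intro integrable_continuous_real continuous_intros cont that)
  define M where "M = integral {0..1} (\<lambda>x. \<bar>f x\<bar>)"
  \<comment> \<open>\<open>f\<close> is orthogonal to every polynomial in the cosine, so the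
    integral of \<open>f^2\<close> equals that of \<open>f * (f - p)\<close>, where \<open>p\<close>
    is uniformly close to \<open>f\<close>.\<close>
  have small: "integral {0..1} (\<lambda>x. f x * f x) \<le> e * M" if e: "e > 0" for e
  proof -
    obtain p where p: "real_polynomial_function p" "\<And>u. u \<in> {-1..1} \<Longrightarrow> \<bar>\<phi> u - p u\<bar> < e"
      using Stone_Weierstrass_real_polynomial_function[of "{-1..1}" \<phi> e] \<phi>c e by auto
    obtain a n where an: "p = (\<lambda>x. \<Sum>i\<le>n. a i * x ^ i)"
      using p(1) real_polynomial_function_iff_sum by blast
    have pc: "continuous_on {0..1} (\<lambda>x. p (cos (2 * pi * x)))"
      unfolding an by (intro continuous_intros)
    have "integral {0..1} (\<lambda>x. f x * p (cos (2 * pi * x)))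
        = integral {0..1} (\<lambda>x. \<Sum>i\<le>n. a i * (f x * cos (2 * pi * x) ^ i))"
      by (simp add: an sum_distrib_left mult_ac)
    also have "\<dots> = (\<Sum>i\<le>n. integral {0..1} (\<lambda>x. a i * (f x * cos (2 * pi * x) ^ i)))"
      by (rule integral_sum) (auto intro!: integrable_continuous_real continuous_intros cont)
    also have "\<dots> = 0" by (simp add: zero)
    finally have z: "integral {0..1} (\<lambda>x. f x * p (cos (2 * pi * x))) = 0" .
    have "integral {0..1} (\<lambda>x. f x * f x)
        = integral {0..1} (\<lambda>x. f x * f x) - integral {0..1} (\<lambda>x. f x * p (cos (2 * pi * x)))"
      using z by simp
    also have "\<dots> = integral {0..1} (\<lambda>x. f x * f x - f x * p (cos (2 * pi * x)))"
      by (rule Henstock_Kurzweil_Integration.integral_diff[symmetric]) (auto intro!: fi cont pc)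
    also have "\<dots> \<le> integral {0..1} (\<lambda>x. e * \<bar>f x\<bar>)"
    proof (rule integral_le)
      show "(\<lambda>x. f x * f x - f x * p (cos (2 * pi * x))) integrable_on {0..1}"
        by (intro integrable_continuous_real continuous_intros cont pc)
      show "(\<lambda>x. e * \<bar>f x\<bar>) integrable_on {0..1}"
        by (intro integrable_continuous_real continuous_intros cont)
      fix y :: real assume y: "y \<in> {0..1}"
      have "\<bar>f y - p (cos (2 * pi * y))\<bar> \<le> e"
        using p(2)[of "cos (2 * pi * y)"] f\<phi>[OF y] by simp
      hence "\<bar>f y\<bar> * \<bar>f y - p (cos (2 * pi * y))\<bar> \<le> \<bar>f y\<bar> * e"
        by (intro mult_left_mono) auto
      thus "f y * f y - f y * p (cos (2 * pi * y)) \<le> e * \<bar>f y\<bar>"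
        by (simp add: abs_mult[symmetric] right_diff_distrib mult.commute)
    qed
    finally show ?thesis by (simp add: M_def)
  qed
  have M0: "M \<ge> 0" unfolding M_def
    by (rule Henstock_Kurzweil_Integration.integral_nonneg) (auto intro!: integrable_continuous_real continuous_intros cont)
  have "integral {0..1} (\<lambda>x. f x * f x) \<le> 0"
  proof (rule field_le_epsilon)
    fix e :: real assume "e > 0"
    \<comment> \<open>\<open>M\<close> can be 0, hence the divisor \<open>M + 1\<close>.\<close>
    have "integral {0..1} (\<lambda>x. f x * f x) \<le> e / (M + 1) * M"
      using small[of "e / (M + 1)"] \<open>e > 0\<close> M0 by simp
    also have "\<dots> \<le> e" using M0 \<open>e > 0\<close> by (simp add: field_simps)
    finally show "integral {0..1} (\<lambda>x. f x * f x) \<le> 0 + e" by simp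
  qed
  moreover have "integral {0..1} (\<lambda>x. f x * f x) \<ge> 0"
    by (rule Henstock_Kurzweil_Integration.integral_nonneg) (auto intro!: integrable_continuous_real continuous_intros cont)
  ultimately have "integral {0..1} (\<lambda>x. f x * f x) = 0" by linarith
  hence "\<forall>x\<in>{0..1}. f x * f x = 0"
    by (subst (asm) integral_eq_0_iff) (auto intro!: continuous_intros cont)
  thus ?thesis using x by auto
qed

text \<open>A single value is claimed, so the even part \<open>G x = g x + g (1 - x)\<close> is
  enough: periodicity gives \<open>G 0 = 2 * g 0\<close>. Powers of the cosine are combinations of
  characters, so all cosine moments of \<open>G\<close> vanish, and its real and imaginary parts
  fall under the previous lemma.\<close>

lemma fourier_coefficients_zero:
  fixes g :: "real \<Rightarrow> complex"
  assumes cont: "continuous_on {0..1} g" and per: "g 0 = g 1"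
    and zero: "\<And>n::int. integral {0..1} (\<lambda>x. g x * cis (2 * pi * n * x)) = 0"
  shows "g 0 = 0"
proof -
  have reflect: "integral {0..1} (\<lambda>x. f (1 - x)) = integral {0..1} f" if "continuous_on {0..1} f" for f :: "real \<Rightarrow> complex"
  proof -
    have "((\<lambda>x. f (- 1 *\<^sub>R x + 1)) has_integral (1 / \<bar>- 1\<bar> ^ DIM(real)) *\<^sub>R integral {0..1} f)
        ((\<lambda>x. (1 / - 1) *\<^sub>R x + - ((1 / - 1) *\<^sub>R 1)) ` cbox 0 1)"
      by (rule has_integral_affinity)
         (use that in \<open>auto intro!: integrable_integral integrable_continuous_real\<close>)
    moreover have "(\<lambda>x. (1 / - 1) *\<^sub>R x + - ((1 / - 1) *\<^sub>R 1)) ` cbox 0 1 = {0..1::real}"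
      by (auto simp: image_iff intro!: bexI[of _ "1 - _"])
    ultimately show ?thesis by (simp add: integral_unique)
  qed
  have cosn: "integral {0..1} (\<lambda>x. g x * of_real (cos (2 * pi * x) ^ n)) = 0" for n
  proof -
    have "of_real (cos (2 * pi * x) ^ n) =
       (\<Sum>k\<le>n. of_nat (n choose k) / 2 ^ n * cis (2 * pi * of_int (2 * int k - int n) * x))" for x
    proof -
      have "complex_of_real (cos (2 * pi * x)) = (cis (2*pi*x) + cis (-(2*pi*x))) / 2"
        by (simp add: complex_eq_iff)
      hence "complex_of_real (cos (2 * pi * x) ^ n) = (cis (2*pi*x) + cis (-(2*pi*x))) ^ n / 2 ^ n"
        by (simp only: of_real_power power_divide)
      also have "(cis (2*pi*x) + cis (-(2*pi*x))) ^ n =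
          (\<Sum>k\<le>n. of_nat (n choose k) * cis (2*pi*x) ^ k * cis (-(2*pi*x)) ^ (n - k))"
        by (rule binomial_ring)
      also have "\<dots> = (\<Sum>k\<le>n. of_nat (n choose k) * cis (2 * pi * of_int (2 * int k - int n) * x))"
      proof (rule sum.cong[OF refl])
        fix k assume "k \<in> {..n}"
        hence "real k * (2*pi*x) + real (n - k) * (-(2*pi*x)) = 2 * pi * of_int (2 * int k - int n) * x"
          by (simp add: of_nat_diff algebra_simps)
        hence "cis (2*pi*x) ^ k * cis (-(2*pi*x)) ^ (n - k) = cis (2 * pi * of_int (2 * int k - int n) * x)"
          by (simp only: Complex.DeMoivre cis_mult)
        thus "of_nat (n choose k) * cis (2*pi*x) ^ k * cis (-(2*pi*x)) ^ (n - k)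
            = of_nat (n choose k) * cis (2 * pi * of_int (2 * int k - int n) * x)"
          by (simp only: mult.assoc)
      qed
      finally show ?thesis by (simp add: sum_divide_distrib)
    qed
    hence "integral {0..1} (\<lambda>x. g x * of_real (cos (2 * pi * x) ^ n)) =
      integral {0..1} (\<lambda>x. \<Sum>k\<le>n. of_nat (n choose k) / 2 ^ n * (g x * cis (2 * pi * of_int (2 * int k - int n) * x)))"
      by (simp add: sum_distrib_left mult_ac)
    also have "\<dots> = (\<Sum>k\<le>n. integral {0..1} (\<lambda>x. of_nat (n choose k) / 2 ^ n * (g x * cis (2 * pi * of_int (2 * int k - int n) * x))))"
      by (rule integral_sum) (auto intro!: integrable_continuous_real continuous_intros cont)
    also have "\<dots> = 0"
      using zero by (simp only: Henstock_Kurzweil_Integration.integral_mult_right) simp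
    finally show ?thesis .
  qed
  have cont': "continuous_on {0..1} (\<lambda>x. g (1 - x))"
    by (rule continuous_on_compose2[OF cont]) (auto intro!: continuous_intros)
  define G where "G = (\<lambda>x. g x + g (1 - x))"
  have Gc: "continuous_on {0..1} G"
    unfolding G_def by (intro continuous_intros cont cont')
  have Gz: "integral {0..1} (\<lambda>x. G x * of_real (cos (2 * pi * x) ^ n)) = 0" for n
  proof -
    have c1: "cos (2 * pi * (1 - x)) = cos (2 * pi * x)" for x
      by (simp add: right_diff_distrib cos_diff)
    have "integral {0..1} (\<lambda>x. G x * of_real (cos (2 * pi * x) ^ n)) =
      integral {0..1} (\<lambda>x. g x * of_real (cos (2 * pi * x) ^ n)) +
      integral {0..1} (\<lambda>x. g (1 - x) * of_real (cos (2 * pi * (1 - x)) ^ n))"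
      unfolding G_def c1 distrib_right
      by (rule Henstock_Kurzweil_Integration.integral_add)
         (auto intro!: integrable_continuous_real continuous_intros cont cont')
    also have "integral {0..1} (\<lambda>x. g (1 - x) * of_real (cos (2 * pi * (1 - x)) ^ n)) = 0"
      using reflect[of "\<lambda>x. g x * of_real (cos (2 * pi * x) ^ n)"] cosn
      by (simp add: continuous_intros cont)
    finally show ?thesis using cosn by simp
  qed
  have Gi: "(\<lambda>x. G x * of_real (cos (2 * pi * x) ^ n)) integrable_on {0..1}" for n
    by (auto intro!: integrable_continuous_real continuous_intros Gc)
  have "Re (G 0) = 0"
  proof (rule symmetric_cos_moments_zero[of "\<lambda>x. Re (G x)"])
    show "integral {0..1} (\<lambda>x. Re (G x) * cos (2 * pi * x) ^ n) = 0" for n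
      using integral_linear[OF Gi bounded_linear_Re, of n] Gz[of n] by (simp add: o_def del: of_real_power)
  qed (auto intro!: continuous_intros cont cont' simp: G_def)
  moreover have "Im (G 0) = 0"
  proof (rule symmetric_cos_moments_zero[of "\<lambda>x. Im (G x)"])
    show "integral {0..1} (\<lambda>x. Im (G x) * cos (2 * pi * x) ^ n) = 0" for n
      using integral_linear[OF Gi bounded_linear_Im, of n] Gz[of n] by (simp add: o_def del: of_real_power)
  qed (auto intro!: continuous_intros cont cont' simp: G_def)
  ultimately show ?thesis using per by (simp add: G_def complex_eq_iff)
qed

section \<open>Summable majorants for translated Gaussians\<close>

lemma summable_on_int_split:
  fixes f :: "int \<Rightarrow> real"
  assumes "(\<lambda>n::nat. f (int n)) summable_on UNIV" "(\<lambda>n::nat. f (- int n)) summable_on UNIV"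
  shows "f summable_on UNIV"
proof -
  have "f summable_on range int"
    by (subst summable_on_reindex) (use assms(1) in \<open>auto simp: o_def\<close>)
  moreover have "f summable_on range (\<lambda>n. - int n)"
    by (subst summable_on_reindex) (use assms(2) in \<open>auto simp: o_def inj_on_def\<close>)
  moreover have "UNIV = range int \<union> range (\<lambda>n. - int n)"
    by (auto simp: image_iff) (metis int_cases2)
  ultimately show ?thesis by (metis summable_on_union)
qed

lemma summable_on_one_plus_square_powr:
  assumes "p > 1/2"
  shows "(\<lambda>n::int. (1 + (real_of_int n)\<^sup>2) powr (-p)) summable_on UNIV"
proof -
  have "summable (\<lambda>n::nat. real n powr (- (2 * p)))"
    using assms by (subst summable_real_powr_iff) auto
  moreover have "(1 + (real (Suc n))\<^sup>2) powr (-p) \<le> real (Suc n) powr (- (2 * p))" for n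
  proof -
    have "real (Suc n) powr (- (2 * p)) = (real (Suc n) powr 2) powr (-p)"
      by (subst powr_powr) simp
    also have "real (Suc n) powr 2 = (real (Suc n))\<^sup>2"
      by (subst powr_numeral) auto
    finally show ?thesis
      using assms by (auto intro!: powr_mono2')
  qed
  ultimately have "summable (\<lambda>n. (1 + (real (Suc n))\<^sup>2) powr (-p))"
    using summable_comparison_test'[of "\<lambda>n. real (Suc n) powr (- (2 * p))" 0
        "\<lambda>n. (1 + (real (Suc n))\<^sup>2) powr (-p)"]
      summable_Suc_iff[of "\<lambda>n. real n powr (- (2 * p))"]
    by (simp del: of_nat_Suc)
  hence "summable (\<lambda>n. (1 + (real n)\<^sup>2) powr (-p))"
    using summable_Suc_iff[of "\<lambda>n. (1 + (real n)\<^sup>2) powr (-p)"] by blast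
  hence "(\<lambda>n::nat. (1 + (real n)\<^sup>2) powr (-p)) summable_on UNIV"
    by (intro summable_nonneg_imp_summable_on) auto
  thus ?thesis by (intro summable_on_int_split) auto
qed

lemma exp_minus_square_le:
  fixes c v :: real
  assumes "c > 0"
  shows "exp (- (c * v\<^sup>2)) \<le> max 1 (1 / c) * inverse (1 + v\<^sup>2)"
proof -
  have "1 + c * v\<^sup>2 \<le> exp (c * v\<^sup>2)" by (rule exp_ge_add_one_self)
  moreover have "1 + v\<^sup>2 \<le> max 1 (1 / c) * (1 + c * v\<^sup>2)"
  proof -
    have "v\<^sup>2 = (1 / c) * (c * v\<^sup>2)" using assms by simp
    also have "\<dots> \<le> max 1 (1 / c) * (c * v\<^sup>2)"
      using assms by (intro mult_right_mono) auto
    finally show ?thesis by (simp add: distrib_left)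
  qed
  ultimately have "1 + v\<^sup>2 \<le> max 1 (1 / c) * exp (c * v\<^sup>2)"
    by (meson mult_left_mono order_trans max.coboundedI1 zero_le_one)
  moreover have "1 + v\<^sup>2 > 0" by (simp add: add_pos_nonneg)
  ultimately show ?thesis by (simp add: exp_minus divide_simps mult.commute)
qed

text \<open>The majorant has to be uniform in the centre \<open>a\<close>, since the Weierstrass
  test is applied while the Gaussian is translated over an interval. Peetre's inequality
  \<open>1 + (a - v)^2 <= 2 * (1 + a^2) * (1 + v^2)\<close> moves the dependence on \<open>a\<close>
  into a constant.\<close>

lemma exp_minus_square_shift_le:
  fixes a c R :: real and k :: int
  assumes "c > 0" "\<bar>a\<bar> \<le> R"
  shows "exp (- (c * (a - k)\<^sup>2)) \<le> 2 * max 1 (1 / c) * (1 + R\<^sup>2) * (1 + (real_of_int k)\<^sup>2) powr (-1)"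
proof -
  define v where "v = a - k"
  have p: "1 + v\<^sup>2 > 0" "1 + (real_of_int k)\<^sup>2 > 0" by (simp_all add: add_pos_nonneg)
  have "1 + (real_of_int k)\<^sup>2 = 1 + (a - v)\<^sup>2" by (simp add: v_def)
  also have "\<dots> \<le> 2 * (1 + a\<^sup>2) * (1 + v\<^sup>2)"
  proof -
    have "2 * (1 + a\<^sup>2) * (1 + v\<^sup>2) - (1 + (a - v)\<^sup>2) = 1 + (a + v)\<^sup>2 + 2 * (a * v)\<^sup>2"
      by (simp add: power2_eq_square algebra_simps)
    thus ?thesis by (smt (verit) zero_le_power2)
  qed
  also have "\<dots> \<le> 2 * (1 + R\<^sup>2) * (1 + v\<^sup>2)"
    using assms(2) p by (intro mult_right_mono mult_left_mono add_left_mono abs_le_square_iff[THEN iffD1]) auto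
  finally have "inverse (1 + v\<^sup>2) \<le> 2 * (1 + R\<^sup>2) * (1 + (real_of_int k)\<^sup>2) powr (-1)"
    using p by (simp add: powr_minus divide_simps mult_ac)
  hence "max 1 (1 / c) * inverse (1 + v\<^sup>2) \<le> max 1 (1 / c) * (2 * (1 + R\<^sup>2) * (1 + (real_of_int k)\<^sup>2) powr (-1))"
    by (intro mult_left_mono) auto
  with exp_minus_square_le[OF assms(1), of v]
  have "exp (- (c * v\<^sup>2)) \<le> max 1 (1 / c) * (2 * (1 + R\<^sup>2) * (1 + (real_of_int k)\<^sup>2) powr (-1))"
    by (rule order_trans)
  thus ?thesis unfolding v_def by (simp only: mult_ac)
qed

lemma summable_on_gaussian_bound:
  "(\<lambda>k::int. C * (1 + (real_of_int k)\<^sup>2) powr (-1)) summable_on UNIV"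
  using summable_on_one_plus_square_powr[of 1] by (intro summable_on_cmult_right) auto

lemma summable_on_exp_minus_square:
  fixes a c :: real
  assumes "c > 0"
  shows "(\<lambda>k::int. exp (- (c * (a - k)\<^sup>2))) summable_on UNIV"
  by (rule summable_on_comparison_test[OF summable_on_gaussian_bound])
     (use exp_minus_square_shift_le[OF assms order_refl] in auto)

text \<open>The substitution \<open>v = r * x\<close> with \<open>r^2 = 2 * s\<close> turns the
  Gaussian into a multiple of the standard normal density, whose characteristic function is
  known.\<close>

lemma
  fixes s \<tau> :: real
  assumes s: "s > 0"
  shows integrable_gaussian: "integrable lborel (\<lambda>v. complex_of_real (exp (- (v\<^sup>2 / (4 * s)))) * cis (\<tau> * v))"
    and integral_gaussian: "(\<integral>v. complex_of_real (exp (- (v\<^sup>2 / (4 * s)))) * cis (\<tau> * v) \<partial>lborel)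
      = of_real (sqrt (4 * pi * s) * exp (- (s * \<tau>\<^sup>2)))"
proof -
  define r where "r = sqrt (2 * s)"
  have r: "r > 0" "r\<^sup>2 = 2 * s" using s by (auto simp: r_def)
  have m: "(\<lambda>x. cis (r * \<tau> * x)) \<in> borel_measurable lborel"
    unfolding cis_conv_exp by measurable
  have i0: "integrable lborel (\<lambda>x. std_normal_density x *\<^sub>R cis (r * \<tau> * x))"
  proof (rule Bochner_Integration.integrable_bound[OF integrable_normal_density[of 1 0]])
    show "(\<lambda>x. std_normal_density x *\<^sub>R cis (r * \<tau> * x)) \<in> borel_measurable lborel"
      by (intro borel_measurable_scaleR m) auto
  qed simp_all
  have eq: "complex_of_real (exp (- ((0 + r * x)\<^sup>2 / (4 * s)))) * cis (\<tau> * (0 + r * x))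
      = complex_of_real (sqrt (2 * pi)) * (std_normal_density x *\<^sub>R cis (r * \<tau> * x))" for x
  proof -
    have e: "(0 + r * x)\<^sup>2 / (4 * s) = x\<^sup>2 / 2"
      using s r(2) by (simp add: power_mult_distrib)
    have "exp (- (x\<^sup>2 / 2)) = sqrt (2 * pi) * std_normal_density x"
      by (simp add: std_normal_density_def)
    thus ?thesis
      unfolding e by (simp add: scaleR_conv_of_real mult_ac)
  qed
  have "integrable lborel (\<lambda>x. complex_of_real (exp (- ((0 + r * x)\<^sup>2 / (4 * s)))) * cis (\<tau> * (0 + r * x)))"
    unfolding eq by (intro integrable_mult_right i0)
  thus "integrable lborel (\<lambda>v. complex_of_real (exp (- (v\<^sup>2 / (4 * s)))) * cis (\<tau> * v))"
    using r(1) lborel_integrable_real_affine_iff[of r "\<lambda>v. complex_of_real (exp (- (v\<^sup>2 / (4 * s)))) * cis (\<tau> * v)" 0]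
    by simp
  have ch: "(\<integral>x. std_normal_density x *\<^sub>R cis (r * \<tau> * x) \<partial>lborel) = of_real (exp (- ((r * \<tau>)\<^sup>2) / 2))"
  proof -
    have "(\<integral>x. std_normal_density x *\<^sub>R cis (r * \<tau> * x) \<partial>lborel)
        = (CLINT x|std_normal_distribution. cis (r * \<tau> * x))"
      by (subst integral_density) (use m in \<open>auto simp: normal_density_nonneg\<close>)
    also have "\<dots> = char std_normal_distribution (r * \<tau>)"
      by (simp add: char_def cis_conv_exp)
    finally show ?thesis by (simp add: char_std_normal_distribution)
  qed
  have "(\<integral>v. complex_of_real (exp (- (v\<^sup>2 / (4 * s)))) * cis (\<tau> * v) \<partial>lborel)
     = r *\<^sub>R (\<integral>x. complex_of_real (sqrt (2 * pi)) * (std_normal_density x *\<^sub>R cis (r * \<tau> * x)) \<partial>lborel)"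
    using r(1) lborel_integral_real_affine[of r "\<lambda>v. complex_of_real (exp (- (v\<^sup>2 / (4 * s)))) * cis (\<tau> * v)" 0]
    unfolding eq by simp
  also have "\<dots> = r *\<^sub>R (complex_of_real (sqrt (2 * pi)) * of_real (exp (- ((r * \<tau>)\<^sup>2) / 2)))"
    by (simp only: integral_mult_right_zero ch)
  also have "\<dots> = of_real (r * sqrt (2 * pi) * exp (- ((r * \<tau>)\<^sup>2) / 2))"
    by (simp add: scaleR_conv_of_real)
  also have "r * sqrt (2 * pi) = sqrt (4 * pi * s)"
    by (simp add: r_def flip: real_sqrt_mult)
  also have "- ((r * \<tau>)\<^sup>2) / 2 = - (s * \<tau>\<^sup>2)"
    using r by (simp add: power_mult_distrib)
  finally show "(\<integral>v. complex_of_real (exp (- (v\<^sup>2 / (4 * s)))) * cis (\<tau> * v) \<partial>lborel)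
      = of_real (sqrt (4 * pi * s) * exp (- (s * \<tau>\<^sup>2)))" .
qed

text \<open>The half-open cells \<open>?I k\<close> tile the line, so each \<open>v\<close> lies in
  exactly one. The closed interval \<open>{0..1}\<close>, over which Fourier coefficients are taken,
  differs from a translated cell by one null point.\<close>

lemma
  fixes h :: "real \<Rightarrow> 'a::{banach,second_countable_topology}"
  assumes h: "integrable lborel h"
  shows summable_on_integral_translates:
      "(\<lambda>k::int. \<integral>u. norm (indicator {0..1} u *\<^sub>R h (u - k)) \<partial>lborel) summable_on UNIV"
    and infsum_integral_translates:
      "(\<Sum>\<^sub>\<infinity>k::int. \<integral>u. indicator {0..1} u *\<^sub>R h (u - k) \<partial>lborel) = (\<integral>v. h v \<partial>lborel)"
proof -
  let ?I = "\<lambda>k::int. {-real_of_int k..<1 - real_of_int k}"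
  have I: "v \<in> ?I k \<longleftrightarrow> k = - \<lfloor>v\<rfloor>" for v k
    by (auto simp: floor_eq_iff) linarith+
  have tr: "(\<integral>u. indicator {0..1} u *\<^sub>R g (u - k) \<partial>lborel) = (\<integral>v. indicator (?I k) v *\<^sub>R g v \<partial>lborel)"
    if "g \<in> borel_measurable lborel"
    for g :: "real \<Rightarrow> 'b::{banach,second_countable_topology}" and k :: int
  proof -
    have "(\<integral>v. indicator (?I k) v *\<^sub>R g v \<partial>lborel) = (\<integral>u. indicator (?I k) (-k + u) *\<^sub>R g (-k + u) \<partial>lborel)"
      using lborel_integral_real_affine[of 1 "\<lambda>v. indicator (?I k) v *\<^sub>R g v" "-k"] by simp
    also have "\<dots> = (\<integral>u. indicator {0..1} u *\<^sub>R g (u - k) \<partial>lborel)"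
    proof (rule integral_cong_AE)
      have "AE u in lborel. u \<noteq> (1::real)" by (rule AE_lborel_singleton)
      thus "AE u in lborel. indicator (?I k) (-k + u) *\<^sub>R g (-k + u) = indicator {0..1} u *\<^sub>R g (u - k)"
        by eventually_elim (auto simp: indicator_def algebra_simps)
    qed (use that in measurable)
    finally show ?thesis by simp
  qed
  have hm: "h \<in> borel_measurable lborel" using h by auto
  have int: "integrable lborel (\<lambda>v. indicator (?I k) v *\<^sub>R h v)" for k
    using h by (intro integrable_mult_indicator) auto
  have nint: "integrable lborel (\<lambda>v. indicator (?I k) v *\<^sub>R norm (h v))" for k
    using h by (intro integrable_mult_indicator integrable_norm) auto
  have s0: "(\<lambda>k. norm (indicator (?I k) v *\<^sub>R h v)) summable_on UNIV" for v
    by (rule finite_nonzero_values_imp_summable_on)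
       (rule finite_subset[of _ "{- \<lfloor>v\<rfloor>}"], auto simp: I[symmetric] indicator_def)
  have s1: "(\<lambda>k. \<integral>v. indicator (?I k) v *\<^sub>R norm (h v) \<partial>lborel) summable_on UNIV"
  proof (rule nonneg_bdd_above_summable_on)
    show "bdd_above (sum (\<lambda>k. \<integral>v. indicator (?I k) v *\<^sub>R norm (h v) \<partial>lborel) ` {F. F \<subseteq> UNIV \<and> finite F})"
    proof (rule bdd_aboveI2)
      fix F :: "int set" assume F: "F \<in> {F. F \<subseteq> UNIV \<and> finite F}"
      have "(\<Sum>k\<in>F. \<integral>v. indicator (?I k) v *\<^sub>R norm (h v) \<partial>lborel)
          = (\<integral>v. (\<Sum>k\<in>F. indicator (?I k) v *\<^sub>R norm (h v)) \<partial>lborel)"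
        using nint by (subst Bochner_Integration.integral_sum) auto
      also have "\<dots> \<le> (\<integral>v. norm (h v) \<partial>lborel)"
      proof (rule integral_mono)
        fix v
        have "(\<Sum>k\<in>F. indicator (?I k) v *\<^sub>R norm (h v)) = (\<Sum>k\<in>F. if k = - \<lfloor>v\<rfloor> then norm (h v) else 0)"
          by (rule sum.cong) (use I in \<open>auto simp: indicator_def\<close>)
        also have "\<dots> \<le> norm (h v)" using F by (simp add: sum.delta)
        finally show "(\<Sum>k\<in>F. indicator (?I k) v *\<^sub>R norm (h v)) \<le> norm (h v)" .
      qed (use nint h in auto)
      finally show "(\<Sum>k\<in>F. \<integral>v. indicator (?I k) v *\<^sub>R norm (h v) \<partial>lborel) \<le> (\<integral>v. norm (h v) \<partial>lborel)" .
    qed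
  qed (auto intro!: Bochner_Integration.integral_nonneg)
  have s2: "(\<lambda>k. \<integral>v. norm (indicator (?I k) v *\<^sub>R h v) \<partial>lborel) summable_on UNIV"
    using s1 by simp
  have "(\<Sum>\<^sub>\<infinity>k. indicator (?I k) v *\<^sub>R h v) = h v" for v
  proof -
    have "(\<Sum>\<^sub>\<infinity>k. indicator (?I k) v *\<^sub>R h v) = (\<Sum>\<^sub>\<infinity>k\<in>{- \<lfloor>v\<rfloor>}. indicator (?I k) v *\<^sub>R h v)"
      by (rule infsum_cong_neutral) (use I in \<open>auto simp: indicator_def\<close>)
    also have "\<dots> = h v" using I[of v "- \<lfloor>v\<rfloor>"] by (simp add: indicator_def)
    finally show ?thesis .
  qed
  hence "(\<integral>v. h v \<partial>lborel) = (\<Sum>\<^sub>\<infinity>k. \<integral>v. indicator (?I k) v *\<^sub>R h v \<partial>lborel)"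
    using integral_infsum[OF int s0 s2] by simp
  thus "(\<Sum>\<^sub>\<infinity>k::int. \<integral>u. indicator {0..1} u *\<^sub>R h (u - k) \<partial>lborel) = (\<integral>v. h v \<partial>lborel)"
    using tr[OF hm] by simp
  have "(\<integral>u. norm (indicator {0..1} u *\<^sub>R h (u - k)) \<partial>lborel) = (\<integral>v. indicator (?I k) v *\<^sub>R norm (h v) \<partial>lborel)" for k
    using tr[of "\<lambda>v. norm (h v)" k] hm by simp
  thus "(\<lambda>k::int. \<integral>u. norm (indicator {0..1} u *\<^sub>R h (u - k)) \<partial>lborel) summable_on UNIV"
    using s1 by simp
qed

lemma continuous_on_infsum:
  fixes f :: "'i \<Rightarrow> 'a::topological_space \<Rightarrow> 'b::banach"
  assumes "\<And>k. k \<in> I \<Longrightarrow> continuous_on S (f k)"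
    and "\<And>k x. k \<in> I \<Longrightarrow> x \<in> S \<Longrightarrow> norm (f k x) \<le> M k" and "M summable_on I"
  shows "continuous_on S (\<lambda>x. \<Sum>\<^sub>\<infinity>k\<in>I. f k x)"
proof (rule uniform_limit_theorem)
  show "uniform_limit S (\<lambda>X y. \<Sum>x\<in>X. f x y) (\<lambda>y. \<Sum>\<^sub>\<infinity>x\<in>I. f x y) (finite_subsets_at_top I)"
    using assms(2,3) by (rule Weierstrass_m_test_general)
  show "\<forall>\<^sub>F X in finite_subsets_at_top I. continuous_on S (\<lambda>y. \<Sum>x\<in>X. f x y)"
    by (rule eventually_finite_subsets_at_top_weakI) (auto intro!: continuous_on_sum assms(1))
qed simp

lemma integral_cis:
  fixes a b c :: real
  assumes "a \<le> b" "c \<noteq> 0"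
  shows "integral {a..b} (\<lambda>u. cis (c * u)) = (cis (c * b) - cis (c * a)) / (\<i> * c)"
proof -
  have "((\<lambda>u. cis (c * u)) has_integral (cis (c * b) / (\<i> * c) - cis (c * a) / (\<i> * c))) {a..b}"
  proof (rule fundamental_theorem_of_calculus[OF assms(1)])
    fix x :: real
    have "((\<lambda>z. exp (\<i> * c * z) / (\<i> * c)) has_field_derivative exp (\<i> * c * of_real x)) (at (of_real x))"
      by (rule derivative_eq_intros refl)+ (use assms(2) in auto)
    from has_vector_derivative_real_field[OF this]
    have "((\<lambda>u. exp (\<i> * c * of_real u) / (\<i> * c)) has_vector_derivative exp (\<i> * c * of_real x)) (at x within {a..b})" .
    thus "((\<lambda>u. cis (c * u) / (\<i> * c)) has_vector_derivative cis (c * x)) (at x within {a..b})"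
      by (simp add: cis_conv_exp mult.assoc)
  qed
  thus ?thesis by (simp add: integral_unique diff_divide_distrib)
qed

lemma continuous_on_integral_lborel:
  fixes f :: "real \<Rightarrow> 'a::euclidean_space"
  assumes "continuous_on {a..b} f"
  shows "integrable lborel (\<lambda>u. indicator {a..b} u *\<^sub>R f u)"
    and "(\<integral>u. indicator {a..b} u *\<^sub>R f u \<partial>lborel) = integral {a..b} f"
  using borel_integrable_atLeastAtMost'[OF assms] set_borel_integral_eq_integral(2)[of "{a..b}" f]
  by (auto simp: set_integrable_def set_lebesgue_integral_def)

lemma cis_int_2pi [simp]: "cis (2 * pi * of_int n) = 1" "cis (of_int n * (2 * pi)) = 1"
proof -
  show "cis (2 * pi * of_int n) = 1" by (rule cis_multiple_2pi) simp
  thus "cis (of_int n * (2 * pi)) = 1" by (subst mult.commute)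
qed

lemma integral_cis_unit:
  "integral {0..1} (\<lambda>u. cis (2 * pi * of_int n * u)) = (if n = 0 then 1 else 0)"
  using integral_cis[of 0 1 "2 * pi * of_int n"] by (simp add: cis_zero)

text \<open>Both a translation \<open>x\<close> and a character \<open>\<theta>\<close> are kept:
  \<open>x\<close> becomes a coordinate of the evaluation point, \<open>\<theta>\<close> a torus
  variable, and the width \<open>s\<close> the mixture parameter \<open>exp u\<close>.\<close>

lemma theta_transform:
  fixes x \<theta> s :: real
  assumes s: "s > 0"
  shows "(\<Sum>\<^sub>\<infinity>k::int. complex_of_real (exp (- ((x - k)\<^sup>2 / (4 * s)))) * cis (k * \<theta>))
    = of_real (sqrt (4 * pi * s)) *
      (\<Sum>\<^sub>\<infinity>n::int. complex_of_real (exp (- (s * (\<theta> + 2 * pi * n)\<^sup>2))) * cis (x * (\<theta> + 2 * pi * n)))"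
proof -
  define F where "F = (\<lambda>v. complex_of_real (exp (- (v\<^sup>2 / (4 * s)))) * cis (- (\<theta> * v)))"
  define b where "b = (\<lambda>n::int. complex_of_real (sqrt (4 * pi * s) * exp (- (s * (\<theta> + 2 * pi * n)\<^sup>2))))"
  define A where "A = (\<lambda>u. \<Sum>\<^sub>\<infinity>k::int. F (x + u - k))"
  define B where "B = (\<lambda>u. \<Sum>\<^sub>\<infinity>n::int. b n * cis (2 * pi * n * (x + u)))"
  have Fc: "continuous_on S F" for S unfolding F_def by (intro continuous_intros) (use s in auto)
  have Fn: "norm (F v) = exp (- ((1 / (4 * s)) * v\<^sup>2))" for v
    by (simp add: F_def norm_mult)
  have bn: "norm (b n) = sqrt (4 * pi * s) * exp (- ((s * (2 * pi)\<^sup>2) * (- \<theta> / (2 * pi) - n)\<^sup>2))" for n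
  proof -
    have "s * (\<theta> + 2 * pi * n)\<^sup>2 = (s * (2 * pi)\<^sup>2) * (- \<theta> / (2 * pi) - n)\<^sup>2"
      by (simp add: power2_eq_square divide_simps) (simp add: algebra_simps)
    thus ?thesis using s by (simp add: b_def norm_mult)
  qed
  have bs: "(\<lambda>n. norm (b n)) summable_on UNIV"
    unfolding bn by (intro summable_on_cmult_right summable_on_exp_minus_square) (use s in auto)
  have Fs: "(\<lambda>k::int. norm (F (v - k))) summable_on UNIV" for v
    unfolding Fn by (intro summable_on_exp_minus_square) (use s in auto)
  have Ac: "continuous_on {0..1} A"
    unfolding A_def
  proof (rule continuous_on_infsum)
    show "continuous_on {0..1} (\<lambda>u. F (x + u - of_int k))" for k
      by (rule continuous_on_compose2[OF Fc[of UNIV]]) (auto intro!: continuous_intros)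
    show "norm (F (x + u - of_int k)) \<le> 2 * max 1 (1 / (1 / (4 * s))) * (1 + (\<bar>x\<bar> + 1)\<^sup>2) * (1 + (real_of_int k)\<^sup>2) powr (-1)"
      if "u \<in> {0..1}" for u k
      unfolding Fn by (rule exp_minus_square_shift_le) (use s that in auto)
  qed (rule summable_on_gaussian_bound)
  have Bc: "continuous_on {0..1} B"
    unfolding B_def by (rule continuous_on_infsum[OF _ _ bs]) (auto intro!: continuous_intros simp: norm_mult)
  define g where "g = (\<lambda>u. A u - B u)"
  \<comment> \<open>Poisson summation: both sides, multiplied by \<open>cis (- x * \<theta>)\<close> and translated by \<open>u\<close>, are
    continuous and 1-periodic in \<open>u\<close> with the same Fourier coefficients.\<close>
  have "g 0 = 0"
  proof (rule fourier_coefficients_zero)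
    show "continuous_on {0..1} g" unfolding g_def by (intro continuous_intros Ac Bc)
    have "A 1 = A 0"
      unfolding A_def
      by (rule infsum_reindex_bij_witness[of _ "\<lambda>k. k + 1" "\<lambda>k. k - 1"]) (auto simp: algebra_simps)
    moreover have "B 1 = B 0"
      unfolding B_def by (simp add: distrib_left flip: cis_mult)
    ultimately show "g 0 = g 1" by (simp add: g_def)
  next
    fix n :: int
    define H where "H = (\<lambda>v. F (x + v) * cis (2 * pi * n * v))"
    define G where "G = (\<lambda>w. complex_of_real (exp (- (w\<^sup>2 / (4 * s)))) * cis ((2 * pi * n - \<theta>) * w))"
    have HG: "H v = cis (- (2 * pi * n * x)) * G (x + 1 * v)" for v
      unfolding H_def G_def F_def
      by (simp add: mult.assoc mult.left_commute[of "cis _"] cis_mult) (simp add: algebra_simps)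
    have Gi: "integrable lborel G"
      unfolding G_def by (rule integrable_gaussian[OF s])
    have Hi: "integrable lborel H"
      unfolding HG by (intro integrable_mult_right lborel_integrable_real_affine Gi) auto
    have HI: "(\<integral>v. H v \<partial>lborel) = cis (- (2 * pi * n * x)) * b (-n)"
    proof -
      have "(\<integral>v. H v \<partial>lborel) = cis (- (2 * pi * n * x)) * (\<integral>v. G (x + 1 * v) \<partial>lborel)"
        unfolding HG by (rule integral_mult_right_zero)
      also have "(\<integral>v. G (x + 1 * v) \<partial>lborel) = (\<integral>w. G w \<partial>lborel)"
        by (subst lborel_integral_real_affine[of 1 G x]) auto
      \<comment> \<open>The frequency \<open>2 * pi * n - \<theta>\<close> is minus the one in
        \<open>b (-n)\<close>, and only its square enters.\<close>
      also have "\<dots> = b (-n)"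
        unfolding G_def by (subst integral_gaussian[OF s]) (simp add: b_def power2_commute)
      finally show ?thesis .
    qed
    have "integral {0..1} (\<lambda>u. A u * cis (2 * pi * n * u))
        = (\<integral>u. indicator {0..1} u *\<^sub>R (A u * cis (2 * pi * n * u)) \<partial>lborel)"
      by (rule continuous_on_integral_lborel(2)[symmetric]) (intro continuous_intros Ac)
    also have "\<dots> = (\<integral>u. (\<Sum>\<^sub>\<infinity>k::int. indicator {0..1} u *\<^sub>R H (u - k)) \<partial>lborel)"
    proof (rule Bochner_Integration.integral_cong[OF refl])
      fix u :: real
      \<comment> \<open>The character has period 1 and so passes into the sum over translates; the
        sum of the integrals over unit cells then becomes one integral over the line.\<close>
      have "H (u - of_int k) = F (x + u - of_int k) * cis (2 * pi * n * u)" for k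
      proof -
        have "cis (2 * pi * n * (u - k)) = cis (2 * pi * n * u) * cis (2 * pi * of_int (- (n * k)))"
          by (subst cis_mult) (simp add: algebra_simps)
        thus ?thesis by (simp only: H_def cis_int_2pi mult_1_right) (simp add: algebra_simps)
      qed
      hence "(\<Sum>\<^sub>\<infinity>k::int. indicator {0..1} u *\<^sub>R H (u - k))
          = (\<Sum>\<^sub>\<infinity>k::int. F (x + u - of_int k) * (indicator {0..1} u *\<^sub>R cis (2 * pi * n * u)))"
        by simp
      also have "\<dots> = A u * (indicator {0..1} u *\<^sub>R cis (2 * pi * n * u))"
        unfolding A_def by (rule infsum_cmult_left') 
      finally show "indicator {0..1} u *\<^sub>R (A u * cis (2 * pi * n * u)) = (\<Sum>\<^sub>\<infinity>k::int. indicator {0..1} u *\<^sub>R H (u - k))"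
        by simp
    qed
    also have "\<dots> = (\<Sum>\<^sub>\<infinity>k::int. \<integral>u. indicator {0..1} u *\<^sub>R H (u - k) \<partial>lborel)"
    proof (rule integral_infsum)
      show "integrable lborel (\<lambda>u. indicator {0..1} u *\<^sub>R H (u - of_int k))" for k
        using lborel_integrable_real_affine[OF Hi, of 1 "- of_int k"]
        by (intro integrable_mult_indicator) auto
      show "(\<lambda>k::int. norm (indicator {0..1} u *\<^sub>R H (u - of_int k))) summable_on UNIV" for u
      proof (rule summable_on_comparison_test[OF Fs[of "x + u"]])
        show "norm (indicator {0..1} u *\<^sub>R H (u - of_int k)) \<le> norm (F (x + u - of_int k))" for k
          by (auto simp: H_def norm_mult indicator_def add_diff_eq)
      qed auto
    qed (rule summable_on_integral_translates[OF Hi])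
    also have "\<dots> = cis (- (2 * pi * n * x)) * b (-n)"
      by (subst infsum_integral_translates[OF Hi]) (rule HI)
    finally have A_eq: "integral {0..1} (\<lambda>u. A u * cis (2 * pi * n * u)) = cis (- (2 * pi * n * x)) * b (-n)" .
    define K where "K = (\<lambda>j u. indicator {0..1} u *\<^sub>R (b j * cis (2 * pi * j * (x + u)) * cis (2 * pi * n * u)))"
    have Ki: "integrable lborel (K j)" for j
      unfolding K_def by (intro continuous_on_integral_lborel(1) continuous_intros)
    have Kn: "norm (K j u) = indicator {0..1} u *\<^sub>R norm (b j)" for j u
      by (simp add: K_def norm_mult)
    have KI: "(\<integral>u. K j u \<partial>lborel) = (if j = - n then cis (- (2 * pi * n * x)) * b (-n) else 0)" for j
    proof -
      have "(\<integral>u. K j u \<partial>lborel) = integral {0..1} (\<lambda>u. b j * cis (2 * pi * j * (x + u)) * cis (2 * pi * n * u))"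
        unfolding K_def by (intro continuous_on_integral_lborel(2) continuous_intros)
      also have "(\<lambda>u. b j * cis (2 * pi * j * (x + u)) * cis (2 * pi * n * u)) =
          (\<lambda>u. (b j * cis (2 * pi * j * x)) * cis (2 * pi * of_int (j + n) * u))"
        by (simp add: mult.assoc cis_mult) (simp add: algebra_simps)
      also have "integral {0..1} \<dots> = (b j * cis (2 * pi * j * x)) * (if j + n = 0 then 1 else 0)"
        by (simp only: Henstock_Kurzweil_Integration.integral_mult_right integral_cis_unit)
      finally show ?thesis by auto
    qed
    have "integral {0..1} (\<lambda>u. B u * cis (2 * pi * n * u))
        = (\<integral>u. indicator {0..1} u *\<^sub>R (B u * cis (2 * pi * n * u)) \<partial>lborel)"
      by (rule continuous_on_integral_lborel(2)[symmetric]) (intro continuous_intros Bc)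
    also have "\<dots> = (\<integral>u. (\<Sum>\<^sub>\<infinity>j. K j u) \<partial>lborel)"
    proof (rule Bochner_Integration.integral_cong[OF refl])
      fix u :: real
      have "(\<Sum>\<^sub>\<infinity>j. K j u) = (\<Sum>\<^sub>\<infinity>j. b j * cis (2 * pi * j * (x + u)) * (indicator {0..1} u *\<^sub>R cis (2 * pi * n * u)))"
        by (simp add: K_def)
      also have "\<dots> = B u * (indicator {0..1} u *\<^sub>R cis (2 * pi * n * u))"
        unfolding B_def by (rule infsum_cmult_left')
      finally show "indicator {0..1} u *\<^sub>R (B u * cis (2 * pi * n * u)) = (\<Sum>\<^sub>\<infinity>j. K j u)"
        by simp
    qed
    also have "\<dots> = (\<Sum>\<^sub>\<infinity>j. \<integral>u. K j u \<partial>lborel)"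
    proof (rule integral_infsum[OF Ki])
      show "(\<lambda>j. norm (K j u)) summable_on UNIV" for u
        unfolding Kn using summable_on_cmult_right[OF bs, of "indicator {0..1} u"] by simp
      have "(\<integral>u. norm (K j u) \<partial>lborel) = norm (b j)" for j
        unfolding Kn by simp
      thus "(\<lambda>j. \<integral>u. norm (K j u) \<partial>lborel) summable_on UNIV" using bs by simp
    qed
    also have "\<dots> = (\<Sum>\<^sub>\<infinity>j\<in>{-n}. cis (- (2 * pi * n * x)) * b (-n))"
      by (rule infsum_cong_neutral) (auto simp: KI)
    finally have B_eq: "integral {0..1} (\<lambda>u. B u * cis (2 * pi * n * u)) = cis (- (2 * pi * n * x)) * b (-n)"
      by simp
    have "integral {0..1} (\<lambda>u. g u * cis (2 * pi * n * u)) =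
       integral {0..1} (\<lambda>u. A u * cis (2 * pi * n * u)) - integral {0..1} (\<lambda>u. B u * cis (2 * pi * n * u))"
      unfolding g_def left_diff_distrib
      by (intro Henstock_Kurzweil_Integration.integral_diff integrable_continuous_real continuous_intros Ac Bc)
    thus "integral {0..1} (\<lambda>u. g u * cis (2 * pi * n * u)) = 0"
      using A_eq B_eq by simp
  qed
  hence AB: "A 0 = B 0" by (simp add: g_def)
  have "(\<Sum>\<^sub>\<infinity>k::int. complex_of_real (exp (- ((x - k)\<^sup>2 / (4 * s)))) * cis (k * \<theta>)) = (\<Sum>\<^sub>\<infinity>k::int. cis (x * \<theta>) * F (x + 0 - k))"
  proof (intro infsum_cong)
    fix k :: int
    have "cis (k * \<theta>) = cis (x * \<theta>) * cis (- (\<theta> * (x + 0 - k)))"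
      unfolding cis_mult by (simp add: algebra_simps)
    thus "complex_of_real (exp (- ((x - k)\<^sup>2 / (4 * s)))) * cis (k * \<theta>) = cis (x * \<theta>) * F (x + 0 - k)"
      by (simp add: F_def)
  qed
  also have "\<dots> = cis (x * \<theta>) * A 0"
    unfolding A_def by (rule infsum_cmult_right')
  also have "\<dots> = (\<Sum>\<^sub>\<infinity>n::int. cis (x * \<theta>) * (b n * cis (2 * pi * n * (x + 0))))"
    unfolding AB B_def by (rule infsum_cmult_right'[symmetric])
  also have "\<dots> = (\<Sum>\<^sub>\<infinity>n::int. of_real (sqrt (4 * pi * s)) * (complex_of_real (exp (- (s * (\<theta> + 2 * pi * n)\<^sup>2))) * cis (x * (\<theta> + 2 * pi * n))))"
  proof (intro infsum_cong)
    fix n :: int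
    have "cis (x * (\<theta> + 2 * pi * n)) = cis (x * \<theta>) * cis (2 * pi * n * (x + 0))"
      unfolding cis_mult by (simp add: algebra_simps)
    thus "cis (x * \<theta>) * (b n * cis (2 * pi * n * (x + 0))) = of_real (sqrt (4 * pi * s)) *
        (complex_of_real (exp (- (s * (\<theta> + 2 * pi * n)\<^sup>2))) * cis (x * (\<theta> + 2 * pi * n)))"
      by (simp add: b_def)
  qed
  also have "\<dots> = of_real (sqrt (4 * pi * s)) * (\<Sum>\<^sub>\<infinity>n::int. complex_of_real (exp (- (s * (\<theta> + 2 * pi * n)\<^sup>2))) * cis (x * (\<theta> + 2 * pi * n)))"
    by (rule infsum_cmult_right')
  finally show ?thesis .
qed

section \<open>The theta transformation in several variables\<close>

lemma cis_sum: "cis (\<Sum>i\<in>A. f i) = (\<Prod>i\<in>A. cis (f i))"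
  by (induction A rule: infinite_finite_induct) (auto simp flip: cis_mult)

lemma
  fixes y :: "real ^ 'd" and t :: "'d \<Rightarrow> real"
  assumes s: "s > 0"
  shows theta_transform_vec: "(\<Sum>\<^sub>\<infinity>k::int^'d. complex_of_real (exp (- ((\<Sum>i\<in>UNIV. (y $ i - k $ i)\<^sup>2) / (4 * s))))
        * cis (\<Sum>i\<in>UNIV. k $ i * t i))
    = of_real (sqrt (4 * pi * s) ^ CARD('d)) *
      (\<Sum>\<^sub>\<infinity>k::int^'d. complex_of_real (exp (- (s * (\<Sum>i\<in>UNIV. (t i + 2 * pi * k $ i)\<^sup>2))))
        * cis (\<Sum>i\<in>UNIV. y $ i * (t i + 2 * pi * k $ i)))"
    and summable_on_theta_vec: "(\<lambda>k::int^'d. exp (- ((\<Sum>i\<in>UNIV. (y $ i - k $ i)\<^sup>2) / (4 * s)))) summable_on UNIV"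
    and summable_on_theta_vec_dual: "(\<lambda>k::int^'d. exp (- (s * (\<Sum>i\<in>UNIV. (t i + 2 * pi * k $ i)\<^sup>2)))) summable_on UNIV"
proof -
  define f where "f = (\<lambda>i (n::int). complex_of_real (exp (- ((y $ i - n)\<^sup>2 / (4 * s)))) * cis (n * t i))"
  define g where "g = (\<lambda>i (n::int). complex_of_real (exp (- (s * (t i + 2 * pi * n)\<^sup>2))) * cis (y $ i * (t i + 2 * pi * n)))"
  have f: "complex_of_real (exp (- ((\<Sum>i\<in>UNIV. (y $ i - k $ i)\<^sup>2) / (4 * s)))) * cis (\<Sum>i\<in>UNIV. k $ i * t i)
      = (\<Prod>i\<in>UNIV. f i (k $ i))" for k
    by (simp add: f_def cis_sum prod.distrib sum_divide_distrib exp_sum flip: sum_negf)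
  have g: "complex_of_real (exp (- (s * (\<Sum>i\<in>UNIV. (t i + 2 * pi * k $ i)\<^sup>2)))) * cis (\<Sum>i\<in>UNIV. y $ i * (t i + 2 * pi * k $ i))
      = (\<Prod>i\<in>UNIV. g i (k $ i))" for k
    by (simp add: g_def cis_sum prod.distrib sum_distrib_left exp_sum flip: sum_negf)
  have fs: "(\<lambda>n. norm (f i n)) summable_on UNIV" for i
    using summable_on_exp_minus_square[of "1 / (4 * s)" "y $ i"] s by (simp add: f_def norm_mult)
  have gs: "(\<lambda>n. norm (g i n)) summable_on UNIV" for i
  proof -
    have "norm (g i n) = exp (- ((s * (2 * pi)\<^sup>2) * (- t i / (2 * pi) - n)\<^sup>2))" for n :: int
    proof -
      have "s * (t i + 2 * pi * n)\<^sup>2 = (s * (2 * pi)\<^sup>2) * (- t i / (2 * pi) - n)\<^sup>2"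
        by (simp add: power2_eq_square divide_simps) (simp add: algebra_simps)
      thus ?thesis by (simp only: g_def norm_mult norm_of_real norm_cis abs_exp_cancel mult_1_right)
    qed
    thus ?thesis
      using s by (simp only:) (intro summable_on_exp_minus_square, simp)
  qed
  have "(\<Prod>i\<in>UNIV. \<Sum>\<^sub>\<infinity>n. f i n) = (\<Prod>i\<in>UNIV. of_real (sqrt (4 * pi * s)) * (\<Sum>\<^sub>\<infinity>n. g i n))"
    unfolding f_def g_def by (intro prod.cong refl theta_transform s)
  also have "\<dots> = of_real (sqrt (4 * pi * s) ^ CARD('d)) * (\<Prod>i\<in>UNIV. \<Sum>\<^sub>\<infinity>n. g i n)"
    by (simp add: prod.distrib)
  finally show "(\<Sum>\<^sub>\<infinity>k::int^'d. complex_of_real (exp (- ((\<Sum>i\<in>UNIV. (y $ i - k $ i)\<^sup>2) / (4 * s))))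
        * cis (\<Sum>i\<in>UNIV. k $ i * t i))
    = of_real (sqrt (4 * pi * s) ^ CARD('d)) *
      (\<Sum>\<^sub>\<infinity>k::int^'d. complex_of_real (exp (- (s * (\<Sum>i\<in>UNIV. (t i + 2 * pi * k $ i)\<^sup>2))))
        * cis (\<Sum>i\<in>UNIV. y $ i * (t i + 2 * pi * k $ i)))"
    unfolding f g infsum_prod_vec[OF fs] infsum_prod_vec[OF gs] .
  show "(\<lambda>k::int^'d. exp (- ((\<Sum>i\<in>UNIV. (y $ i - k $ i)\<^sup>2) / (4 * s)))) summable_on UNIV"
    using norm_summable_on_prod_vec[of f, OF fs] unfolding f[symmetric] by (simp add: norm_mult)
  show "(\<lambda>k::int^'d. exp (- (s * (\<Sum>i\<in>UNIV. (t i + 2 * pi * k $ i)\<^sup>2)))) summable_on UNIV"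
    using norm_summable_on_prod_vec[of g, OF gs] unfolding g[symmetric] by (simp add: norm_mult)
qed

section \<open>The terms of the Poisson series in a complex tube\<close>

text \<open>The symbol of \<open>h^2\<close> minus the Laplacian at the frequency
  \<open>\<zeta> + 2 * pi * k\<close>. The squares are those of complex numbers, not of moduli: this
  makes it a polynomial in \<open>\<zeta>\<close> but lets it vanish at nonreal points.\<close>

definition shifted_quadric :: "real \<Rightarrow> ('d::finite \<Rightarrow> complex) \<Rightarrow> int ^ 'd \<Rightarrow> complex" where
  "shifted_quadric h \<zeta> k = of_real (h\<^sup>2) + (\<Sum>j\<in>UNIV. (\<zeta> j + of_real (2 * pi * (k $ j)))\<^sup>2)"

definition shifted_wave :: "real ^ 'd \<Rightarrow> ('d::finite \<Rightarrow> complex) \<Rightarrow> int ^ 'd \<Rightarrow> complex" where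
  "shifted_wave y \<zeta> k = exp (\<i> * (\<Sum>j\<in>UNIV. of_real (y $ j) * (\<zeta> j + of_real (2 * pi * (k $ j)))))"

text \<open>The bound 4 only has to exceed \<open>pi\<close>, so that the torus lies in the interior, and be less than
  \<open>2 * pi\<close>, so that the quadrics with \<open>k \<noteq> 0\<close> do not vanish.\<close>

definition tube :: "('d::finite \<Rightarrow> complex) set" where
  "tube = {\<zeta>. (\<forall>j. \<bar>Re (\<zeta> j)\<bar> \<le> 4) \<and> (\<Sum>j\<in>UNIV. (Im (\<zeta> j))\<^sup>2) \<le> 1}"

lemma norm_shifted_wave: "norm (shifted_wave y \<zeta> k) = exp (- (\<Sum>j\<in>UNIV. y $ j * Im (\<zeta> j)))"
  by (simp add: shifted_wave_def)

lemma Re_shifted_quadric: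
  "Re (shifted_quadric h \<zeta> k) = h\<^sup>2 + (\<Sum>j\<in>UNIV. (Re (\<zeta> j) + 2 * pi * (k $ j))\<^sup>2) - (\<Sum>j\<in>UNIV. (Im (\<zeta> j))\<^sup>2)"
  by (simp add: shifted_quadric_def power2_eq_square sum_subtractf)

text \<open>Where \<open>k $ j\<close> is nonzero, \<open>6 < 2 * pi\<close> and the bound 4 on the
  real part keep the shifted real part at distance at least \<open>2 * \<bar>k $ j\<bar>\<close>
  from 0. So the real squares contribute \<open>4 * S\<close>, with \<open>S\<close> the sum of the
  \<open>(k $ j)^2\<close>, the imaginary ones take away at most 1, and \<open>S >= 1\<close> gives
  \<open>1 + S <= 4 * S - 1\<close>. The bound is free of \<open>h\<close>, which the uniformity in
  \<open>h\<close> rests on.\<close>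

lemma shifted_quadric_lower:
  fixes \<zeta> :: "'d::finite \<Rightarrow> complex"
  assumes \<zeta>: "\<zeta> \<in> tube" and k: "k \<noteq> 0"
  shows "1 + (\<Sum>j\<in>UNIV. (real_of_int (k $ j))\<^sup>2) \<le> norm (shifted_quadric h \<zeta> k)"
proof -
  have 1: "4 * (real_of_int (k $ j))\<^sup>2 \<le> (Re (\<zeta> j) + 2 * pi * (k $ j))\<^sup>2" for j
  proof (cases "k $ j = 0")
    case False
    define n where "n = \<bar>real_of_int (k $ j)\<bar>"
    have n: "n \<ge> 1" using False by (simp add: n_def)
    have "2 * n \<le> 6 * n - 4" using n by simp
    also have "\<dots> \<le> 2 * pi * n - \<bar>Re (\<zeta> j)\<bar>"
      using \<zeta> n pi_gt3 by (intro diff_mono mult_right_mono) (auto simp: tube_def)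
    also have "\<dots> \<le> \<bar>Re (\<zeta> j) + 2 * pi * (k $ j)\<bar>"
      using abs_triangle_ineq2[of "2 * pi * (k $ j)" "- Re (\<zeta> j)"] by (simp add: n_def abs_mult add.commute)
    finally have "\<bar>2 * n\<bar> \<le> \<bar>Re (\<zeta> j) + 2 * pi * (k $ j)\<bar>" using n by simp
    hence "(2 * n)\<^sup>2 \<le> (Re (\<zeta> j) + 2 * pi * (k $ j))\<^sup>2" by (simp only: abs_le_square_iff)
    thus ?thesis by (simp add: n_def power_mult_distrib)
  qed simp
  obtain j where j: "k $ j \<noteq> 0" using k by (auto simp: vec_eq_iff)
  have "0 < (k $ j)\<^sup>2" using j by simp
  hence "1 \<le> real_of_int ((k $ j)\<^sup>2)" by linarith
  hence "1 \<le> (real_of_int (k $ j))\<^sup>2" by simp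
  also have "\<dots> \<le> (\<Sum>j\<in>UNIV. (real_of_int (k $ j))\<^sup>2)"
    by (rule member_le_sum) auto
  finally have "1 \<le> (\<Sum>j\<in>UNIV. (real_of_int (k $ j))\<^sup>2)" .
  hence "1 + (\<Sum>j\<in>UNIV. (real_of_int (k $ j))\<^sup>2) \<le> 4 * (\<Sum>j\<in>UNIV. (real_of_int (k $ j))\<^sup>2) - 1"
    by linarith
  also have "\<dots> \<le> h\<^sup>2 + (\<Sum>j\<in>UNIV. (Re (\<zeta> j) + 2 * pi * (k $ j))\<^sup>2) - (\<Sum>j\<in>UNIV. (Im (\<zeta> j))\<^sup>2)"
  proof -
    have "4 * (\<Sum>j\<in>UNIV. (real_of_int (k $ j))\<^sup>2) \<le> (\<Sum>j\<in>UNIV. (Re (\<zeta> j) + 2 * pi * (k $ j))\<^sup>2)"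
      unfolding sum_distrib_left by (intro sum_mono 1)
    moreover have "(\<Sum>j\<in>UNIV. (Im (\<zeta> j))\<^sup>2) \<le> 1"
      using \<zeta> by (simp add: tube_def)
    ultimately show ?thesis
      using zero_le_power2[of h] by linarith
  qed
  also have "\<dots> \<le> norm (shifted_quadric h \<zeta> k)"
    using complex_Re_le_cmod[of "shifted_quadric h \<zeta> k"] by (simp add: Re_shifted_quadric)
  finally show ?thesis .
qed

text \<open>A product majorant for the inverse \<open>m\<close>-th power of \<open>1 + S\<close>,
  with \<open>S\<close> the sum of the \<open>(k $ j)^2\<close>: the power is split into
  \<open>d\<close> equal factors, and in each of them only one coordinate is retained. The exponent
  \<open>m / d\<close> exceeds 1/2 exactly when \<open>m > d / 2\<close>, which makes each factor
  summable over \<open>int\<close>.\<close>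

definition lattice_bound :: "nat \<Rightarrow> int ^ 'd \<Rightarrow> real" where
  "lattice_bound m k = (\<Prod>j\<in>UNIV. (1 + (real_of_int (k $ j))\<^sup>2) powr (- (real m / real CARD('d))))"

lemma summable_on_lattice_bound:
  assumes "real m > real CARD('d::finite) / 2"
  shows "lattice_bound m summable_on (UNIV :: (int ^ 'd) set)"
proof -
  have "(\<lambda>n. norm ((1 + (real_of_int n)\<^sup>2) powr (- (real m / real CARD('d))))) summable_on UNIV"
    using summable_on_one_plus_square_powr[of "real m / real CARD('d)"] assms by (simp add: field_simps)
  hence "(\<lambda>k::int^'d. norm (\<Prod>j\<in>UNIV. (1 + (real_of_int (k $ j))\<^sup>2) powr (- (real m / real CARD('d))))) summable_on UNIV"
    by (intro norm_summable_on_prod_vec)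
  hence "(\<lambda>k::int^'d. \<Prod>j\<in>UNIV. (1 + (real_of_int (k $ j))\<^sup>2) powr (- (real m / real CARD('d)))) summable_on UNIV"
    by (simp add: abs_prod)
  thus ?thesis unfolding lattice_bound_def[abs_def] .
qed

lemma inverse_shifted_quadric_le:
  fixes \<zeta> :: "'d::finite \<Rightarrow> complex"
  assumes "\<zeta> \<in> tube" "k \<noteq> 0"
  shows "inverse (norm (shifted_quadric h \<zeta> k) ^ m) \<le> lattice_bound m k"
proof -
  let ?N = "1 + (\<Sum>j\<in>UNIV. (real_of_int (k $ j))\<^sup>2)"
  have N: "?N > 0" by (intro add_pos_nonneg sum_nonneg) auto
  have "inverse (norm (shifted_quadric h \<zeta> k) ^ m) \<le> inverse (?N ^ m)"
    using shifted_quadric_lower[OF assms] N by (intro le_imp_inverse_le power_mono zero_less_power) auto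
  also have "\<dots> = (\<Prod>j\<in>(UNIV::'d set). ?N powr (- (real m / real CARD('d))))"
    using N by (simp add: powr_realpow[symmetric] powr_powr powr_minus[symmetric] flip: powr_power)
  also have "\<dots> \<le> lattice_bound m k"
    unfolding lattice_bound_def
    by (intro prod_mono conjI powr_mono2' add_left_mono member_le_sum) (auto simp: add_pos_nonneg)
  finally show ?thesis .
qed

section \<open>The Matern kernel as a Gaussian mixture\<close>

lemma integrable_exp_minus_abs:
  fixes b :: real
  assumes "b > 0"
  shows "integrable lborel (\<lambda>u. exp (- (b * \<bar>u\<bar>)))"
proof -
  define g where "g = (\<lambda>u::real. indicator {0..} u *\<^sub>R exp (- b * u))"
  have gm: "g \<in> borel_measurable lborel" unfolding g_def by measurable
  have "integrable lebesgue g"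
    using nonnegative_absolutely_integrable_1[OF integrable_on_exp_minus_to_infinity[OF assms, of 0]]
    by (simp add: set_integrable_def g_def)
  hence g: "integrable lborel g" by (subst (asm) integrable_completion[OF gm])
  have "integrable lborel (\<lambda>u. g u + g (0 + (-1) * u))"
    by (intro Bochner_Integration.integrable_add g lborel_integrable_real_affine) auto
  thus ?thesis
    by (rule Bochner_Integration.integrable_bound) (auto simp: g_def indicator_def abs_if)
qed

text \<open>The Gamma integral in a logarithmic variable. On the left \<open>exp (a * u)\<close>
  decays; on the right \<open>exp u >= u^2 / 2\<close> wins over any linear term. \<open>C\<close>
  is the maximum of \<open>(a + 1) * u - q * u^2 / 2\<close>, and \<open>b = min a 1\<close> is a
  rate valid on both sides.\<close>

lemma integrable_exp_minus_exp:
  fixes a q :: real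
  assumes a: "a > 0" and q: "q > 0"
  shows "integrable lborel (\<lambda>u. exp (a * u - q * exp u))"
proof -
  define b where "b = min a 1"
  define C where "C = (a + 1)\<^sup>2 / (2 * q)"
  have b: "0 < b" "b \<le> a" "b \<le> 1" using a by (auto simp: b_def)
  have C: "C \<ge> 0" using q by (simp add: C_def)
  have "integrable lborel (\<lambda>u. exp C * exp (- (b * \<bar>u\<bar>)))"
    by (intro integrable_mult_right integrable_exp_minus_abs b)
  thus ?thesis
  proof (rule Bochner_Integration.integrable_bound)
    have "a * u - q * exp u \<le> C - b * \<bar>u\<bar>" for u
    proof (cases "u \<ge> 0")
      case True
      have "u\<^sup>2 / 2 \<le> exp u" using exp_lower_Taylor_quadratic[OF True] True by linarith
      hence "q * (u\<^sup>2 / 2) \<le> q * exp u" using q by (intro mult_left_mono) auto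
      moreover have "(a + 1) * u - q * (u\<^sup>2 / 2) \<le> C"
      proof -
        have "0 \<le> (q * u - (a + 1))\<^sup>2 / (2 * q)" using q by simp
        also have "\<dots> = C - ((a + 1) * u - q * (u\<^sup>2 / 2))"
          using q by (simp add: C_def power2_eq_square field_simps)
        finally show ?thesis by simp
      qed
      moreover have "b * u \<le> 1 * u" using b True by (intro mult_right_mono) auto
      ultimately show ?thesis using True by (simp add: distrib_right)
    next
      case False
      have "a * u \<le> b * u" using False b by (intro mult_right_mono_neg) auto
      moreover have "q * exp u \<ge> 0" using q by simp
      moreover have "b * \<bar>u\<bar> = - (b * u)" using False by simp
      ultimately show ?thesis using C by linarith
    qed
    hence "exp (a * u - q * exp u) \<le> exp C * exp (- (b * \<bar>u\<bar>))" for u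
      unfolding exp_add[symmetric] by (simp add: exp_le_cancel_iff)
    thus "AE u in lborel. norm (exp (a * u - q * exp u)) \<le> norm (exp C * exp (- (b * \<bar>u\<bar>)))"
      by simp
  qed measurable
qed

lemma integrable_exp_mixture:
  fixes a q p :: real
  assumes "a > 0" "q > 0" "p \<ge> 0"
  shows "integrable lborel (\<lambda>u. exp (a * u - q * exp u - p * exp (- u)))"
  by (rule Bochner_Integration.integrable_bound[OF integrable_exp_minus_exp[OF assms(1,2)]])
     (use assms(3) in auto)

text \<open>Translation by \<open>- ln q\<close> absorbs \<open>q\<close>. With \<open>a = m\<close>
  this is where the inverse powers of the quadrics in the Poisson series come from; the remaining
  integral is \<open>Gamma a\<close>, of which later only the positivity is used.\<close>

lemma integral_exp_minus_exp_scale: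
  fixes a q :: real
  assumes "q > 0"
  shows "(\<integral>u. exp (a * u - q * exp u) \<partial>lborel) = q powr (-a) * (\<integral>u. exp (a * u - exp u) \<partial>lborel)"
proof -
  have "(\<integral>u. exp (a * u - q * exp u) \<partial>lborel) = (\<integral>u. exp (a * (- ln q + 1 * u) - q * exp (- ln q + 1 * u)) \<partial>lborel)"
    by (subst lborel_integral_real_affine[of 1 _ "- ln q"]) auto
  also have "\<dots> = (\<integral>u. q powr (-a) * exp (a * u - exp u) \<partial>lborel)"
  proof (rule Bochner_Integration.integral_cong[OF refl])
    fix u :: real
    have "q * exp (- ln q + 1 * u) = exp u"
      using assms by (simp add: exp_diff)
    moreover have "exp (a * (- ln q + 1 * u) - exp u) = q powr (-a) * exp (a * u - exp u)"
      using assms by (simp add: powr_def algebra_simps flip: exp_add)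
    ultimately show "exp (a * (- ln q + 1 * u) - q * exp (- ln q + 1 * u)) = q powr (-a) * exp (a * u - exp u)"
      by simp
  qed
  finally show ?thesis by simp
qed

lemma integral_exp_minus_exp_pos:
  fixes a :: real
  assumes "a > 0"
  shows "(\<integral>u. exp (a * u - exp u) \<partial>lborel) > 0"
proof -
  have i: "integrable lborel (\<lambda>u. exp (a * u - exp u))"
    using integrable_exp_minus_exp[OF assms, of 1] by simp
  have "(\<integral>u. exp (a * u - exp u) \<partial>lborel) \<noteq> 0"
  proof
    assume "(\<integral>u. exp (a * u - exp u) \<partial>lborel) = 0"
    hence "AE u in lborel. exp (a * u - exp u) = 0"
      by (subst (asm) integral_nonneg_eq_0_iff_AE[OF i]) auto
    hence "AE u in (lborel :: real measure). False" by simp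
    thus False by (simp add: AE_iff_null null_sets_def)
  qed
  moreover have "(\<integral>u. exp (a * u - exp u) \<partial>lborel) \<ge> 0"
    by (rule Bochner_Integration.integral_nonneg) simp
  ultimately show ?thesis by linarith
qed

text \<open>Folding the line at 0 pairs \<open>exp (\<nu> * t)\<close> with
  \<open>exp (- (\<nu> * t))\<close> into \<open>2 * cosh (\<nu> * t)\<close>. Over the whole line
  the integral can be translated without moving an endpoint, as the mixture formula
  requires.\<close>

lemma bessel_K_symmetric_integral:
  assumes \<nu>: "\<nu> > 0" and z: "z > 0"
  shows "bessel_K \<nu> z = (\<integral>t. exp (\<nu> * t - z / 2 * exp t - z / 2 * exp (- t)) \<partial>lborel) / 2"
proof -
  define J where "J = (\<lambda>t. exp (\<nu> * t - z / 2 * exp t - z / 2 * exp (- t)))"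
  have J: "integrable lborel J"
    unfolding J_def by (rule integrable_exp_mixture) (use \<nu> z in auto)
  have J': "integrable lborel (\<lambda>t. J (0 + (-1) * t))"
    by (rule lborel_integrable_real_affine[OF J]) simp
  have Jm: "J \<in> borel_measurable lborel" using J by auto
  have "(\<integral>t. J t \<partial>lborel) = (\<integral>t. indicator {0..} t *\<^sub>R J t + indicator {..<0} t *\<^sub>R J t \<partial>lborel)"
    by (rule Bochner_Integration.integral_cong) (auto simp: indicator_def)
  also have "\<dots> = (\<integral>t. indicator {0..} t *\<^sub>R J t \<partial>lborel) + (\<integral>t. indicator {..<0} t *\<^sub>R J t \<partial>lborel)"
    by (intro Bochner_Integration.integral_add integrable_mult_indicator J) auto
  also have "(\<integral>t. indicator {..<0} t *\<^sub>R J t \<partial>lborel) = (\<integral>t. indicator {..<0} (0 + (-1) * t) *\<^sub>R J (0 + (-1) * t) \<partial>lborel)"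
    by (subst lborel_integral_real_affine[of "-1" _ 0]) auto
  also have "\<dots> = (\<integral>t. indicator {0..} t *\<^sub>R J (0 + (-1) * t) \<partial>lborel)"
  proof (rule integral_cong_AE)
    have "AE t in lborel. t \<noteq> (0::real)" by (rule AE_lborel_singleton)
    thus "AE t in lborel. indicator {..<0} (0 + (-1) * t) *\<^sub>R J (0 + (-1) * t) = indicator {0..} t *\<^sub>R J (0 + (-1) * t)"
      by eventually_elim (auto simp: indicator_def)
  qed (use Jm in measurable)
  also have "(\<integral>t. indicator {0..} t *\<^sub>R J t \<partial>lborel) + \<dots> = (\<integral>t. indicator {0..} t *\<^sub>R J t + indicator {0..} t *\<^sub>R J (0 + (-1) * t) \<partial>lborel)"
    by (intro Bochner_Integration.integral_add[symmetric] integrable_mult_indicator J J') auto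
  also have "\<dots> = (\<integral>t. 2 * (indicator {0..} t *\<^sub>R (exp (- z * cosh t) * cosh (\<nu> * t))) \<partial>lborel)"
  proof (rule Bochner_Integration.integral_cong[OF refl])
    fix t :: real
    have "J t = exp (- z * cosh t) * exp (\<nu> * t)" "J (0 + (-1) * t) = exp (- z * cosh t) * exp (- (\<nu> * t))"
      unfolding J_def exp_add[symmetric] by (simp_all add: cosh_def algebra_simps)
    moreover have "cosh (\<nu> * t) = (exp (\<nu> * t) + exp (- (\<nu> * t))) / 2"
      by (simp add: cosh_def)
    moreover from this have "exp (\<nu> * t) + exp (- (\<nu> * t)) = 2 * cosh (\<nu> * t)" by simp
    ultimately have "J t + J (0 + (-1) * t) = exp (- z * cosh t) * (2 * cosh (\<nu> * t))"
      by (simp only: distrib_left[symmetric])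
    hence "J t + J (0 + (-1) * t) = 2 * (exp (- z * cosh t) * cosh (\<nu> * t))"
      by simp
    thus "indicator {0..} t *\<^sub>R J t + indicator {0..} t *\<^sub>R J (0 + (-1) * t)
        = 2 * (indicator {0..} t *\<^sub>R (exp (- z * cosh t) * cosh (\<nu> * t)))"
      by (simp only: scaleR_add_right[symmetric]) simp
  qed
  also have "\<dots> = 2 * bessel_K \<nu> z"
    by (simp add: bessel_K_def set_lebesgue_integral_def)
  finally show ?thesis by (simp add: J_def)
qed

text \<open>Translating the Bessel integral by \<open>ln (2 * h / \<rho>)\<close> turns it into an integral over Gaussians in
  \<open>\<rho>\<close>, parametrised by \<open>exp u\<close>, in which \<open>h\<close> only enters the weight.\<close>

lemma matern_profile_mixture:
  assumes \<nu>: "\<nu> > 0" and h: "h > 0" and \<rho>: "\<rho> > 0"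
  shows "matern_profile \<nu> (h * \<rho>) = (2 * h\<^sup>2) powr \<nu> / 2 *
     (\<integral>u. exp (\<nu> * u - h\<^sup>2 * exp u - \<rho>\<^sup>2 / 4 * exp (- u)) \<partial>lborel)"
proof -
  define c where "c = ln (2 * h / \<rho>)"
  have ec: "exp c = 2 * h / \<rho>" "exp (- c) = \<rho> / (2 * h)"
    using h \<rho> by (simp_all add: c_def exp_minus)
  have "(\<integral>t. exp (\<nu> * t - h * \<rho> / 2 * exp t - h * \<rho> / 2 * exp (- t)) \<partial>lborel)
     = (\<integral>u. exp (\<nu> * (c + 1 * u) - h * \<rho> / 2 * exp (c + 1 * u) - h * \<rho> / 2 * exp (- (c + 1 * u))) \<partial>lborel)"
    by (subst lborel_integral_real_affine[of 1 _ c]) auto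
  also have "\<dots> = (\<integral>u. (2 * h / \<rho>) powr \<nu> * exp (\<nu> * u - h\<^sup>2 * exp u - \<rho>\<^sup>2 / 4 * exp (- u)) \<partial>lborel)"
  proof (rule Bochner_Integration.integral_cong[OF refl])
    fix u :: real
    have e1: "h * \<rho> / 2 * exp (c + 1 * u) = h\<^sup>2 * exp u"
      using \<rho> by (simp add: exp_add ec power2_eq_square)
    have "- (c + 1 * u) = - c + - u" by simp
    hence e2: "h * \<rho> / 2 * exp (- (c + 1 * u)) = \<rho>\<^sup>2 / 4 * exp (- u)"
      using h by (simp only: exp_add ec) (simp add: power2_eq_square)
    have e3: "(2 * h / \<rho>) powr \<nu> = exp (\<nu> * c)"
      using h \<rho> by (simp add: powr_def c_def)
    show "exp (\<nu> * (c + 1 * u) - h * \<rho> / 2 * exp (c + 1 * u) - h * \<rho> / 2 * exp (- (c + 1 * u)))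
      = (2 * h / \<rho>) powr \<nu> * exp (\<nu> * u - h\<^sup>2 * exp u - \<rho>\<^sup>2 / 4 * exp (- u))"
      unfolding e1 e2 e3 exp_add[symmetric] by (simp add: algebra_simps)
  qed
  also have "\<dots> = (2 * h / \<rho>) powr \<nu> * (\<integral>u. exp (\<nu> * u - h\<^sup>2 * exp u - \<rho>\<^sup>2 / 4 * exp (- u)) \<partial>lborel)"
    by simp
  finally have "matern_profile \<nu> (h * \<rho>) = (h * \<rho>) powr \<nu> * (2 * h / \<rho>) powr \<nu> / 2 *
     (\<integral>u. exp (\<nu> * u - h\<^sup>2 * exp u - \<rho>\<^sup>2 / 4 * exp (- u)) \<partial>lborel)"
    using bessel_K_symmetric_integral[OF \<nu>, of "h * \<rho>"] h \<rho>
    by (simp add: matern_profile_def)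
  also have "(h * \<rho>) powr \<nu> * (2 * h / \<rho>) powr \<nu> = (2 * h\<^sup>2) powr \<nu>"
    using h \<rho> by (simp add: powr_mult[symmetric] power2_eq_square mult.left_commute)
  finally show ?thesis .
qed

text \<open>For \<open>h = 1\<close> the mixture depends on \<open>r\<close> only through a Gaussian
  factor bounded by 1, so dominated convergence applies. The limit is the mixture integral at
  \<open>\<rho> = 0\<close>, so that one formula will cover the origin as well.\<close>

lemma Lim_matern_profile:
  assumes \<nu>: "\<nu> > 0"
  shows "Lim (at_right 0) (matern_profile \<nu>) = 2 powr \<nu> / 2 * (\<integral>u. exp (\<nu> * u - exp u) \<partial>lborel)"
proof -
  have "((\<lambda>r. matern_profile \<nu> r) \<longlongrightarrow> 2 powr \<nu> / 2 * (\<integral>u. exp (\<nu> * u - exp u) \<partial>lborel)) (at_right 0)"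
  proof (rule tendsto_at_right_sequentially[of 0 1])
    fix S :: "nat \<Rightarrow> real"
    assume S: "\<And>n. 0 < S n" "S \<longlonglongrightarrow> 0"
    have eq: "matern_profile \<nu> (S n) = 2 powr \<nu> / 2 * (\<integral>u. exp (\<nu> * u - exp u - (S n)\<^sup>2 / 4 * exp (- u)) \<partial>lborel)" for n
      using matern_profile_mixture[OF \<nu>, of 1 "S n"] S(1) by simp
    have "(\<lambda>n. \<integral>u. exp (\<nu> * u - exp u - (S n)\<^sup>2 / 4 * exp (- u)) \<partial>lborel) \<longlonglongrightarrow> (\<integral>u. exp (\<nu> * u - exp u) \<partial>lborel)"
    proof (rule integral_dominated_convergence)
      show "integrable lborel (\<lambda>u. exp (\<nu> * u - exp u))"
        using integrable_exp_minus_exp[OF \<nu>, of 1] by simp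
      have "(\<lambda>n. exp (\<nu> * u - exp u - (S n)\<^sup>2 / 4 * exp (- u))) \<longlonglongrightarrow> exp (\<nu> * u - exp u - 0\<^sup>2 / 4 * exp (- u))" for u
        by (intro tendsto_intros S) simp
      thus "AE u in lborel. (\<lambda>n. exp (\<nu> * u - exp u - (S n)\<^sup>2 / 4 * exp (- u))) \<longlonglongrightarrow> exp (\<nu> * u - exp u)"
        by simp
    qed auto
    thus "(\<lambda>n. matern_profile \<nu> (S n)) \<longlonglongrightarrow> 2 powr \<nu> / 2 * (\<integral>u. exp (\<nu> * u - exp u) \<partial>lborel)"
      unfolding eq by (intro tendsto_mult_left)
  qed simp
  thus ?thesis by (intro tendsto_Lim) auto
qed

lemma scaled_matern_mixture:
  fixes x :: "real ^ 'd"
  assumes h: "h > 0" and \<nu>: "\<nu> = real m - real CARD('d) / 2" "\<nu> > 0"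
  shows "scaled_matern m h x = (2 * h\<^sup>2) powr \<nu> / 2 *
     (\<integral>u. exp (\<nu> * u - h\<^sup>2 * exp u - (norm x)\<^sup>2 / 4 * exp (- u)) \<partial>lborel)"
proof (cases "x = 0")
  case True
  \<comment> \<open>At the origin the kernel does not depend on \<open>h\<close>: rescaling the
    Gamma integral cancels \<open>h\<close> in the prefactor.\<close>
  have "(2 * h\<^sup>2) powr \<nu> * (h\<^sup>2) powr (- \<nu>) = 2 powr \<nu>"
    using h by (simp add: powr_mult powr_minus)
  thus ?thesis
    using integral_exp_minus_exp_scale[of "h\<^sup>2" \<nu>] h True \<nu>
    by (simp add: scaled_matern_def matern_def Let_def Lim_matern_profile mult.assoc[symmetric])
next
  case False
  thus ?thesis
    using matern_profile_mixture[OF \<nu>(2) h, of "norm x"] h \<nu>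
    by (simp add: scaled_matern_def matern_def Let_def)
qed

section \<open>Poisson summation for the scaled kernel\<close>

lemma infsum_of_real_complex: "f summable_on A \<Longrightarrow> (\<Sum>\<^sub>\<infinity>k\<in>A. complex_of_real (f k)) = of_real (\<Sum>\<^sub>\<infinity>k\<in>A. f k)"
  by (rule infsumI, rule has_sum_of_real, rule has_sum_infsum)

lemma summable_on_inverse_shifted_quadric:
  fixes \<zeta> :: "'d::finite \<Rightarrow> complex"
  assumes "real m > real CARD('d) / 2" "\<zeta> \<in> tube"
  shows "(\<lambda>k. inverse (norm (shifted_quadric h \<zeta> k) ^ m)) summable_on UNIV"
proof -
  have "(\<lambda>k. inverse (norm (shifted_quadric h \<zeta> k) ^ m)) summable_on UNIV - {0}"
    by (rule summable_on_comparison_test[OF summable_on_subset_banach[OF summable_on_lattice_bound[OF assms(1)]]])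
       (use inverse_shifted_quadric_le[OF assms(2)] in auto)
  hence "(\<lambda>k. inverse (norm (shifted_quadric h \<zeta> k) ^ m)) summable_on insert 0 (UNIV - {0})"
    by (subst summable_on_insert_iff) auto
  thus ?thesis by (simp add: insert_absorb)
qed

lemma of_real_mem_tube: "(\<And>j. \<bar>t j\<bar> \<le> 4) \<Longrightarrow> (\<lambda>j. complex_of_real (t j)) \<in> tube"
  by (simp add: tube_def)

lemma shifted_quadric_of_real:
  "shifted_quadric h (\<lambda>j. of_real (t j)) k = of_real (h\<^sup>2 + (\<Sum>j\<in>UNIV. (t j + 2 * pi * (k $ j))\<^sup>2))"
  by (simp add: shifted_quadric_def)

lemma shifted_wave_of_real:
  "shifted_wave y (\<lambda>j. of_real (t j)) k = cis (\<Sum>j\<in>UNIV. y $ j * (t j + 2 * pi * (k $ j)))"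
  by (simp add: shifted_wave_def cis_conv_exp)

lemma norm_diff_lattice_point:
  fixes y :: "real ^ 'd"
  shows "(norm (y - lattice_point k))\<^sup>2 = (\<Sum>i\<in>UNIV. (y $ i - k $ i)\<^sup>2)"
  unfolding power2_norm_eq_inner inner_vec_def lattice_point_def by (simp add: power2_eq_square)

text \<open>The theta formula at width \<open>exp u\<close>. Its factor
  \<open>sqrt (4 * pi * exp u) ^ CARD('d)\<close> supplies \<open>exp (d / 2 * u)\<close>, which
  raises the exponent from \<open>\<nu> = m - d / 2\<close> to \<open>m\<close>; this is how the
  integer power of the quadric arises.\<close>

lemma matern_mixture_theta:
  fixes y :: "real ^ 'd" and t :: "'d \<Rightarrow> real" and h u \<nu> :: real
  assumes \<nu>: "\<nu> = real m - real CARD('d) / 2"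
  shows "(\<Sum>\<^sub>\<infinity>k::int^'d. complex_of_real (exp (\<nu> * u - h\<^sup>2 * exp u - (norm (y - lattice_point k))\<^sup>2 / 4 * exp (- u)))
            * cis (\<Sum>i\<in>UNIV. k $ i * t i))
      = of_real (sqrt (4 * pi) ^ CARD('d)) *
        (\<Sum>\<^sub>\<infinity>k::int^'d. complex_of_real (exp (real m * u - (h\<^sup>2 + (\<Sum>i\<in>UNIV. (t i + 2 * pi * k $ i)\<^sup>2)) * exp u))
            * cis (\<Sum>i\<in>UNIV. y $ i * (t i + 2 * pi * k $ i)))"
    and "(\<lambda>k::int^'d. exp (\<nu> * u - h\<^sup>2 * exp u - (norm (y - lattice_point k))\<^sup>2 / 4 * exp (- u))) summable_on UNIV"
    and "(\<lambda>k::int^'d. exp (real m * u - (h\<^sup>2 + (\<Sum>i\<in>UNIV. (t i + 2 * pi * k $ i)\<^sup>2)) * exp u)) summable_on UNIV"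
proof -
  define E where "E = exp (\<nu> * u - h\<^sup>2 * exp u)"
  have G: "exp (\<nu> * u - h\<^sup>2 * exp u - (norm (y - lattice_point k))\<^sup>2 / 4 * exp (- u))
      = E * exp (- ((\<Sum>i\<in>UNIV. (y $ i - k $ i)\<^sup>2) / (4 * exp u)))" for k :: "int^'d"
  proof -
    have "(norm (y - lattice_point k))\<^sup>2 / 4 * exp (- u) = (\<Sum>i\<in>UNIV. (y $ i - k $ i)\<^sup>2) / (4 * exp u)"
      by (simp only: norm_diff_lattice_point exp_minus) (simp add: field_simps)
    thus ?thesis
      by (simp only: E_def exp_add[symmetric] diff_conv_add_uminus)
  qed
  have sq: "sqrt (4 * pi * exp u) ^ CARD('d) = sqrt (4 * pi) ^ CARD('d) * exp (real CARD('d) / 2 * u)"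
  proof -
    have "sqrt (exp u) = exp (u / 2)"
      using exp_double[of "u / 2"] by (intro real_sqrt_unique) auto
    moreover have "exp (u / 2) ^ CARD('d) = exp (real CARD('d) / 2 * u)"
      by (simp add: exp_of_nat_mult[symmetric])
    ultimately show ?thesis by (simp only: real_sqrt_mult power_mult_distrib)
  qed
  have R: "exp (real m * u - (h\<^sup>2 + Q) * exp u) = E * exp (real CARD('d) / 2 * u) * exp (- (exp u * Q))" for Q
    unfolding E_def exp_add[symmetric] by (simp add: \<nu> algebra_simps)
  show "(\<lambda>k::int^'d. exp (\<nu> * u - h\<^sup>2 * exp u - (norm (y - lattice_point k))\<^sup>2 / 4 * exp (- u))) summable_on UNIV"
    unfolding G by (intro summable_on_cmult_right summable_on_theta_vec) simp
  show "(\<lambda>k::int^'d. exp (real m * u - (h\<^sup>2 + (\<Sum>i\<in>UNIV. (t i + 2 * pi * k $ i)\<^sup>2)) * exp u)) summable_on UNIV"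
    unfolding R by (intro summable_on_cmult_right summable_on_theta_vec_dual) simp
  have "(\<Sum>\<^sub>\<infinity>k::int^'d. complex_of_real (exp (\<nu> * u - h\<^sup>2 * exp u - (norm (y - lattice_point k))\<^sup>2 / 4 * exp (- u)))
            * cis (\<Sum>i\<in>UNIV. k $ i * t i))
      = of_real E * (\<Sum>\<^sub>\<infinity>k::int^'d. complex_of_real (exp (- ((\<Sum>i\<in>UNIV. (y $ i - k $ i)\<^sup>2) / (4 * exp u))))
            * cis (\<Sum>i\<in>UNIV. k $ i * t i))"
    unfolding G by (simp add: mult.assoc infsum_cmult_right')
  also have "\<dots> = of_real (sqrt (4 * pi) ^ CARD('d)) *
     (of_real (E * exp (real CARD('d) / 2 * u)) * (\<Sum>\<^sub>\<infinity>k::int^'d. complex_of_real (exp (- (exp u * (\<Sum>i\<in>UNIV. (t i + 2 * pi * k $ i)\<^sup>2))))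
        * cis (\<Sum>i\<in>UNIV. y $ i * (t i + 2 * pi * k $ i))))"
    by (subst theta_transform_vec) (simp_all add: sq del: of_real_power)
  also have "of_real (E * exp (real CARD('d) / 2 * u)) * (\<Sum>\<^sub>\<infinity>k::int^'d. complex_of_real (exp (- (exp u * (\<Sum>i\<in>UNIV. (t i + 2 * pi * k $ i)\<^sup>2))))
        * cis (\<Sum>i\<in>UNIV. y $ i * (t i + 2 * pi * k $ i)))
     = (\<Sum>\<^sub>\<infinity>k::int^'d. complex_of_real (exp (real m * u - (h\<^sup>2 + (\<Sum>i\<in>UNIV. (t i + 2 * pi * k $ i)\<^sup>2)) * exp u))
            * cis (\<Sum>i\<in>UNIV. y $ i * (t i + 2 * pi * k $ i)))"
    unfolding R by (simp add: mult.assoc infsum_cmult_right')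
  finally show "(\<Sum>\<^sub>\<infinity>k::int^'d. complex_of_real (exp (\<nu> * u - h\<^sup>2 * exp u - (norm (y - lattice_point k))\<^sup>2 / 4 * exp (- u)))
            * cis (\<Sum>i\<in>UNIV. k $ i * t i))
      = of_real (sqrt (4 * pi) ^ CARD('d)) *
        (\<Sum>\<^sub>\<infinity>k::int^'d. complex_of_real (exp (real m * u - (h\<^sup>2 + (\<Sum>i\<in>UNIV. (t i + 2 * pi * k $ i)\<^sup>2)) * exp u))
            * cis (\<Sum>i\<in>UNIV. y $ i * (t i + 2 * pi * k $ i)))" .
qed

lemma matern_dual_integrals:
  fixes t :: "'d::finite \<Rightarrow> real" and h :: real
  assumes dm: "real m > real CARD('d) / 2" and h: "h > 0" and t: "\<And>j. \<bar>t j\<bar> \<le> 4"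
  defines "q \<equiv> \<lambda>k::int^'d. h\<^sup>2 + (\<Sum>i\<in>UNIV. (t i + 2 * pi * k $ i)\<^sup>2)"
  shows "integrable lborel (\<lambda>u. exp (real m * u - q k * exp u))"
    and "(\<integral>u. exp (real m * u - q k * exp u) \<partial>lborel) = (\<integral>u. exp (real m * u - exp u) \<partial>lborel) / q k ^ m"
    and "(\<lambda>k. \<integral>u. exp (real m * u - q k * exp u) \<partial>lborel) summable_on UNIV"
proof -
  have m: "real m > 0" using dm by (rule order.strict_trans1[rotated]) simp
  have q: "q k > 0" for k unfolding q_def using h by (intro add_pos_nonneg sum_nonneg) auto
  have qe: "h\<^sup>2 + (\<Sum>i\<in>UNIV. (t i + 2 * pi * k $ i)\<^sup>2) = q k" for k
    by (simp add: q_def)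
  show "integrable lborel (\<lambda>u. exp (real m * u - q k * exp u))" for k
    by (rule integrable_exp_minus_exp[OF m q])
  show W: "(\<integral>u. exp (real m * u - q k * exp u) \<partial>lborel) = (\<integral>u. exp (real m * u - exp u) \<partial>lborel) / q k ^ m" for k
    using q[of k] by (subst integral_exp_minus_exp_scale[OF q]) (simp add: powr_minus powr_realpow divide_inverse mult.commute)
  have "(\<lambda>k. inverse (q k ^ m)) summable_on UNIV"
    using summable_on_inverse_shifted_quadric[OF dm of_real_mem_tube[of t], of h] t q
    unfolding shifted_quadric_of_real norm_of_real by (simp add: qe abs_of_pos)
  from summable_on_cmult_right[OF this, of "\<integral>u. exp (real m * u - exp u) \<partial>lborel"]
  show "(\<lambda>k. \<integral>u. exp (real m * u - q k * exp u) \<partial>lborel) summable_on UNIV"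
    unfolding W divide_inverse .
qed

text \<open>For each \<open>u\<close> the theta formula at \<open>t = 0\<close> bounds the sum of
  the Gaussians by \<open>D\<close> times the dual sum, which is integrable in \<open>u\<close>.
  This bounds all finite sums of kernel values without any asymptotics of the Bessel
  function.\<close>

lemma summable_on_scaled_matern:
  fixes y :: "real ^ 'd"
  assumes dm: "real m > real CARD('d) / 2" and h: "h > 0"
  shows "(\<lambda>k. scaled_matern m h (y - lattice_point k)) summable_on UNIV"
    and "scaled_matern m h y \<ge> 0"
proof -
  define \<nu> where "\<nu> = real m - real CARD('d) / 2"
  have \<nu>: "\<nu> > 0" using dm by (simp add: \<nu>_def)
  note mix = scaled_matern_mixture[OF h \<nu>_def \<nu>]
  show "scaled_matern m h y \<ge> 0"
    unfolding mix by (intro mult_nonneg_nonneg Bochner_Integration.integral_nonneg) auto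
  define G where "G = (\<lambda>k u. exp (\<nu> * u - h\<^sup>2 * exp u - (norm (y - lattice_point k))\<^sup>2 / 4 * exp (- u)))"
  define R where "R = (\<lambda>(k::int^'d) u. exp (real m * u - (h\<^sup>2 + (\<Sum>i\<in>UNIV. ((0::real) + 2 * pi * k $ i)\<^sup>2)) * exp u))"
  have Gi: "integrable lborel (G k)" for k
    unfolding G_def by (rule integrable_exp_mixture) (use h \<nu> in auto)
  note dual = matern_dual_integrals[OF dm h, of "\<lambda>_. 0", simplified abs_zero, folded R_def]
  have Rs: "(\<lambda>k. norm (R k u)) summable_on UNIV" for u
    using matern_mixture_theta(3)[OF \<nu>_def, of u h "\<lambda>_. 0"] by (simp add: R_def)
  have Ri: "integrable lborel (R k)" for k using dual(1)[of k] by (simp add: R_def)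
  have RI: "integrable lborel (\<lambda>u. \<Sum>\<^sub>\<infinity>k. R k u)"
  proof (rule integrable_infsum[OF Ri Rs])
    show "(\<lambda>k. \<integral>u. norm (R k u) \<partial>lborel) summable_on UNIV"
      using dual(3) by (simp add: R_def)
  qed
  define D where "D = sqrt (4 * pi) ^ CARD('d)"
  have D0: "D \<ge> 0" by (simp add: D_def)
  have GR: "(\<Sum>\<^sub>\<infinity>k. G k u) \<le> D * (\<Sum>\<^sub>\<infinity>k. R k u)" for u
  proof -
    have Gs: "(\<lambda>k. G k u) summable_on UNIV"
      using matern_mixture_theta(2)[OF \<nu>_def] unfolding G_def .
    have "of_real (\<Sum>\<^sub>\<infinity>k. G k u) = (\<Sum>\<^sub>\<infinity>k::int^'d. complex_of_real (G k u) * cis (\<Sum>i\<in>UNIV. k $ i * (0::real)))"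
      by (simp add: infsum_of_real_complex[OF Gs] cis_zero)
    also have "\<dots> = of_real D * (\<Sum>\<^sub>\<infinity>k::int^'d. complex_of_real (R k u) * cis (\<Sum>i\<in>UNIV. y $ i * ((0::real) + 2 * pi * k $ i)))"
      unfolding G_def R_def D_def by (rule matern_mixture_theta(1)[OF \<nu>_def])
    finally have "norm (complex_of_real (\<Sum>\<^sub>\<infinity>k. G k u)) = D * norm (\<Sum>\<^sub>\<infinity>k::int^'d. complex_of_real (R k u) * cis (\<Sum>i\<in>UNIV. y $ i * ((0::real) + 2 * pi * k $ i)))"
      using D0 by (simp add: norm_mult)
    also have "norm (\<Sum>\<^sub>\<infinity>k::int^'d. complex_of_real (R k u) * cis (\<Sum>i\<in>UNIV. y $ i * ((0::real) + 2 * pi * k $ i))) \<le> (\<Sum>\<^sub>\<infinity>k. R k u)"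
      using norm_infsum_bound[of "\<lambda>k::int^'d. complex_of_real (R k u) * cis (\<Sum>i\<in>UNIV. y $ i * ((0::real) + 2 * pi * k $ i))" UNIV] Rs[of u]
      by (simp add: norm_mult R_def)
    finally show ?thesis using D0 by (simp add: mult_left_mono)
  qed
  have "(\<lambda>k. \<integral>u. G k u \<partial>lborel) summable_on UNIV"
  proof (rule nonneg_bdd_above_summable_on)
    show "(\<integral>u. G k u \<partial>lborel) \<ge> 0" for k
      by (rule Bochner_Integration.integral_nonneg) (simp add: G_def)
    show "bdd_above (sum (\<lambda>k. \<integral>u. G k u \<partial>lborel) ` {F. F \<subseteq> UNIV \<and> finite F})"
    proof (rule bdd_aboveI2)
      fix F :: "(int^'d) set" assume F: "F \<in> {F. F \<subseteq> UNIV \<and> finite F}"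
      have "(\<Sum>k\<in>F. \<integral>u. G k u \<partial>lborel) = (\<integral>u. (\<Sum>k\<in>F. G k u) \<partial>lborel)"
        by (rule Bochner_Integration.integral_sum[symmetric]) (rule Gi)
      also have "\<dots> \<le> (\<integral>u. D * (\<Sum>\<^sub>\<infinity>k. R k u) \<partial>lborel)"
      proof (rule integral_mono)
        fix u
        have "(\<Sum>k\<in>F. G k u) \<le> (\<Sum>\<^sub>\<infinity>k. G k u)"
          by (rule finite_sum_le_infsum) (use F matern_mixture_theta(2)[OF \<nu>_def] in \<open>auto simp: G_def\<close>)
        thus "(\<Sum>k\<in>F. G k u) \<le> D * (\<Sum>\<^sub>\<infinity>k. R k u)" using GR by (rule order_trans)
      qed (use Gi RI in auto)
      finally show "(\<Sum>k\<in>F. \<integral>u. G k u \<partial>lborel) \<le> (\<integral>u. D * (\<Sum>\<^sub>\<infinity>k. R k u) \<partial>lborel)" .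
    qed
  qed
  thus "(\<lambda>k. scaled_matern m h (y - lattice_point k)) summable_on UNIV"
    unfolding mix G_def by (intro summable_on_cmult_right)
qed

text \<open>The theta formula is integrated over \<open>u\<close>, with sum and integral exchanged
  on both sides. The order of the quantifiers matters: \<open>C\<close> may depend on
  \<open>h\<close> but not on \<open>y\<close> and \<open>t\<close>, so it cancels in the quotient
  that represents the Lagrange function.\<close>

lemma matern_poisson_summation:
  assumes dm: "real m > real CARD('d::finite) / 2" and h: "h > 0"
  shows "\<exists>C > 0. \<forall>(y :: real ^ 'd) (t :: 'd \<Rightarrow> real). (\<forall>j. \<bar>t j\<bar> \<le> 4) \<longrightarrow>
      (\<Sum>\<^sub>\<infinity>k. of_real (scaled_matern m h (y - lattice_point k)) * cis (\<Sum>i\<in>UNIV. k $ i * t i))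
      = of_real C * (\<Sum>\<^sub>\<infinity>k. shifted_wave y (\<lambda>j. of_real (t j)) k / shifted_quadric h (\<lambda>j. of_real (t j)) k ^ m)"
proof -
  define \<nu> where "\<nu> = real m - real CARD('d) / 2"
  have \<nu>: "\<nu> > 0" using dm by (simp add: \<nu>_def)
  have m: "real m > 0" using dm by (rule order.strict_trans1[rotated]) simp
  define c where "c = (2 * h\<^sup>2) powr \<nu> / 2"
  define D where "D = sqrt (4 * pi) ^ CARD('d)"
  define W where "W = (\<integral>u. exp (real m * u - exp u) \<partial>lborel)"
  have pos: "c > 0" "D > 0" "W > 0"
    using h integral_exp_minus_exp_pos[OF m] by (auto simp: c_def D_def W_def)
  show ?thesis
  proof (intro exI[of _ "c * D * W"] conjI allI impI)
    show "c * D * W > 0" using pos by simp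
    fix y :: "real ^ 'd" and t :: "'d \<Rightarrow> real"
    assume "\<forall>j. \<bar>t j\<bar> \<le> 4"
    hence t: "\<And>j. \<bar>t j\<bar> \<le> 4" by blast
    define G where "G = (\<lambda>k u. exp (\<nu> * u - h\<^sup>2 * exp u - (norm (y - lattice_point k))\<^sup>2 / 4 * exp (- u)))"
    define q where "q = (\<lambda>k::int^'d. h\<^sup>2 + (\<Sum>i\<in>UNIV. (t i + 2 * pi * k $ i)\<^sup>2))"
    define R where "R = (\<lambda>k u. exp (real m * u - q k * exp u))"
    define e where "e = (\<lambda>k::int^'d. cis (\<Sum>i\<in>UNIV. k $ i * t i))"
    define w where "w = (\<lambda>k::int^'d. cis (\<Sum>i\<in>UNIV. y $ i * (t i + 2 * pi * k $ i)))"
    have mix: "scaled_matern m h (y - lattice_point k) = c * (\<integral>u. G k u \<partial>lborel)" for k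
      unfolding c_def G_def by (rule scaled_matern_mixture[OF h \<nu>_def \<nu>])
    have Gi: "integrable lborel (G k)" for k
      unfolding G_def by (rule integrable_exp_mixture) (use h \<nu> in auto)
    have Gs: "(\<lambda>k. G k u) summable_on UNIV" for u
      using matern_mixture_theta(2)[OF \<nu>_def] unfolding G_def .
    have GS: "(\<lambda>k. \<integral>u. G k u \<partial>lborel) summable_on UNIV"
      using summable_on_cmult_right[OF summable_on_scaled_matern(1)[OF dm h, of y], of "1 / c"] pos
      by (simp add: mix)
    have Rs: "(\<lambda>k. R k u) summable_on UNIV" for u
      using matern_mixture_theta(3)[OF \<nu>_def] unfolding R_def q_def .
    have Ri: "integrable lborel (R k)" for k
      unfolding R_def q_def by (rule matern_dual_integrals(1)[OF dm h t])
    have RS: "(\<lambda>k. \<integral>u. R k u \<partial>lborel) summable_on UNIV"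
      unfolding R_def q_def by (rule matern_dual_integrals(3)[OF dm h t])
    have "(\<Sum>\<^sub>\<infinity>k. of_real (scaled_matern m h (y - lattice_point k)) * cis (\<Sum>i\<in>UNIV. k $ i * t i))
        = of_real c * (\<Sum>\<^sub>\<infinity>k. \<integral>u. of_real (G k u) * e k \<partial>lborel)"
      unfolding mix e_def by (simp add: mult.assoc infsum_cmult_right')
    also have "(\<Sum>\<^sub>\<infinity>k. \<integral>u. of_real (G k u) * e k \<partial>lborel) = (\<integral>u. (\<Sum>\<^sub>\<infinity>k. of_real (G k u) * e k) \<partial>lborel)"
      by (rule integral_infsum[symmetric])
         (use Gi Gs GS in \<open>auto simp: e_def norm_mult G_def\<close>)
    also have "\<dots> = (\<integral>u. of_real D * (\<Sum>\<^sub>\<infinity>k. of_real (R k u) * w k) \<partial>lborel)"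
      unfolding G_def R_def q_def e_def w_def D_def
      by (rule Bochner_Integration.integral_cong[OF refl]) (rule matern_mixture_theta(1)[OF \<nu>_def])
    also have "\<dots> = of_real D * (\<integral>u. (\<Sum>\<^sub>\<infinity>k. of_real (R k u) * w k) \<partial>lborel)"
      by (rule integral_mult_right_zero)
    also have "(\<integral>u. (\<Sum>\<^sub>\<infinity>k. of_real (R k u) * w k) \<partial>lborel) = (\<Sum>\<^sub>\<infinity>k. \<integral>u. of_real (R k u) * w k \<partial>lborel)"
      by (rule integral_infsum)
         (use Ri Rs RS in \<open>auto simp: w_def norm_mult R_def\<close>)
    also have "\<dots> = (\<Sum>\<^sub>\<infinity>k. of_real W * (shifted_wave y (\<lambda>j. of_real (t j)) k / shifted_quadric h (\<lambda>j. of_real (t j)) k ^ m))"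
    proof (rule infsum_cong)
      fix k :: "int^'d"
      have "(\<integral>u. R k u \<partial>lborel) = W / q k ^ m"
        unfolding R_def q_def W_def by (rule matern_dual_integrals(2)[OF dm h t])
      thus "(\<integral>u. of_real (R k u) * w k \<partial>lborel) = of_real W * (shifted_wave y (\<lambda>j. of_real (t j)) k / shifted_quadric h (\<lambda>j. of_real (t j)) k ^ m)"
        unfolding shifted_wave_of_real shifted_quadric_of_real by (simp add: w_def q_def)
    qed
    also have "\<dots> = of_real W * (\<Sum>\<^sub>\<infinity>k. shifted_wave y (\<lambda>j. of_real (t j)) k / shifted_quadric h (\<lambda>j. of_real (t j)) k ^ m)"
      by (rule infsum_cmult_right')
    finally show "(\<Sum>\<^sub>\<infinity>k. of_real (scaled_matern m h (y - lattice_point k)) * cis (\<Sum>i\<in>UNIV. k $ i * t i))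
      = of_real (c * D * W) * (\<Sum>\<^sub>\<infinity>k. shifted_wave y (\<lambda>j. of_real (t j)) k / shifted_quadric h (\<lambda>j. of_real (t j)) k ^ m)"
      by (simp only: of_real_mult mult.assoc)
  qed
qed

section \<open>The regularized symbol\<close>

definition wave_sum :: "nat \<Rightarrow> real \<Rightarrow> real ^ 'd \<Rightarrow> ('d::finite \<Rightarrow> complex) \<Rightarrow> complex" where
  "wave_sum m h y \<zeta> = (\<Sum>\<^sub>\<infinity>k. shifted_wave y \<zeta> k / shifted_quadric h \<zeta> k ^ m)"

text \<open>The term \<open>k = 0\<close> of \<open>wave_sum\<close> is singular at complex points of size \<open>h\<close>; multiplying by the
  \<open>m\<close>-th power of its quadric removes the singularity and leaves bounds that are uniform in \<open>h\<close>.\<close>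

definition regularized_sum :: "nat \<Rightarrow> real \<Rightarrow> real ^ 'd \<Rightarrow> ('d::finite \<Rightarrow> complex) \<Rightarrow> complex" where
  "regularized_sum m h y \<zeta> = shifted_wave y \<zeta> 0 +
     shifted_quadric h \<zeta> 0 ^ m * (\<Sum>\<^sub>\<infinity>k\<in>-{0}. shifted_wave y \<zeta> k / shifted_quadric h \<zeta> k ^ m)"

lemma summable_on_lattice_bound_subset:
  assumes "real m > real CARD('d::finite) / 2"
  shows "lattice_bound m summable_on (A :: (int ^ 'd) set)"
  using summable_on_lattice_bound[OF assms] by (rule summable_on_subset_banach) auto

lemma summable_on_wave_sum:
  fixes \<zeta> :: "'d::finite \<Rightarrow> complex"
  assumes "real m > real CARD('d) / 2" "\<zeta> \<in> tube"
  shows "(\<lambda>k. norm (shifted_wave y \<zeta> k / shifted_quadric h \<zeta> k ^ m)) summable_on UNIV"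
  using summable_on_cmult_right[OF summable_on_inverse_shifted_quadric[OF assms, of h],
      of "exp (- (\<Sum>j\<in>UNIV. y $ j * Im (\<zeta> j)))"]
  by (simp add: norm_mult norm_inverse norm_shifted_wave norm_power divide_inverse)

lemma regularized_sum_eq:
  fixes \<zeta> :: "'d::finite \<Rightarrow> complex"
  assumes dm: "real m > real CARD('d) / 2" and \<zeta>: "\<zeta> \<in> tube" and nz: "shifted_quadric h \<zeta> 0 \<noteq> 0"
  shows "regularized_sum m h y \<zeta> = shifted_quadric h \<zeta> 0 ^ m * wave_sum m h y \<zeta>"
proof -
  let ?f = "\<lambda>k. shifted_wave y \<zeta> k / shifted_quadric h \<zeta> k ^ m"
  have "?f summable_on UNIV"
    using summable_on_wave_sum[OF dm \<zeta>] by (rule abs_summable_summable)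
  hence s: "?f summable_on (-{0})" by (rule summable_on_subset_banach) auto
  have "wave_sum m h y \<zeta> = infsum ?f (insert 0 (-{0}))"
    by (simp add: wave_sum_def insert_absorb Compl_eq_Diff_UNIV)
  also have "\<dots> = ?f 0 + infsum ?f (-{0})"
    by (rule infsum_insert[OF s]) auto
  finally show ?thesis using nz by (simp add: regularized_sum_def distrib_left)
qed

lemma wave_bound_tube:
  fixes \<zeta> :: "'d::finite \<Rightarrow> complex"
  assumes "\<zeta> \<in> tube"
  shows "exp (- (\<Sum>j\<in>UNIV. y $ j * Im (\<zeta> j))) \<le> exp (\<Sum>j\<in>UNIV. \<bar>y $ j\<bar>)"
proof -
  have "\<bar>Im (\<zeta> j)\<bar> \<le> 1" for j
  proof -
    have "(Im (\<zeta> j))\<^sup>2 \<le> (\<Sum>j\<in>UNIV. (Im (\<zeta> j))\<^sup>2)" by (rule member_le_sum) auto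
    also have "\<dots> \<le> 1" using assms by (simp add: tube_def)
    finally show ?thesis by (simp add: abs_square_le_1)
  qed
  hence "- (y $ j * Im (\<zeta> j)) \<le> \<bar>y $ j\<bar>" for j
    by (metis abs_le_D2 abs_ge_zero abs_mult mult_left_le)
  hence "(\<Sum>j\<in>UNIV. - (y $ j * Im (\<zeta> j))) \<le> (\<Sum>j\<in>UNIV. \<bar>y $ j\<bar>)" by (rule sum_mono)
  thus ?thesis by (simp add: sum_negf)
qed

lemma wave_term_le:
  fixes \<zeta> :: "'d::finite \<Rightarrow> complex"
  assumes "\<zeta> \<in> tube" "k \<noteq> 0"
  shows "norm (shifted_wave y \<zeta> k / shifted_quadric h \<zeta> k ^ m)
      \<le> exp (- (\<Sum>j\<in>UNIV. y $ j * Im (\<zeta> j))) * lattice_bound m k"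
  using inverse_shifted_quadric_le[OF assms, of h m]
  by (simp add: norm_mult norm_inverse norm_shifted_wave norm_power divide_inverse)

lemma shifted_quadric_nz: "\<zeta> \<in> tube \<Longrightarrow> k \<noteq> 0 \<Longrightarrow> shifted_quadric h \<zeta> k \<noteq> 0"
  using shifted_quadric_lower[of \<zeta> k h] sum_nonneg[of UNIV "\<lambda>j. (real_of_int (k $ j))\<^sup>2"] by auto

lemma norm_shifted_quadric_0_le:
  fixes \<zeta> :: "'d::finite \<Rightarrow> complex"
  assumes h: "h \<in> {0..1}" and \<zeta>: "\<zeta> \<in> tube"
  shows "norm (shifted_quadric h \<zeta> 0) \<le> 1 + 25 * real CARD('d)"
proof -
  \<comment> \<open>\<open>5 = 4 + 1\<close>, from the bounds of the tube on real and imaginary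
    parts.\<close>
  have z5: "norm (\<zeta> j) \<le> 5" for j
  proof -
    have "(Im (\<zeta> j))\<^sup>2 \<le> (\<Sum>j\<in>UNIV. (Im (\<zeta> j))\<^sup>2)" by (rule member_le_sum) auto
    also have "\<dots> \<le> 1" using \<zeta> by (simp add: tube_def)
    finally have "\<bar>Im (\<zeta> j)\<bar> \<le> 1" by (simp add: abs_square_le_1)
    moreover have "\<bar>Re (\<zeta> j)\<bar> \<le> 4" using \<zeta> by (simp add: tube_def)
    ultimately show ?thesis using cmod_le[of "\<zeta> j"] by linarith
  qed
  have z25: "(norm (\<zeta> j))\<^sup>2 \<le> 25" for j
    using power_mono[OF z5 norm_ge_zero, of j 2] by simp
  have "norm (shifted_quadric h \<zeta> 0) \<le> norm (complex_of_real (h\<^sup>2)) + norm (\<Sum>j\<in>UNIV. (\<zeta> j)\<^sup>2)"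
    unfolding shifted_quadric_def by (rule order_trans[OF norm_triangle_ineq]) simp
  also have "\<dots> \<le> 1 + (\<Sum>j\<in>(UNIV::'d set). (25::real))"
    using h z25
    by (intro add_mono order_trans[OF norm_sum] sum_mono) (auto simp: norm_power power_le_one)
  finally show ?thesis by simp
qed

text \<open>The shifts \<open>2 * pi * k\<close> are real, so all waves have the same modulus, which
  factors out of the sum. This exponential is the source of the decay; what remains is controlled by
  the sum of \<open>lattice_bound\<close>, independently of \<open>h\<close> and
  \<open>y\<close>.\<close>

lemma norm_regularized_sum_le:
  assumes dm: "real m > real CARD('d::finite) / 2"
  shows "\<exists>K > 0. \<forall>h\<in>{0..1}. \<forall>(y :: real ^ 'd). \<forall>\<zeta>\<in>tube.
    norm (regularized_sum m h y \<zeta>) \<le> K * exp (- (\<Sum>j\<in>UNIV. y $ j * Im (\<zeta> j)))"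
proof -
  define L where "L = (\<Sum>\<^sub>\<infinity>k::int^'d\<in>-{0}. lattice_bound m k)"
  have Ls: "lattice_bound m summable_on (-{0::int^'d})"
    by (rule summable_on_lattice_bound_subset[OF dm])
  have L: "L \<ge> 0" unfolding L_def by (rule infsum_nonneg) (auto simp: lattice_bound_def intro!: prod_nonneg)
  define Q where "Q = 1 + 25 * real CARD('d)"
  have Q0: "Q \<ge> 0" unfolding Q_def by simp
  show ?thesis
  proof (intro exI[of _ "1 + Q ^ m * L"] conjI ballI allI)
    show "1 + Q ^ m * L > 0" using L Q0 by (intro add_pos_nonneg) auto
    fix h :: real and y :: "real^'d" and \<zeta> :: "'d \<Rightarrow> complex"
    assume h: "h \<in> {0..1}" and \<zeta>: "\<zeta> \<in> tube"
    let ?e = "exp (- (\<Sum>j\<in>UNIV. y $ j * Im (\<zeta> j)))"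
    have "norm (shifted_quadric h \<zeta> 0) \<le> Q"
      unfolding Q_def by (rule norm_shifted_quadric_0_le[OF h \<zeta>])
    hence q: "norm (shifted_quadric h \<zeta> 0 ^ m) \<le> Q ^ m"
      by (simp add: norm_power power_mono)
    have "norm (\<Sum>\<^sub>\<infinity>k\<in>-{0}. shifted_wave y \<zeta> k / shifted_quadric h \<zeta> k ^ m) \<le> (\<Sum>\<^sub>\<infinity>k\<in>-{0::int^'d}. ?e * lattice_bound m k)"
    proof (rule norm_infsum_le[OF has_sum_infsum has_sum_infsum])
      show "(\<lambda>k. shifted_wave y \<zeta> k / shifted_quadric h \<zeta> k ^ m) summable_on - {0}"
        by (rule summable_on_subset_banach[OF abs_summable_summable[OF summable_on_wave_sum[OF dm \<zeta>]]]) auto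
      show "(\<lambda>k. ?e * lattice_bound m k) summable_on (- {0::int^'d})"
        by (intro summable_on_cmult_right Ls)
    qed (use wave_term_le[OF \<zeta>] in auto)
    also have "\<dots> = ?e * L" by (simp add: L_def infsum_cmult_right')
    finally have "norm (shifted_quadric h \<zeta> 0 ^ m * (\<Sum>\<^sub>\<infinity>k\<in>-{0}. shifted_wave y \<zeta> k / shifted_quadric h \<zeta> k ^ m)) \<le> Q ^ m * (?e * L)"
      unfolding norm_mult using q Q0 by (intro mult_mono) auto
    hence "norm (regularized_sum m h y \<zeta>) \<le> ?e + Q ^ m * (?e * L)"
      unfolding regularized_sum_def
      by (intro order_trans[OF norm_triangle_ineq] add_mono) (simp_all add: norm_shifted_wave)
    thus "norm (regularized_sum m h y \<zeta>) \<le> (1 + Q ^ m * L) * ?e"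
      by (simp add: algebra_simps)
  qed
qed

text \<open>The parameter \<open>p\<close> lets \<open>h\<close> and \<open>\<zeta>\<close> vary
  jointly, which the compactness argument over \<open>h\<close> needs; on the torus it is used with
  \<open>h\<close> constant.\<close>

lemma continuous_on_regularized_sum:
  fixes Z :: "'a::topological_space \<Rightarrow> 'd::finite \<Rightarrow> complex"
  assumes dm: "real m > real CARD('d) / 2"
    and H: "continuous_on S H" and Z: "\<And>j. continuous_on S (\<lambda>p. Z p j)"
    and tube: "\<And>p. p \<in> S \<Longrightarrow> Z p \<in> tube"
  shows "continuous_on S (\<lambda>p. regularized_sum m (H p) y (Z p))"
proof -
  have w: "continuous_on S (\<lambda>p. shifted_wave y (Z p) k)" for k
    unfolding shifted_wave_def by (intro continuous_intros Z)
  have q: "continuous_on S (\<lambda>p. shifted_quadric (H p) (Z p) k)" for k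
    unfolding shifted_quadric_def by (intro continuous_intros Z H)
  have "continuous_on S (\<lambda>p. \<Sum>\<^sub>\<infinity>k\<in>-{0}. shifted_wave y (Z p) k / shifted_quadric (H p) (Z p) k ^ m)"
  proof (rule continuous_on_infsum)
    show "continuous_on S (\<lambda>p. shifted_wave y (Z p) k / shifted_quadric (H p) (Z p) k ^ m)" if "k \<in> -{0}" for k
      by (intro continuous_intros w q) (use that tube in \<open>auto simp: shifted_quadric_nz\<close>)
    show "norm (shifted_wave y (Z p) k / shifted_quadric (H p) (Z p) k ^ m) \<le> exp (\<Sum>j\<in>UNIV. \<bar>y $ j\<bar>) * lattice_bound m k"
      if "k \<in> -{0}" "p \<in> S" for k p
      using that
      by (intro order_trans[OF wave_term_le] mult_right_mono wave_bound_tube tube)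
         (auto simp: lattice_bound_def intro!: prod_nonneg)
    show "(\<lambda>k::int^'d. exp (\<Sum>j\<in>UNIV. \<bar>y $ j\<bar>) * lattice_bound m k) summable_on - {0}"
      by (intro summable_on_cmult_right summable_on_lattice_bound_subset dm)
  qed
  thus ?thesis unfolding regularized_sum_def by (intro continuous_intros w q)
qed

lemma holomorphic_on_infsum:
  fixes f :: "'i \<Rightarrow> complex \<Rightarrow> complex"
  assumes "open A" and "\<And>k. k \<in> I \<Longrightarrow> f k holomorphic_on A"
    and "\<And>k z. k \<in> I \<Longrightarrow> z \<in> A \<Longrightarrow> norm (f k z) \<le> M k" and "M summable_on I"
  shows "(\<lambda>z. \<Sum>\<^sub>\<infinity>k\<in>I. f k z) holomorphic_on A"
proof -
  have "(\<lambda>z. \<Sum>\<^sub>\<infinity>k\<in>I. f k z) field_differentiable (at z)" if z: "z \<in> A" for z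
  proof -
    obtain r where r: "r > 0" "cball z r \<subseteq> A" using assms(1) z open_contains_cball by blast
    have "(\<lambda>z. \<Sum>k\<in>X. f k z) holomorphic_on cball z r" if "X \<subseteq> I" for X
      using that r assms(2) by (intro holomorphic_on_sum) (meson holomorphic_on_subset subsetD)
    hence "\<forall>\<^sub>F X in finite_subsets_at_top I. continuous_on (cball z r) (\<lambda>z. \<Sum>k\<in>X. f k z) \<and>
        (\<lambda>z. \<Sum>k\<in>X. f k z) holomorphic_on ball z r"
      by (intro eventually_finite_subsets_at_top_weakI)
         (meson holomorphic_on_imp_continuous_on holomorphic_on_subset ball_subset_cball)
    moreover have "uniform_limit (cball z r) (\<lambda>X z. \<Sum>k\<in>X. f k z) (\<lambda>z. \<Sum>\<^sub>\<infinity>k\<in>I. f k z) (finite_subsets_at_top I)"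
      by (rule Weierstrass_m_test_general[OF _ assms(4)]) (use assms(3) r in auto)
    ultimately have "(\<lambda>z. \<Sum>\<^sub>\<infinity>k\<in>I. f k z) holomorphic_on ball z r"
      using holomorphic_uniform_limit[of z r _ "finite_subsets_at_top I"] by (metis finite_subsets_at_top_neq_bot)
    thus ?thesis using r(1) holomorphic_on_imp_differentiable_at[of _ "ball z r" z] by simp
  qed
  thus ?thesis using assms(1) by (simp add: holomorphic_on_def field_differentiable_at_within)
qed

lemma holomorphic_on_regularized_sum:
  fixes \<zeta> :: "'d::finite \<Rightarrow> complex"
  assumes dm: "real m > real CARD('d) / 2" and A: "open A" and tube: "\<And>w. w \<in> A \<Longrightarrow> \<zeta>(i := w) \<in> tube"
  shows "(\<lambda>w. regularized_sum m h y (\<zeta>(i := w))) holomorphic_on A"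
proof -
  have u: "(\<lambda>w. (\<zeta>(i := w)) j) holomorphic_on A" for j
    by (cases "j = i") auto
  have w: "(\<lambda>w. shifted_wave y (\<zeta>(i := w)) k) holomorphic_on A" for k
    unfolding shifted_wave_def by (intro holomorphic_intros u)
  have q: "(\<lambda>w. shifted_quadric h (\<zeta>(i := w)) k) holomorphic_on A" for k
    unfolding shifted_quadric_def by (intro holomorphic_intros u)
  have "(\<lambda>w. \<Sum>\<^sub>\<infinity>k\<in>-{0}. shifted_wave y (\<zeta>(i := w)) k / shifted_quadric h (\<zeta>(i := w)) k ^ m) holomorphic_on A"
  proof (rule holomorphic_on_infsum[OF A])
    show "(\<lambda>w. shifted_wave y (\<zeta>(i := w)) k / shifted_quadric h (\<zeta>(i := w)) k ^ m) holomorphic_on A" if "k \<in> -{0}" for k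
      by (intro holomorphic_intros w q) (use that tube in \<open>auto simp: shifted_quadric_nz\<close>)
    show "norm (shifted_wave y (\<zeta>(i := w)) k / shifted_quadric h (\<zeta>(i := w)) k ^ m) \<le> exp (\<Sum>j\<in>UNIV. \<bar>y $ j\<bar>) * lattice_bound m k"
      if "k \<in> -{0}" "w \<in> A" for k w
      using that
      by (intro order_trans[OF wave_term_le] mult_right_mono wave_bound_tube tube)
         (auto simp: lattice_bound_def intro!: prod_nonneg)
    show "(\<lambda>k::int^'d. exp (\<Sum>j\<in>UNIV. \<bar>y $ j\<bar>) * lattice_bound m k) summable_on - {0}"
      by (intro summable_on_cmult_right summable_on_lattice_bound_subset dm)
  qed
  thus ?thesis unfolding regularized_sum_def by (intro holomorphic_intros w q)
qed

text \<open>At real points and \<open>y = 0\<close> every wave is 1 and every quadric is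
  nonnegative, so the term \<open>k = 0\<close> gives exactly 1 and the others only add to
  it.\<close>

lemma Re_regularized_sum_of_real_ge_1:
  fixes t :: "'d::finite \<Rightarrow> real"
  shows "Re (regularized_sum m h 0 (\<lambda>j. of_real (t j))) \<ge> 1"
proof -
  let ?q = "\<lambda>k::int^'d. h\<^sup>2 + (\<Sum>j\<in>UNIV. (t j + 2 * pi * (k $ j))\<^sup>2)"
  have q: "?q k \<ge> 0" for k :: "int^'d" by (intro add_nonneg_nonneg sum_nonneg) auto
  define s where "s = (\<Sum>\<^sub>\<infinity>k\<in>-{0::int^'d}. inverse (?q k ^ m))"
  have s: "s \<ge> 0" unfolding s_def using q by (intro infsum_nonneg) auto
  have "(\<Sum>\<^sub>\<infinity>k\<in>-{0::int^'d}. complex_of_real (inverse (?q k ^ m))) = of_real s"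
  proof (cases "(\<lambda>k. inverse (?q k ^ m)) summable_on (-{0::int^'d})")
    case True
    thus ?thesis unfolding s_def by (rule infsum_of_real_complex)
  next
    \<comment> \<open>For a divergent series the real and the complex sum both take the default
      value 0.\<close>
    case False
    have "\<not> (\<lambda>k. complex_of_real (inverse (?q k ^ m))) summable_on (-{0::int^'d})"
    proof
      assume "(\<lambda>k. complex_of_real (inverse (?q k ^ m))) summable_on (-{0::int^'d})"
      from summable_on_Re[OF this] False show False unfolding Re_complex_of_real by contradiction
    qed
    thus ?thesis using False by (simp add: s_def infsum_not_exists)
  qed
  moreover have "regularized_sum m h 0 (\<lambda>j. of_real (t j))
      = 1 + of_real (?q 0 ^ m) * (\<Sum>\<^sub>\<infinity>k\<in>-{0::int^'d}. complex_of_real (inverse (?q k ^ m)))"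
    unfolding regularized_sum_def shifted_wave_of_real shifted_quadric_of_real by (simp add: cis_zero divide_inverse)
  ultimately have "regularized_sum m h 0 (\<lambda>j. of_real (t j)) = of_real (1 + ?q 0 ^ m * s)" by simp
  moreover have "?q 0 ^ m * s \<ge> 0" by (intro mult_nonneg_nonneg zero_le_power q s)
  ultimately show ?thesis by simp
qed

text \<open>The translation is absorbed by moving the index by \<open>axis i 1\<close>. This treats
  all lattice points alike, and therefore does not carry over to
  \<open>regularized_sum\<close>.\<close>

lemma wave_sum_periodic:
  fixes \<zeta> :: "'d::finite \<Rightarrow> complex"
  shows "wave_sum m h y (\<zeta>(i := w + of_real (2 * pi))) = wave_sum m h y (\<zeta>(i := w))"
proof -
  have e: "(\<zeta>(i := w + of_real (2 * pi))) j + of_real (2 * pi * real_of_int (k $ j))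
     = (\<zeta>(i := w)) j + of_real (2 * pi * real_of_int ((k + axis i 1) $ j))" for j and k :: "int^'d"
    by (simp add: axis_def algebra_simps)
  show ?thesis
    unfolding wave_sum_def
    by (rule infsum_reindex_bij_witness[of _ "\<lambda>k. k - axis i 1" "\<lambda>k. k + axis i 1"])
       (simp_all only: shifted_wave_def shifted_quadric_def e, auto)
qed

lemma tube_line:
  assumes "\<And>j. \<bar>t j\<bar> \<le> 4" "\<bar>Re w\<bar> \<le> 4" "\<bar>Im w\<bar> \<le> 1"
  shows "(\<lambda>j. complex_of_real (t j))(i := w) \<in> tube"
proof -
  have "(\<Sum>j\<in>UNIV. (Im (((\<lambda>j. complex_of_real (t j))(i := w)) j))\<^sup>2) = (\<Sum>j\<in>UNIV. if j = i then (Im w)\<^sup>2 else 0)"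
    by (rule sum.cong) auto
  also have "\<dots> = (Im w)\<^sup>2" by simp
  also have "\<dots> \<le> 1" using assms(3) by (simp add: abs_square_le_1)
  finally show ?thesis using assms by (simp add: tube_def)
qed

text \<open>At real points the symbol is at least 1; compactness of the parameter range, \<open>h = 0\<close> included, gives
  a strip that works for all \<open>h\<close> at once.\<close>

lemma Re_regularized_sum_ge_half:
  assumes dm: "real m > real CARD('d::finite) / 2"
  shows "\<exists>b > 0. b \<le> 1 \<and> (\<forall>h\<in>{0..1}. \<forall>t :: 'd \<Rightarrow> real. (\<forall>j. \<bar>t j\<bar> \<le> 4) \<longrightarrow>
    (\<forall>i s. \<bar>s\<bar> \<le> b \<longrightarrow> 1 / 2 \<le> Re (regularized_sum m h 0 ((\<lambda>j. of_real (t j))(i := of_real (t i) + \<i> * of_real s)))))"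
proof -
  define S where "S = ({0..1::real} \<times> cbox (\<chi> j. - (4::real)) (\<chi> j. (4::real)) :: (real \<times> (real ^ 'd)) set)"
  define T where "T = S \<times> {-1..1::real}"
  define Z where "Z = (\<lambda>i (p :: (real \<times> (real ^ 'd)) \<times> real).
     (\<lambda>j. complex_of_real (snd (fst p) $ j))(i := of_real (snd (fst p) $ i) + \<i> * of_real (snd p)))"
  define F where "F = (\<lambda>i p. regularized_sum m (fst (fst p)) (0 :: real ^ 'd) (Z i p))"
  have vS: "\<bar>snd q $ j\<bar> \<le> 4" if "q \<in> S" for q j
    using that by (auto simp: S_def mem_box_cart abs_le_iff dest!: spec[of _ j])
  have cT: "compact T" unfolding T_def S_def by (intro compact_Times compact_cbox compact_Icc)
  have cF: "continuous_on T (F i)" for i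
    unfolding F_def
  proof (rule continuous_on_regularized_sum[OF dm])
    show "continuous_on T (\<lambda>p. Z i p j)" for j
      unfolding Z_def by (cases "j = i") (auto intro!: continuous_intros)
    show "Z i p \<in> tube" if "p \<in> T" for p
      unfolding Z_def using that vS by (intro tube_line) (auto simp: T_def)
  qed (intro continuous_intros)
  have "\<exists>d>0. d \<le> 1 \<and> (\<forall>q\<in>S. \<forall>s. \<bar>s\<bar> \<le> d \<longrightarrow> 1 / 2 \<le> Re (F i (q, s)))" for i
  proof -
    have "uniformly_continuous_on T (F i)"
      using cF cT by (rule compact_uniformly_continuous)
    then obtain d where d: "d > 0" "\<And>p p'. p \<in> T \<Longrightarrow> p' \<in> T \<Longrightarrow> dist p' p < d \<Longrightarrow> dist (F i p') (F i p) < 1 / 2"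
      unfolding uniformly_continuous_on_def by (metis half_gt_zero zero_less_one)
    show ?thesis
    \<comment> \<open>\<open>d / 2\<close> meets the strict inequality of uniform continuity, and 1
      keeps \<open>(q, s)\<close> in \<open>T\<close>.\<close>
    proof (intro exI[of _ "min (d / 2) 1"] conjI ballI allI impI)
      fix q s assume q: "q \<in> S" and s: "\<bar>s\<bar> \<le> min (d / 2) 1"
      have "dist (q, s) (q, 0) < d" using s d(1) by (simp add: dist_Pair_Pair)
      hence "dist (F i (q, s)) (F i (q, 0)) < 1 / 2"
        using q s by (intro d(2)) (auto simp: T_def)
      hence "\<bar>Re (F i (q, s)) - Re (F i (q, 0))\<bar> < 1 / 2"
        using abs_Re_le_cmod[of "F i (q, s) - F i (q, 0)"] by (simp add: dist_norm)
      moreover have "Re (F i (q, 0)) \<ge> 1"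
      proof -
        have "Z i (q, 0) = (\<lambda>j. of_real (snd q $ j))" by (auto simp: Z_def)
        thus ?thesis using Re_regularized_sum_of_real_ge_1[of m "fst q" "vec_nth (snd q)"] by (simp add: F_def)
      qed
      ultimately show "1 / 2 \<le> Re (F i (q, s))" by linarith
    qed (use d in auto)
  qed
  then obtain d where d: "\<And>i. d i > 0" "\<And>i. d i \<le> 1"
    "\<And>i q s. q \<in> S \<Longrightarrow> \<bar>s\<bar> \<le> d i \<Longrightarrow> 1 / 2 \<le> Re (F i (q, s))"
    by metis
  show ?thesis
  proof (intro exI[of _ "Min (range d)"] conjI ballI allI impI)
    show "0 < Min (range d)" using d(1) by (subst Min_gr_iff) auto
    show "Min (range d) \<le> 1" using d(2) by (meson Min_le finite finite_imageI order_trans rangeI)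
    fix h :: real and t :: "'d \<Rightarrow> real" and i s
    assume h: "h \<in> {0..1}" and t: "\<forall>j. \<bar>t j\<bar> \<le> 4" and s: "\<bar>s\<bar> \<le> Min (range d)"
    have "(h, vec_lambda t) \<in> S"
      using h t by (auto simp: S_def mem_box_cart abs_le_iff) (metis minus_le_iff)
    moreover have "\<bar>s\<bar> \<le> d i" using s by (meson Min_le finite finite_imageI order_trans rangeI)
    ultimately show "1 / 2 \<le> Re (regularized_sum m h 0 ((\<lambda>j. of_real (t j))(i := of_real (t i) + \<i> * of_real s)))"
      using d(3)[of "(h, vec_lambda t)" s i] by (simp add: F_def Z_def)
  qed
qed

section \<open>Contour shift on the torus\<close>

text \<open>Normalised to a probability measure, so that integrals over the product are means.
  Restricting the space to \<open>{-pi..pi}\<close>, instead of carrying an indicator, turns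
  estimates on the torus into pointwise statements about \<open>space\<close>.\<close>

definition circle_measure :: "real measure" where
  "circle_measure = density (restrict_space lborel {-pi..pi}) (\<lambda>_. ennreal (1 / (2 * pi)))"

lemma space_circle_measure [simp]: "space circle_measure = {-pi..pi}"
  by (simp add: circle_measure_def space_restrict_space)

lemma prob_space_circle_measure: "prob_space circle_measure"
proof
  have "emeasure circle_measure (space circle_measure) = ennreal (1 / (2 * pi)) * ennreal (2 * pi)"
    unfolding circle_measure_def space_density
    by (subst emeasure_density_const[OF sets.top]) (simp add: space_restrict_space emeasure_restrict_space)
  also have "\<dots> = 1" by (simp flip: ennreal_mult)
  finally show "emeasure circle_measure (space circle_measure) = 1" .
qed

lemma continuous_imp_measurable_circle:
  fixes f :: "real \<Rightarrow> 'a::{banach,second_countable_topology}"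
  assumes "continuous_on {-pi..pi} f"
  shows "f \<in> borel_measurable circle_measure"
  using borel_measurable_continuous_on_restrict[OF assms]
  by (simp add: circle_measure_def cong: measurable_cong_sets sets_restrict_space_cong)

lemma integral_circle_measure:
  fixes f :: "real \<Rightarrow> complex"
  assumes "continuous_on {-pi..pi} f"
  shows "(\<integral>x. f x \<partial>circle_measure) = of_real (1 / (2 * pi)) * integral {-pi..pi} f"
    and "integrable circle_measure f"
proof -
  have m: "f \<in> borel_measurable (restrict_space lborel {-pi..pi})"
    using borel_measurable_continuous_on_restrict[OF assms]
    by (simp cong: measurable_cong_sets sets_restrict_space_cong)
  have "(\<integral>x. f x \<partial>circle_measure) = (\<integral>x. (1 / (2 * pi)) *\<^sub>R f x \<partial>restrict_space lborel {-pi..pi})"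
    unfolding circle_measure_def by (rule integral_density[OF m]) auto
  also have "\<dots> = (1 / (2 * pi)) *\<^sub>R (\<integral>x. f x \<partial>restrict_space lborel {-pi..pi})"
    by (rule integral_scaleR_right)
  also have "(\<integral>x. f x \<partial>restrict_space lborel {-pi..pi}) = (\<integral>x. indicator {-pi..pi} x *\<^sub>R f x \<partial>lborel)"
    by (rule integral_restrict_space) auto
  also have "\<dots> = integral {-pi..pi} f"
    by (rule continuous_on_integral_lborel(2)[OF assms])
  finally show "(\<integral>x. f x \<partial>circle_measure) = of_real (1 / (2 * pi)) * integral {-pi..pi} f"
    by (simp add: scaleR_conv_of_real)
  interpret prob_space circle_measure by (rule prob_space_circle_measure)
  have "compact (f ` {-pi..pi})" using assms by (intro compact_continuous_image) auto
  then obtain B where "\<And>x. x \<in> {-pi..pi} \<Longrightarrow> norm (f x) \<le> B"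
    using compact_imp_bounded bounded_iff by (metis imageI)
  thus "integrable circle_measure f"
    by (intro integrable_const_bound[of _ B] AE_I2 continuous_imp_measurable_circle assms) auto
qed

lemma open_strip: "open {w. \<bar>Re w\<bar> < a \<and> \<bar>Im w\<bar> < b}"
proof -
  have "{w. \<bar>Re w\<bar> < a \<and> \<bar>Im w\<bar> < b} = {w. Re w < a} \<inter> {w. Re w > -a} \<inter> ({w. Im w < b} \<inter> {w. Im w > -b})"
    by (auto simp: abs_less_iff)
  thus ?thesis
    by (simp add: open_Int open_halfspace_Re_lt open_halfspace_Re_gt open_halfspace_Im_lt open_halfspace_Im_gt)
qed

text \<open>The open strip is convex, so \<open>g\<close> has a primitive there and the integral
  along the segment at height \<open>u\<close> is a difference of two of its values. Cauchy's
  theorem for the rectangle becomes the constancy of this difference in \<open>u\<close>. As 4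
  exceeds \<open>pi\<close>, the segments lie inside the open domain.\<close>

lemma circle_contour_shift_bound:
  fixes g :: "complex \<Rightarrow> complex"
  assumes hol: "g holomorphic_on {w. \<bar>Re w\<bar> < 4 \<and> \<bar>Im w\<bar> < b}"
    and per: "\<And>u. \<bar>u\<bar> < b \<Longrightarrow> g (of_real (- pi) + \<i> * of_real u) = g (of_real pi + \<i> * of_real u)"
    and s: "\<bar>s\<bar> < b" and B: "\<And>x. \<bar>x\<bar> \<le> pi \<Longrightarrow> norm (g (of_real x + \<i> * of_real s)) \<le> B"
  shows "norm (\<integral>x. g (of_real x) \<partial>circle_measure) \<le> B"
proof -
  define A where "A = {w. \<bar>Re w\<bar> < 4 \<and> \<bar>Im w\<bar> < b}"
  have oA: "open A" unfolding A_def by (rule open_strip)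
  have A_eq: "A = {w. Re w < 4} \<inter> {w. Re w > -4} \<inter> ({w. Im w < b} \<inter> {w. Im w > -b})"
    by (auto simp: A_def abs_less_iff)
  have cA: "convex A" unfolding A_eq
    by (intro convex_Int convex_halfspace_Re_lt convex_halfspace_Re_gt convex_halfspace_Im_lt convex_halfspace_Im_gt)
  obtain F where F: "\<And>x. x \<in> A \<Longrightarrow> (F has_field_derivative g x) (at x)"
    using holomorphic_convex_primitive'[OF cA oA hol[folded A_def]] oA by (metis at_within_open)
  have gc: "continuous_on A g" using hol A_def holomorphic_on_imp_continuous_on by blast
  have mem: "of_real x + \<i> * of_real u \<in> A" if "\<bar>x\<bar> \<le> pi" "\<bar>u\<bar> < b" for x u
    using that pi_less_4 by (auto simp: A_def)
  have ftc: "integral {-pi..pi} (\<lambda>x. g (of_real x + \<i> * of_real u)) = F (of_real pi + \<i> * of_real u) - F (of_real (- pi) + \<i> * of_real u)"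
    if u: "\<bar>u\<bar> < b" for u
  proof (rule integral_unique, rule fundamental_theorem_of_calculus)
    fix x assume x: "x \<in> {-pi..pi}"
    have "((\<lambda>x. complex_of_real x + \<i> * of_real u) has_vector_derivative 1) (at x)"
      by (auto intro!: derivative_eq_intros)
    from field_vector_diff_chain_at[OF this F[OF mem[OF _ u]]] x
    show "((\<lambda>x. F (complex_of_real x + \<i> * of_real u)) has_vector_derivative g (of_real x + \<i> * of_real u)) (at x within {-pi..pi})"
      by (auto simp: o_def intro: has_vector_derivative_at_within)
  qed simp
  define K where "K = (\<lambda>u. F (of_real pi + \<i> * of_real u) - F (of_real (- pi) + \<i> * of_real u))"
  \<comment> \<open>The derivative of \<open>K\<close> is the difference of \<open>g\<close> at the two vertical sides, which vanishes by periodicity.\<close>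
  obtain c where c: "\<And>u. u \<in> {-b<..<b} \<Longrightarrow> K u = c"
  proof (rule has_vector_derivative_zero_constant[of "{-b<..<b}" K])
    fix u assume "u \<in> {-b<..<b}"
    hence u: "\<bar>u\<bar> < b" by auto
    have d: "((\<lambda>u. F (of_real x + \<i> * of_real u)) has_vector_derivative \<i> * g (of_real x + \<i> * of_real u)) (at u)"
      if x: "\<bar>x\<bar> \<le> pi" for x
    proof -
      have "((\<lambda>u. complex_of_real x + \<i> * of_real u) has_vector_derivative \<i>) (at u)"
        by (auto intro!: derivative_eq_intros)
      from field_vector_diff_chain_at[OF this F[OF mem[OF x u]]] show ?thesis by (simp add: o_def)
    qed
    have "(K has_vector_derivative (\<i> * g (of_real pi + \<i> * of_real u) - \<i> * g (of_real (- pi) + \<i> * of_real u))) (at u)"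
      unfolding K_def by (intro has_vector_derivative_diff d) auto
    thus "(K has_vector_derivative 0) (at u within {-b<..<b})"
      using per[OF u] by (auto intro: has_vector_derivative_at_within)
  qed (auto intro: that)
  have c0: "continuous_on {-pi..pi} (\<lambda>x. g (of_real x + \<i> * of_real u))" if "\<bar>u\<bar> < b" for u
    by (rule continuous_on_compose2[OF gc]) (use mem that in \<open>auto intro!: continuous_intros\<close>)
  have b: "b > 0" using s by linarith
  have "integral {-pi..pi} (\<lambda>x. g (of_real x + \<i> * of_real 0)) = integral {-pi..pi} (\<lambda>x. g (of_real x + \<i> * of_real s))"
    using ftc[of 0] ftc[of s] c[of 0] c[of s] s b unfolding K_def by (simp add: abs_less_iff)
  moreover have "norm (integral {-pi..pi} (\<lambda>x. g (of_real x + \<i> * of_real s))) \<le> B * (pi - (- pi))"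
    by (rule integral_bound[OF _ c0[OF s]]) (use B in auto)
  moreover have "(\<integral>x. g (of_real x) \<partial>circle_measure) = of_real (1 / (2 * pi)) * integral {-pi..pi} (\<lambda>x. g (of_real x))"
    using integral_circle_measure(1)[of "\<lambda>x. g (of_real x)"] c0[of 0] b by simp
  ultimately have "norm (\<integral>x. g (of_real x) \<partial>circle_measure) \<le> 1 / (2 * pi) * (B * (pi - (- pi)))"
    by (simp add: norm_mult norm_divide pos_divide_le_eq)
  thus ?thesis by simp
qed

section \<open>Integration over the torus\<close>

definition torus_measure :: "('d::finite \<Rightarrow> real) measure" where
  "torus_measure = PiM UNIV (\<lambda>_. circle_measure)"

lemma product_prob_space_circle: "product_prob_space (\<lambda>_::'d. circle_measure)"
proof -
  interpret prob_space circle_measure by (rule prob_space_circle_measure)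
  show ?thesis by standard
qed

lemma prob_space_torus_measure: "prob_space torus_measure"
  unfolding torus_measure_def by (rule prob_space_PiM) (rule prob_space_circle_measure)

lemma space_torus_measure: "space torus_measure = {t. \<forall>j. \<bar>t j\<bar> \<le> pi}"
proof -
  have "\<bar>a\<bar> \<le> pi \<longleftrightarrow> a \<in> {-pi..pi}" for a :: real by auto
  thus ?thesis by (auto simp: torus_measure_def space_PiM PiE_def Pi_def)
qed

text \<open>Points of the torus are functions, as the product measure demands. Continuity and
  compactness are handled on \<open>real ^ 'd\<close>, and \<open>vec_lambda\<close>, measurable
  because its coordinates are, links the two.\<close>

lemma continuous_imp_integrable_torus:
  fixes f :: "('d::finite \<Rightarrow> real) \<Rightarrow> complex"
  assumes cont: "continuous_on {v :: real ^ 'd. \<forall>j. \<bar>v $ j\<bar> \<le> pi} (\<lambda>v. f (vec_nth v))"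
  shows "integrable torus_measure f"
proof -
  let ?V = "{v :: real ^ 'd. \<forall>j. \<bar>v $ j\<bar> \<le> pi}"
  have V: "?V = cbox (\<chi> j. - pi) (\<chi> j. pi)"
    by (auto simp: mem_box_cart abs_le_iff minus_le_iff)
  have c: "(\<lambda>x. x) \<in> circle_measure \<rightarrow>\<^sub>M borel"
    by (rule continuous_imp_measurable_circle) (rule continuous_on_id)
  have "(\<lambda>t. vec_lambda t) \<in> torus_measure \<rightarrow>\<^sub>M (borel :: (real ^ 'd) measure)"
  proof (subst borel_measurable_euclidean_space, intro ballI)
    fix b :: "real ^ 'd" assume "b \<in> Basis"
    then obtain j where "b = axis j 1" by (auto simp: Basis_vec_def)
    hence "vec_lambda t \<bullet> b = t j" for t by (simp add: inner_axis)
    moreover have "(\<lambda>t. t j) \<in> torus_measure \<rightarrow>\<^sub>M borel"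
      unfolding torus_measure_def
      by (rule measurable_compose[OF measurable_component_singleton[of j UNIV "\<lambda>_. circle_measure"] c]) simp
    ultimately show "(\<lambda>t. vec_lambda t \<bullet> b) \<in> borel_measurable torus_measure" by simp
  qed
  hence "(\<lambda>t. vec_lambda t) \<in> torus_measure \<rightarrow>\<^sub>M restrict_space borel ?V"
    by (rule measurable_restrict_space2[rotated]) (auto simp: space_torus_measure)
  moreover have "(\<lambda>v :: real ^ 'd. f (vec_nth v)) \<in> borel_measurable (restrict_space borel ?V)"
    by (rule borel_measurable_continuous_on_restrict[OF cont])
  ultimately have "(\<lambda>t. f (vec_nth (vec_lambda t :: real ^ 'd))) \<in> borel_measurable torus_measure"
    by (rule measurable_compose)
  hence m: "f \<in> borel_measurable torus_measure" by (simp add: vec_lambda_inverse)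
  have "compact ((\<lambda>v. f (vec_nth v)) ` ?V)"
    using cont unfolding V by (intro compact_continuous_image compact_cbox)
  then obtain B where B: "\<And>v. v \<in> ?V \<Longrightarrow> norm (f (vec_nth v)) \<le> B"
    using compact_imp_bounded bounded_iff by (metis (no_types, lifting) imageI)
  interpret prob_space torus_measure by (rule prob_space_torus_measure)
  show ?thesis
  proof (rule integrable_const_bound[OF AE_I2 m])
    fix t :: "'d \<Rightarrow> real" assume "t \<in> space torus_measure"
    thus "norm (f t) \<le> B" using B[of "vec_lambda t"] by (simp add: space_torus_measure vec_lambda_inverse)
  qed
qed

lemma norm_integral_torus_le:
  fixes f :: "('d::finite \<Rightarrow> real) \<Rightarrow> complex"
  assumes f: "integrable torus_measure f"
    and B: "\<And>t. (\<And>j. \<bar>t j\<bar> \<le> pi) \<Longrightarrow> norm (\<integral>x. f (t(i := x)) \<partial>circle_measure) \<le> B"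
  shows "norm (\<integral>t. f t \<partial>torus_measure) \<le> B"
proof -
  interpret product_prob_space "\<lambda>_::'d. circle_measure" by (rule product_prob_space_circle)
  interpret Q: prob_space "PiM (UNIV - {i}) (\<lambda>_. circle_measure)"
    by (rule prob_space_PiM) (rule prob_space_circle_measure)
  have ins: "insert i (UNIV - {i}) = UNIV" by auto
  have eq: "(\<integral>t. f t \<partial>torus_measure) = (\<integral>t. (\<integral>x. f (t(i := x)) \<partial>circle_measure) \<partial>PiM (UNIV - {i}) (\<lambda>_. circle_measure))"
    using product_integral_insert[of "UNIV - {i}" i f] f unfolding ins torus_measure_def by simp
  define \<phi> where "\<phi> = (\<lambda>t. \<integral>x. f (t(i := x)) \<partial>circle_measure)"
  have \<phi>: "norm (\<phi> t) \<le> B" if t: "t \<in> space (PiM (UNIV - {i}) (\<lambda>_. circle_measure))" for t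
  proof -
    \<comment> \<open>A point of the product over \<open>UNIV - {i}\<close> is
      \<open>undefined\<close> at \<open>i\<close>; the 0 put there is overwritten inside
      \<open>\<phi>\<close>.\<close>
    have "\<bar>(t(i := 0)) j\<bar> \<le> pi" for j
      using t by (auto simp: space_PiM PiE_def Pi_def abs_le_iff)
    from B[of "t(i := 0)", OF this] show ?thesis by (simp add: \<phi>_def)
  qed
  have "norm (\<integral>t. \<phi> t \<partial>PiM (UNIV - {i}) (\<lambda>_. circle_measure)) \<le> (\<integral>t. norm (\<phi> t) \<partial>PiM (UNIV - {i}) (\<lambda>_. circle_measure))"
    by (rule integral_norm_bound)
  also have "\<dots> \<le> B"
  proof (cases "integrable (PiM (UNIV - {i}) (\<lambda>_. circle_measure)) (\<lambda>t. norm (\<phi> t))")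
    case True
    thus ?thesis by (rule Q.integral_le_const) (use \<phi> in \<open>auto intro: AE_I2\<close>)
  next
    case False
    \<comment> \<open>A Bochner integral that does not exist is 0, so \<open>B >= 0\<close>
      suffices, and this follows from the bound at any one point.\<close>
    obtain t where "t \<in> space (PiM (UNIV - {i}) (\<lambda>_. circle_measure))"
      using Q.not_empty by blast
    from \<phi>[OF this] have "B \<ge> 0" by (rule order_trans[OF norm_ge_zero])
    thus ?thesis using False by (simp add: not_integrable_integral_eq)
  qed
  finally show ?thesis unfolding eq \<phi>_def .
qed

lemma integral_torus_cis:
  "(\<integral>t. cis (\<Sum>i\<in>UNIV. real_of_int (k $ i) * t i) \<partial>torus_measure) = (if k = 0 then 1 else 0)"
proof -
  interpret product_prob_space "\<lambda>_::'d. circle_measure" by (rule product_prob_space_circle)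
  have c: "continuous_on {-pi..pi} (\<lambda>x. cis (real_of_int n * x))" for n
    by (intro continuous_intros)
  have one: "(\<integral>x. cis (real_of_int n * x) \<partial>circle_measure) = (if n = 0 then 1 else 0)" for n
  proof (cases "n = 0")
    case True
    thus ?thesis using M.prob_space by (simp add: cis_zero)
  next
    case False
    have "cis (real_of_int n * pi) = cis (real_of_int n * - pi)"
    proof -
      have "real_of_int n * pi = real_of_int n * (2 * pi) + real_of_int n * - pi" by simp
      hence "cis (real_of_int n * pi) = cis (real_of_int n * (2 * pi)) * cis (real_of_int n * - pi)"
        by (simp only: cis_mult)
      thus ?thesis by simp
    qed
    thus ?thesis using False integral_cis[of "-pi" pi n] by (simp add: integral_circle_measure(1)[OF c])
  qed
  have "(\<integral>t. cis (\<Sum>i\<in>UNIV. real_of_int (k $ i) * t i) \<partial>torus_measure)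
      = (\<integral>t. (\<Prod>i\<in>UNIV. cis (real_of_int (k $ i) * t i)) \<partial>PiM UNIV (\<lambda>_. circle_measure))"
    by (simp add: cis_sum torus_measure_def)
  also have "\<dots> = (\<Prod>i\<in>UNIV. \<integral>x. cis (real_of_int (k $ i) * x) \<partial>circle_measure)"
    by (rule product_integral_prod) (auto intro: integral_circle_measure(2) c)
  also have "\<dots> = (if k = 0 then 1 else 0)"
    unfolding one by (auto simp: vec_eq_iff)
  finally show ?thesis .
qed

section \<open>Decay of the Lagrange function\<close>

lemma le_exp_sum_of_le_exp_each:
  fixes y :: "'d::finite \<Rightarrow> real"
  assumes each: "\<And>i. x \<le> A * exp (- (B * \<bar>y i\<bar>))" and A: "A \<ge> 0" and B: "B \<ge> 0"
  shows "x \<le> A * exp (- (B / real CARD('d) * (\<Sum>i\<in>UNIV. \<bar>y i\<bar>)))"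
proof -
  obtain i where i: "\<And>j. \<bar>y j\<bar> \<le> \<bar>y i\<bar>"
  proof -
    have "Max (range (\<lambda>j. \<bar>y j\<bar>)) \<in> range (\<lambda>j. \<bar>y j\<bar>)" by (intro Max_in) auto
    then obtain i where "Max (range (\<lambda>j. \<bar>y j\<bar>)) = \<bar>y i\<bar>" by (rule imageE)
    thus ?thesis using that[of i] by (metis Max_ge finite finite_imageI rangeI)
  qed
  have "(\<Sum>j\<in>UNIV. \<bar>y j\<bar>) \<le> real CARD('d) * \<bar>y i\<bar>"
    using sum_bounded_above[of UNIV "\<lambda>j. \<bar>y j\<bar>" "\<bar>y i\<bar>"] i by simp
  hence "B / real CARD('d) * (\<Sum>j\<in>UNIV. \<bar>y j\<bar>) \<le> B / real CARD('d) * (real CARD('d) * \<bar>y i\<bar>)"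
    using B by (intro mult_left_mono) auto
  hence "exp (- (B * \<bar>y i\<bar>)) \<le> exp (- (B / real CARD('d) * (\<Sum>i\<in>UNIV. \<bar>y i\<bar>)))"
    by simp
  thus ?thesis using each[of i] A by (meson mult_left_mono order_trans)
qed

lemma summable_on_exp_minus_abs_int:
  fixes c :: real
  assumes "c > 0"
  shows "(\<lambda>n::int. exp (- (c * \<bar>real_of_int n\<bar>))) summable_on UNIV"
proof -
  have "summable (\<lambda>n::nat. exp (- c) ^ n)" using assms by (intro summable_geometric) simp
  hence "(\<lambda>n::nat. exp (- (c * real n))) summable_on UNIV"
    by (intro summable_nonneg_imp_summable_on) (simp_all add: exp_of_nat_mult[symmetric] mult.commute)
  thus ?thesis by (intro summable_on_int_split) simp_all
qed

lemma summable_on_exp_decay: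
  fixes a :: "int ^ 'd::finite \<Rightarrow> complex"
  assumes a: "\<And>k i. norm (a k) \<le> A * exp (- (B * \<bar>real_of_int (k $ i)\<bar>))" and A: "A \<ge> 0" and B: "B > 0"
  shows "(\<lambda>k. norm (a k)) summable_on UNIV"
proof -
  define c where "c = B / real CARD('d)"
  have c: "c > 0" using B by (simp add: c_def)
  have "(\<lambda>k::int^'d. norm (\<Prod>i\<in>UNIV. exp (- (c * \<bar>real_of_int (k $ i)\<bar>)))) summable_on UNIV"
    by (rule norm_summable_on_prod_vec) (use summable_on_exp_minus_abs_int[OF c] in simp)
  hence "(\<lambda>k::int^'d. A * (\<Prod>i\<in>UNIV. exp (- (c * \<bar>real_of_int (k $ i)\<bar>)))) summable_on UNIV"
    by (intro summable_on_cmult_right) (simp add: abs_prod)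
  thus ?thesis
  proof (rule summable_on_comparison_test)
    fix k :: "int^'d"
    have "norm (a k) \<le> A * exp (- (c * (\<Sum>i\<in>UNIV. \<bar>real_of_int (k $ i)\<bar>)))"
      unfolding c_def using B by (intro le_exp_sum_of_le_exp_each a A) auto
    also have "\<dots> = A * (\<Prod>i\<in>UNIV. exp (- (c * \<bar>real_of_int (k $ i)\<bar>)))"
      by (simp add: exp_sum sum_distrib_left flip: sum_negf)
    finally show "norm (a k) \<le> A * (\<Prod>i\<in>UNIV. exp (- (c * \<bar>real_of_int (k $ i)\<bar>)))" .
  qed simp
qed

lemma of_real_fun_upd: "(\<lambda>j. complex_of_real ((t(i := x)) j)) = (\<lambda>j. of_real (t j))(i := of_real x)"
  by auto

text \<open>The numerator \<open>U\<close> is general because of two uses: with the regularized sum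
  at \<open>y\<close> it gives the decay of the Lagrange function, with a lattice wave times the
  \<open>m\<close>-th power of the quadric at 0 the summability of the coefficients. Periodicity is
  asked of the quotient only, since numerator and denominator lack it separately.\<close>

lemma norm_torus_integral_decay:
  fixes U :: "('d::finite \<Rightarrow> complex) \<Rightarrow> complex" and y :: "real ^ 'd"
  assumes dm: "real m > real CARD('d) / 2" and b: "0 < b" "b \<le> 1"
    and lower: "\<And>(t :: 'd \<Rightarrow> real) i s. (\<forall>j. \<bar>t j\<bar> \<le> 4) \<Longrightarrow> \<bar>s\<bar> \<le> b \<Longrightarrow>
      1 / 2 \<le> Re (regularized_sum m h 0 ((\<lambda>j. of_real (t j))(i := of_real (t i) + \<i> * of_real s)))"
    and hol: "\<And>t. (\<And>j. \<bar>t j\<bar> \<le> 4) \<Longrightarrow>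
      (\<lambda>w. U ((\<lambda>j. of_real (t j))(i := w))) holomorphic_on {w. \<bar>Re w\<bar> < 4 \<and> \<bar>Im w\<bar> < b}"
    and per: "\<And>t u. (\<And>j. \<bar>t j\<bar> \<le> 4) \<Longrightarrow> \<bar>u\<bar> < b \<Longrightarrow>
      (\<lambda>\<zeta>. U \<zeta> / regularized_sum m h 0 \<zeta>) ((\<lambda>j. of_real (t j))(i := of_real (- pi) + \<i> * of_real u))
      = (\<lambda>\<zeta>. U \<zeta> / regularized_sum m h 0 \<zeta>) ((\<lambda>j. of_real (t j))(i := of_real pi + \<i> * of_real u))"
    and bound: "\<And>\<zeta>. \<zeta> \<in> tube \<Longrightarrow> norm (U \<zeta>) \<le> M * exp (- (\<Sum>j\<in>UNIV. y $ j * Im (\<zeta> j)))"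
    and int: "integrable torus_measure (\<lambda>t. U (\<lambda>j. of_real (t j)) / regularized_sum m h 0 (\<lambda>j. of_real (t j)))"
  shows "norm (\<integral>t. U (\<lambda>j. of_real (t j)) / regularized_sum m h 0 (\<lambda>j. of_real (t j)) \<partial>torus_measure)
    \<le> 2 * M * exp (- (b / 2 * \<bar>y $ i\<bar>))"
proof (rule norm_integral_torus_le[where i = i, OF int])
  fix t :: "'d \<Rightarrow> real"
  assume t: "\<And>j. \<bar>t j\<bar> \<le> pi"
  have t4: "\<bar>t j\<bar> \<le> 4" for j using t[of j] pi_less_4 by linarith
  define L where "L = (\<lambda>w. (\<lambda>j. complex_of_real (t j))(i := w))"
  define g where "g = (\<lambda>w. U (L w) / regularized_sum m h 0 (L w))"
  \<comment> \<open>The sign of \<open>s\<close> follows that of \<open>y $ i\<close>, so that the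
    wave is damped on the shifted segment; \<open>b / 2\<close> lies strictly inside the
    strip.\<close>
  define s where "s = (if y $ i \<ge> 0 then b / 2 else - (b / 2))"
  have low: "1 / 2 \<le> Re (regularized_sum m h 0 (L w))" if "\<bar>Re w\<bar> \<le> 4" "\<bar>Im w\<bar> \<le> b" for w
  proof -
    have "of_real (Re w) + \<i> * of_real (Im w) = w" by (simp add: complex_eq_iff)
    \<comment> \<open>The hypothesis \<open>lower\<close> leaves the real point vertically over
      \<open>t i\<close>, so the real part of \<open>w\<close> is first written into
      \<open>t\<close>.\<close>
    hence "L w = (\<lambda>j. complex_of_real ((t(i := Re w)) j))(i := of_real ((t(i := Re w)) i) + \<i> * of_real (Im w))"
      by (auto simp: L_def)
    thus ?thesis using lower[of "t(i := Re w)" "Im w" i] that t4 by (metis fun_upd_apply)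
  qed
  have tb: "L w \<in> tube" if "\<bar>Re w\<bar> \<le> 4" "\<bar>Im w\<bar> \<le> b" for w
    unfolding L_def using that t4 b by (intro tube_line) auto
  have "norm (\<integral>x. g (of_real x) \<partial>circle_measure) \<le> 2 * M * exp (- (b / 2 * \<bar>y $ i\<bar>))"
  proof (rule circle_contour_shift_bound)
    have "(\<lambda>w. regularized_sum m h 0 (L w)) holomorphic_on {w. \<bar>Re w\<bar> < 4 \<and> \<bar>Im w\<bar> < b}"
      unfolding L_def by (rule holomorphic_on_regularized_sum[OF dm open_strip]) (use tb[unfolded L_def] in auto)
    moreover have "regularized_sum m h 0 (L w) \<noteq> 0" if "\<bar>Re w\<bar> < 4 \<and> \<bar>Im w\<bar> < b" for w
      using low[of w] that by auto
    ultimately show "g holomorphic_on {w. \<bar>Re w\<bar> < 4 \<and> \<bar>Im w\<bar> < b}"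
      unfolding g_def using hol[of t, OF t4, folded L_def] by (intro holomorphic_on_divide) auto
    show "g (of_real (- pi) + \<i> * of_real u) = g (of_real pi + \<i> * of_real u)" if "\<bar>u\<bar> < b" for u
      using per[of t, OF t4 that] by (simp add: g_def L_def)
    show "\<bar>s\<bar> < b" using b by (auto simp: s_def)
    fix x :: real assume x: "\<bar>x\<bar> \<le> pi"
    define w where "w = of_real x + \<i> * complex_of_real s"
    have w: "\<bar>Re w\<bar> \<le> 4" "\<bar>Im w\<bar> \<le> b" "Im w = s"
      using x b pi_less_4 by (auto simp: w_def s_def)
    have "(\<Sum>j\<in>UNIV. y $ j * Im (L w j)) = (\<Sum>j\<in>UNIV. if j = i then y $ i * s else 0)"
      by (rule sum.cong) (auto simp: L_def w)
    also have "\<dots> = b / 2 * \<bar>y $ i\<bar>" by (simp add: s_def)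
    finally have eq: "(\<Sum>j\<in>UNIV. y $ j * Im (L w j)) = b / 2 * \<bar>y $ i\<bar>" .
    have "norm (U (L w)) \<le> M * exp (- (b / 2 * \<bar>y $ i\<bar>))"
      using bound[OF tb[OF w(1,2)]] unfolding eq .
    moreover have "1 / 2 \<le> norm (regularized_sum m h 0 (L w))"
      using low[OF w(1,2)] complex_Re_le_cmod order_trans by blast
    \<comment> \<open>The lower bound 1/2 of the denominator accounts for the factor 2.\<close>
    ultimately have "norm (U (L w)) / norm (regularized_sum m h 0 (L w)) \<le> (M * exp (- (b / 2 * \<bar>y $ i\<bar>))) / (1 / 2)"
      by (intro frac_le) (auto intro: order_trans[OF norm_ge_zero])
    thus "norm (g (of_real x + \<i> * of_real s)) \<le> 2 * M * exp (- (b / 2 * \<bar>y $ i\<bar>))"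
      by (simp add: g_def norm_divide w_def)
  qed
  thus "norm (\<integral>x. U (\<lambda>j. of_real ((t(i := x)) j)) / regularized_sum m h 0 (\<lambda>j. of_real ((t(i := x)) j)) \<partial>circle_measure)
      \<le> 2 * M * exp (- (b / 2 * \<bar>y $ i\<bar>))"
    unfolding of_real_fun_upd by (simp add: g_def L_def)
qed

text \<open>Convolving with the inverse \<open>c\<close> of \<open>\<phi>\<close> recovers
  \<open>e\<close> from its convolution with \<open>\<phi>\<close>. Boundedness of \<open>e\<close>
  and absolute summability of \<open>c\<close> and \<open>\<phi>\<close> make the double family
  \<open>F\<close> absolutely summable, so both orders of summation agree.\<close>

lemma discrete_convolution_injective:
  fixes \<phi> c e :: "int ^ 'd \<Rightarrow> real"
  assumes \<phi>: "(\<lambda>k. \<bar>\<phi> k\<bar>) summable_on UNIV" and c: "(\<lambda>k. \<bar>c k\<bar>) summable_on UNIV"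
    and inv: "\<And>l. (\<Sum>\<^sub>\<infinity>n. c n * \<phi> (l - n)) = (if l = 0 then 1 else 0)"
    and e: "\<And>k. \<bar>e k\<bar> \<le> E" and zero: "\<And>j. (\<Sum>\<^sub>\<infinity>k. e k * \<phi> (j - k)) = 0"
  shows "e l = 0"
proof -
  have \<phi>': "(\<lambda>k. \<bar>\<phi> (a - k)\<bar>) summable_on UNIV" for a
    using summable_on_reindex_bij_witness[of UNIV "\<lambda>k. a - k" "\<lambda>k. a - k" UNIV "\<lambda>k. \<bar>\<phi> k\<bar>" "\<lambda>k. \<bar>\<phi> (a - k)\<bar>"] \<phi> by simp
  have \<phi>S: "(\<Sum>\<^sub>\<infinity>k. \<bar>\<phi> (a - k)\<bar>) = (\<Sum>\<^sub>\<infinity>k. \<bar>\<phi> k\<bar>)" for a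
    by (rule infsum_reindex_bij_witness[of _ "\<lambda>k. a - k" "\<lambda>k. a - k"]) auto
  have E: "E \<ge> 0" using e[of 0] by linarith
  define F where "F = (\<lambda>n k. c n * (e k * \<phi> (l - n - k)))"
  have Fb: "\<bar>F n k\<bar> \<le> \<bar>c n\<bar> * E * \<bar>\<phi> (l - n - k)\<bar>" for n k
    using e[of k] by (simp add: F_def abs_mult mult.assoc mult_left_mono mult_right_mono)
  have Fs: "(\<lambda>k. norm (F n k)) summable_on UNIV" for n
    by (rule summable_on_comparison_test[OF summable_on_cmult_right[OF \<phi>'[of "l - n"], of "\<bar>c n\<bar> * E"]])
       (use Fb in auto)
  have Fi: "(\<Sum>\<^sub>\<infinity>k. norm (F n k)) \<le> \<bar>c n\<bar> * (E * (\<Sum>\<^sub>\<infinity>k. \<bar>\<phi> k\<bar>))" for n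
  proof -
    have "(\<Sum>\<^sub>\<infinity>k. norm (F n k)) \<le> (\<Sum>\<^sub>\<infinity>k. \<bar>c n\<bar> * E * \<bar>\<phi> (l - n - k)\<bar>)"
      using Fb by (intro infsum_mono Fs summable_on_cmult_right \<phi>') auto
    thus ?thesis by (simp add: infsum_cmult_right' \<phi>S mult.assoc)
  qed
  have "(\<lambda>p. norm (case p of (n, k) \<Rightarrow> F n k)) summable_on (UNIV \<times> UNIV)"
  proof (rule Infinite_Sum.abs_summable_on_Sigma_iff[THEN iffD2], intro conjI ballI)
    show "(\<lambda>k. norm (case (n, k) of (n, k) \<Rightarrow> F n k)) summable_on UNIV" for n
      using Fs by simp
    have "(\<lambda>n. \<bar>c n\<bar> * (E * (\<Sum>\<^sub>\<infinity>k. \<bar>\<phi> k\<bar>))) summable_on UNIV"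
      by (rule summable_on_cmult_left[OF c])
    thus "(\<lambda>n. norm (\<Sum>\<^sub>\<infinity>k. norm (case (n, k) of (n, k) \<Rightarrow> F n k))) summable_on UNIV"
      by (rule summable_on_comparison_test) (use Fi in \<open>auto simp: infsum_nonneg\<close>)
  qed
  hence sw: "(\<Sum>\<^sub>\<infinity>n. \<Sum>\<^sub>\<infinity>k. F n k) = (\<Sum>\<^sub>\<infinity>k. \<Sum>\<^sub>\<infinity>n. F n k)"
    by (rule infsum_swap_banach[OF abs_summable_summable])
  have "(\<Sum>\<^sub>\<infinity>n. \<Sum>\<^sub>\<infinity>k. F n k) = 0"
    by (simp add: F_def infsum_cmult_right' zero)
  moreover have "(\<Sum>\<^sub>\<infinity>k. \<Sum>\<^sub>\<infinity>n. F n k) = e l"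
  proof -
    have "(\<Sum>\<^sub>\<infinity>n. F n k) = (if k = l then e l else 0)" for k
    proof -
      have "(\<Sum>\<^sub>\<infinity>n. F n k) = (\<Sum>\<^sub>\<infinity>n. e k * (c n * \<phi> (l - k - n)))"
        by (intro infsum_cong) (simp add: F_def algebra_simps)
      also have "\<dots> = e k * (if l - k = 0 then 1 else 0)"
        by (simp only: infsum_cmult_right' inv)
      finally show ?thesis by auto
    qed
    hence "(\<Sum>\<^sub>\<infinity>k. \<Sum>\<^sub>\<infinity>n. F n k) = (\<Sum>\<^sub>\<infinity>k. if k = l then e l else 0)" by simp
    also have "\<dots> = (\<Sum>\<^sub>\<infinity>k\<in>{l}. e l)" by (rule infsum_cong_neutral) auto
    finally show ?thesis by simp
  qed
  ultimately show ?thesis using sw by simp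
qed

section \<open>Lattice waves and periodicity of the quotients\<close>

lemma lattice_point_diff: "lattice_point (a - b) = lattice_point a - lattice_point b"
  by (simp add: lattice_point_def vec_eq_iff)

text \<open>At an integer point the extra phase is a multiple of \<open>2 * pi\<close>. The Poisson
  quotient there reduces to a pure character, which is why its mean interpolates.\<close>

lemma shifted_wave_lattice_point:
  "shifted_wave (lattice_point a) \<zeta> k = shifted_wave (lattice_point a) \<zeta> 0"
proof -
  have "\<i> * (\<Sum>j\<in>UNIV. of_real (lattice_point a $ j) * (\<zeta> j + of_real (2 * pi * (k $ j))))
      = \<i> * (\<Sum>j\<in>UNIV. of_real (lattice_point a $ j) * \<zeta> j) + of_int (\<Sum>j\<in>UNIV. a $ j * k $ j) * (of_real (2 * pi) * \<i>)"
    by (simp add: lattice_point_def distrib_left sum.distrib sum_distrib_left sum_distrib_right mult_ac)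
  moreover have "exp (of_int n * (of_real (2 * pi) * \<i>)) = 1" for n :: int
    using exp_integer_2pi[of "of_int n"] by (simp add: mult_ac)
  ultimately have "shifted_wave (lattice_point a) \<zeta> k = exp (\<i> * (\<Sum>j\<in>UNIV. of_real (lattice_point a $ j) * \<zeta> j))"
    by (simp only: shifted_wave_def exp_add mult_1_right)
  thus ?thesis by (simp add: shifted_wave_def)
qed

lemma wave_sum_lattice_point:
  "wave_sum m h (lattice_point a) \<zeta> = shifted_wave (lattice_point a) \<zeta> 0 * wave_sum m h 0 \<zeta>"
proof -
  have "shifted_wave 0 \<zeta> k = 1" for k by (simp add: shifted_wave_def)
  thus ?thesis
    unfolding wave_sum_def
    by (subst shifted_wave_lattice_point) (simp add: divide_inverse infsum_cmult_right')
qed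

lemma regularized_ratio_eq:
  fixes \<zeta> :: "'d::finite \<Rightarrow> complex"
  assumes "real m > real CARD('d) / 2" "\<zeta> \<in> tube" "shifted_quadric h \<zeta> 0 \<noteq> 0"
  shows "regularized_sum m h y \<zeta> / regularized_sum m h 0 \<zeta> = wave_sum m h y \<zeta> / wave_sum m h 0 \<zeta>"
  using assms by (simp add: regularized_sum_eq)

text \<open>On the vertical sides the real part of coordinate \<open>i\<close> has modulus
  \<open>pi > 1\<close>, its imaginary part at most 1, and the other coordinates are real, so the
  quadric has positive real part. Inside the strip it may vanish, but the regularized quotient is
  compared with the periodic one on the sides only.\<close>

lemma shifted_quadric_0_nz:
  fixes t :: "'d::finite \<Rightarrow> real"
  assumes "\<bar>x\<bar> = pi" "\<bar>u\<bar> \<le> 1"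
  shows "shifted_quadric h ((\<lambda>j. of_real (t j))(i := of_real x + \<i> * of_real u)) 0 \<noteq> 0"
proof -
  let ?\<zeta> = "(\<lambda>j. complex_of_real (t j))(i := of_real x + \<i> * of_real u)"
  have "(\<Sum>j\<in>UNIV. (Im (?\<zeta> j))\<^sup>2) = (\<Sum>j\<in>UNIV. if j = i then u\<^sup>2 else 0)"
    by (rule sum.cong) auto
  also have "\<dots> \<le> 1" using assms(2) by (simp add: abs_square_le_1)
  also have "(1::real) < pi\<^sup>2" using pi_gt3 by (intro one_less_power) auto
  also have "pi\<^sup>2 = (Re (?\<zeta> i))\<^sup>2" using assms(1) by (simp flip: assms(1))
  also have "\<dots> \<le> (\<Sum>j\<in>UNIV. (Re (?\<zeta> j))\<^sup>2)" by (rule member_le_sum) auto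
  finally have "(\<Sum>j\<in>UNIV. (Im (?\<zeta> j))\<^sup>2) < (\<Sum>j\<in>UNIV. (Re (?\<zeta> j))\<^sup>2)" .
  moreover have "Re (shifted_quadric h ?\<zeta> 0) = h\<^sup>2 + (\<Sum>j\<in>UNIV. (Re (?\<zeta> j))\<^sup>2) - (\<Sum>j\<in>UNIV. (Im (?\<zeta> j))\<^sup>2)"
    by (simp only: Re_shifted_quadric zero_index of_int_0 mult_zero_right add_0_right)
  ultimately have "Re (shifted_quadric h ?\<zeta> 0) > 0"
    using zero_le_power2[of h] by linarith
  thus ?thesis by (metis less_irrefl zero_complex.simps(1))
qed

lemma shifted_wave_lattice_point_periodic:
  "shifted_wave (lattice_point a) (\<zeta>(i := w + of_real (2 * pi))) 0 = shifted_wave (lattice_point a) (\<zeta>(i := w)) 0"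
proof -
  have "(\<zeta>(i := w + of_real (2 * pi))) j + of_real (2 * pi * real_of_int (0 $ j))
     = (\<zeta>(i := w)) j + of_real (2 * pi * real_of_int (axis i 1 $ j))" for j
    by (simp add: axis_def)
  hence "shifted_wave (lattice_point a) (\<zeta>(i := w + of_real (2 * pi))) 0 = shifted_wave (lattice_point a) (\<zeta>(i := w)) (axis i 1)"
    by (simp only: shifted_wave_def)
  thus ?thesis by (subst (asm) shifted_wave_lattice_point)
qed

text \<open>The interpolant \<open>g\<close> arises by dividing Poisson's formula by the symbol and
  integrating over the torus; uniqueness identifies it with \<open>lagrange_fun\<close>, and the
  decay is that of the mean of \<open>R y\<close>. The constants \<open>b\<close> and
  \<open>K\<close> are parameters here, so that they can be chosen before \<open>h\<close>.\<close>

lemma lagrange_fun_decay: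
  fixes y :: "real ^ 'd"
  assumes dm: "real m > real CARD('d::finite) / 2" and h: "h \<in> {0<..1}"
    and b: "0 < b" "b \<le> 1"
    and lower: "\<And>(t :: 'd \<Rightarrow> real) i s. (\<forall>j. \<bar>t j\<bar> \<le> 4) \<Longrightarrow> \<bar>s\<bar> \<le> b \<Longrightarrow>
      1 / 2 \<le> Re (regularized_sum m h 0 ((\<lambda>j. of_real (t j))(i := of_real (t i) + \<i> * of_real s)))"
    and upper: "\<And>(y :: real ^ 'd) \<zeta>. \<zeta> \<in> tube \<Longrightarrow>
      norm (regularized_sum m h y \<zeta>) \<le> K * exp (- (\<Sum>j\<in>UNIV. y $ j * Im (\<zeta> j)))"
  shows "\<bar>lagrange_fun m h y\<bar> \<le> 2 * K * exp (- (b / 2 * \<bar>y $ i\<bar>))"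
proof -
  have h0: "h > 0" and h01: "h \<in> {0..1}" using h by auto
  define \<zeta> where "\<zeta> = (\<lambda>(t :: 'd \<Rightarrow> real) j. complex_of_real (t j))"
  define N where "N = (\<lambda>(y :: real ^ 'd) t. regularized_sum m h y (\<zeta> t))"
  define S where "S = (\<lambda>(y :: real ^ 'd) t. wave_sum m h y (\<zeta> t))"
  define q where "q = (\<lambda>t. shifted_quadric h (\<zeta> t) (0 :: int ^ 'd))"
  define \<Phi> where "\<Phi> = (scaled_matern m h :: real ^ 'd \<Rightarrow> real)"
  define E where "E = (\<lambda>(k :: int ^ 'd) t. cis (\<Sum>i\<in>UNIV. real_of_int (k $ i) * t i))"
  let ?T = "torus_measure :: ('d \<Rightarrow> real) measure"
  obtain C where C: "C > 0" and C': "\<forall>(y :: real ^ 'd) (t :: 'd \<Rightarrow> real). (\<forall>j. \<bar>t j\<bar> \<le> 4) \<longrightarrow>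
      (\<Sum>\<^sub>\<infinity>k. of_real (scaled_matern m h (y - lattice_point k)) * cis (\<Sum>i\<in>UNIV. k $ i * t i))
      = of_real C * (\<Sum>\<^sub>\<infinity>k. shifted_wave y (\<lambda>j. of_real (t j)) k / shifted_quadric h (\<lambda>j. of_real (t j)) k ^ m)"
    using matern_poisson_summation[OF dm h0] by (elim exE conjE)
  have poisson: "(\<Sum>\<^sub>\<infinity>k. of_real (\<Phi> (y - lattice_point k)) * E k t) = of_real C * S y t"
    if "\<And>j. \<bar>t j\<bar> \<le> 4" for y t
    unfolding \<Phi>_def S_def wave_sum_def \<zeta>_def E_def
    by (rule C'[rule_format]) (rule that)
  have T4: "\<bar>t j\<bar> \<le> 4" if "t \<in> space ?T" for t j
    using that pi_less_4 by (auto simp: space_torus_measure intro: order_trans)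
  have tb: "\<zeta> t \<in> tube" if "\<And>j. \<bar>t j\<bar> \<le> 4" for t
    unfolding \<zeta>_def using that by (rule of_real_mem_tube)
  have q0: "q t \<noteq> 0" for t
  proof -
    have "h\<^sup>2 + (\<Sum>j\<in>UNIV. (t j + 2 * pi * real_of_int ((0 :: int ^ 'd) $ j))\<^sup>2) > 0"
      using h0 by (intro add_pos_nonneg sum_nonneg) auto
    thus ?thesis unfolding q_def \<zeta>_def shifted_quadric_of_real by (metis of_real_eq_0_iff less_irrefl)
  qed
  have NS: "N y t = q t ^ m * S y t" if "\<And>j. \<bar>t j\<bar> \<le> 4" for y t
    unfolding N_def S_def q_def by (rule regularized_sum_eq[OF dm tb[OF that] q0[unfolded q_def]])
  have N0: "N 0 t \<noteq> 0" for t
    using Re_regularized_sum_of_real_ge_1[of m h t] unfolding N_def \<zeta>_def by auto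
  have S0: "S 0 t \<noteq> 0" if "\<And>j. \<bar>t j\<bar> \<le> 4" for t
    using N0[of t] NS[OF that, of 0] by auto
  let ?V = "{v :: real ^ 'd. \<forall>j. \<bar>v $ j\<bar> \<le> pi}"
  have \<zeta>c: "continuous_on ?V (\<lambda>v. \<zeta> (vec_nth v) j)" for j
    unfolding \<zeta>_def by (intro continuous_intros)
  have V4: "\<bar>v $ j\<bar> \<le> 4" if "v \<in> ?V" for v j
    using that pi_less_4 by (auto intro: order_trans)
  have Nc: "continuous_on ?V (\<lambda>v. N y (vec_nth v))" for y
    unfolding N_def using V4 by (intro continuous_on_regularized_sum dm continuous_on_const \<zeta>c tb) auto
  define R where "R = (\<lambda>y t. N y t / N 0 t)"
  have Ri: "integrable ?T (R y)" for y
    unfolding R_def by (rule continuous_imp_integrable_torus) (intro continuous_intros Nc, use N0 in auto)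
  have R_decay: "norm (\<integral>t. R y t \<partial>?T) \<le> 2 * K * exp (- (b / 2 * \<bar>y $ i\<bar>))" for y i
    unfolding R_def N_def \<zeta>_def
  proof (rule norm_torus_integral_decay[OF dm b lower, where U = "regularized_sum m h y"])
    fix t :: "'d \<Rightarrow> real" assume t: "\<And>j. \<bar>t j\<bar> \<le> 4"
    show "(\<lambda>w. regularized_sum m h y ((\<lambda>j. of_real (t j))(i := w))) holomorphic_on {w. \<bar>Re w\<bar> < 4 \<and> \<bar>Im w\<bar> < b}"
      by (rule holomorphic_on_regularized_sum[OF dm open_strip]) (use t b in \<open>auto intro: tube_line\<close>)
    fix u assume u: "\<bar>u\<bar> < b"
    have e: "complex_of_real pi + \<i> * of_real u = (of_real (- pi) + \<i> * of_real u) + of_real (2 * pi)" by simp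
    have "regularized_sum m h y ((\<lambda>j. of_real (t j))(i := of_real x + \<i> * of_real u)) /
          regularized_sum m h 0 ((\<lambda>j. of_real (t j))(i := of_real x + \<i> * of_real u))
        = wave_sum m h y ((\<lambda>j. of_real (t j))(i := of_real x + \<i> * of_real u)) /
          wave_sum m h 0 ((\<lambda>j. of_real (t j))(i := of_real x + \<i> * of_real u))" if x: "\<bar>x\<bar> = pi" for x
    proof (rule regularized_ratio_eq[OF dm])
      show "(\<lambda>j. complex_of_real (t j))(i := of_real x + \<i> * of_real u) \<in> tube"
        using t u b x pi_less_4 by (intro tube_line) auto
      show "shifted_quadric h ((\<lambda>j. of_real (t j))(i := of_real x + \<i> * of_real u)) 0 \<noteq> 0"
        using u b x by (intro shifted_quadric_0_nz) auto
    qed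
    from this[of "-pi"] this[of pi]
    show "regularized_sum m h y ((\<lambda>j. of_real (t j))(i := of_real (- pi) + \<i> * of_real u)) /
          regularized_sum m h 0 ((\<lambda>j. of_real (t j))(i := of_real (- pi) + \<i> * of_real u)) =
        regularized_sum m h y ((\<lambda>j. of_real (t j))(i := of_real pi + \<i> * of_real u)) /
          regularized_sum m h 0 ((\<lambda>j. of_real (t j))(i := of_real pi + \<i> * of_real u))"
      by (simp only: abs_minus_cancel abs_of_pos[OF pi_gt_zero] refl e wave_sum_periodic)
  qed (use upper Ri in \<open>auto simp: R_def[abs_def] N_def \<zeta>_def\<close>)
  \<comment> \<open>\<open>C * S 0 t\<close> is the symbol of the kernel, hence the integrals
    \<open>a k\<close> of \<open>f k\<close> are the Fourier coefficients of its reciprocal.\<close>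
  define f where "f = (\<lambda>k t. E k t / (of_real C * S 0 t))"
  \<comment> \<open>Multiplying numerator and denominator of \<open>f\<close> by
    \<open>q t ^ m\<close> brings in the denominator \<open>N 0\<close> of \<open>R\<close>, so the
    same decay lemma applies.\<close>
  define U where "U = (\<lambda>(k :: int ^ 'd) \<zeta>. shifted_wave (lattice_point k) \<zeta> 0 * shifted_quadric h \<zeta> 0 ^ m)"
  have EU: "E k t = shifted_wave (lattice_point k) (\<zeta> t) 0" for k t
    unfolding \<zeta>_def shifted_wave_of_real by (simp add: E_def lattice_point_def)
  have fU: "f k t = of_real (1 / C) * (U k (\<zeta> t) / N 0 t)" if "\<And>j. \<bar>t j\<bar> \<le> 4" for k t
  proof -
    have "shifted_quadric h (\<zeta> t) 0 = q t" by (simp add: q_def)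
    thus ?thesis using q0[of t] C by (simp add: f_def EU U_def NS[OF that])
  qed
  have Ui: "integrable ?T (\<lambda>t. U k (\<zeta> t) / N 0 t)" for k
  proof (rule continuous_imp_integrable_torus)
    have "continuous_on ?V (\<lambda>v. U k (\<zeta> (vec_nth v)))"
      unfolding U_def shifted_wave_def shifted_quadric_def by (intro continuous_intros \<zeta>c)
    thus "continuous_on ?V (\<lambda>v. U k (\<zeta> (vec_nth v)) / N 0 (vec_nth v))"
      by (intro continuous_intros Nc) (use N0 in auto)
  qed
  have fi: "integrable ?T (f k)" for k
    using integrable_mult_right[OF Ui[of k], of "of_real (1 / C)"]
    by (rule Bochner_Integration.integrable_cong[THEN iffD2, OF refl, rotated]) (use fU T4 in auto)
  define a where "a = (\<lambda>k. \<integral>t. f k t \<partial>?T)"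
  define Q where "Q = (1 + 25 * real CARD('d)) ^ m"
  have a_decay: "norm (a k) \<le> (1 / C * (2 * Q)) * exp (- (b / 2 * \<bar>real_of_int (k $ i)\<bar>))" for k i
  proof -
    have "norm (\<integral>t. U k (\<zeta> t) / N 0 t \<partial>?T) \<le> 2 * Q * exp (- (b / 2 * \<bar>lattice_point k $ i\<bar>))"
      unfolding N_def \<zeta>_def
    proof (rule norm_torus_integral_decay[OF dm b lower, where U = "U k"])
      fix t :: "'d \<Rightarrow> real" assume t: "\<And>j. \<bar>t j\<bar> \<le> 4"
      have "(\<lambda>w. ((\<lambda>j. complex_of_real (t j))(i := w)) j) holomorphic_on A" for j A
        by (cases "j = i") auto
      thus "(\<lambda>w. U k ((\<lambda>j. of_real (t j))(i := w))) holomorphic_on {w. \<bar>Re w\<bar> < 4 \<and> \<bar>Im w\<bar> < b}"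
        unfolding U_def shifted_wave_def shifted_quadric_def by (intro holomorphic_intros)
      fix u assume u: "\<bar>u\<bar> < b"
      have e: "complex_of_real pi + \<i> * of_real u = (of_real (- pi) + \<i> * of_real u) + of_real (2 * pi)" by simp
      have "U k ((\<lambda>j. of_real (t j))(i := of_real x + \<i> * of_real u)) / regularized_sum m h 0 ((\<lambda>j. of_real (t j))(i := of_real x + \<i> * of_real u))
        = shifted_wave (lattice_point k) ((\<lambda>j. of_real (t j))(i := of_real x + \<i> * of_real u)) 0 /
          wave_sum m h 0 ((\<lambda>j. of_real (t j))(i := of_real x + \<i> * of_real u))" if x: "\<bar>x\<bar> = pi" for x
      proof -
        let ?z = "(\<lambda>j. complex_of_real (t j))(i := of_real x + \<i> * of_real u)"
        have "?z \<in> tube"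
          using t u b x pi_less_4 by (intro tube_line) auto
        moreover have "shifted_quadric h ?z 0 \<noteq> 0"
          using u b x by (intro shifted_quadric_0_nz) auto
        ultimately show ?thesis by (simp add: U_def regularized_sum_eq[OF dm])
      qed
      from this[of "-pi"] this[of pi]
      show "U k ((\<lambda>j. of_real (t j))(i := of_real (- pi) + \<i> * of_real u)) /
          regularized_sum m h 0 ((\<lambda>j. of_real (t j))(i := of_real (- pi) + \<i> * of_real u)) =
        U k ((\<lambda>j. of_real (t j))(i := of_real pi + \<i> * of_real u)) /
          regularized_sum m h 0 ((\<lambda>j. of_real (t j))(i := of_real pi + \<i> * of_real u))"
        by (simp only: abs_minus_cancel abs_of_pos[OF pi_gt_zero] refl e wave_sum_periodic shifted_wave_lattice_point_periodic)
    next
      fix z :: "'d \<Rightarrow> complex" assume z: "z \<in> tube"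
      have "norm (shifted_quadric h z 0) ^ m \<le> Q"
        unfolding Q_def by (intro power_mono norm_shifted_quadric_0_le h01 z norm_ge_zero)
      thus "norm (U k z) \<le> Q * exp (- (\<Sum>j\<in>UNIV. lattice_point k $ j * Im (z j)))"
        by (simp add: U_def norm_mult norm_power norm_shifted_wave mult.commute mult_left_mono)
    qed (use Ui in \<open>auto simp: N_def \<zeta>_def\<close>)
    moreover have "a k = of_real (1 / C) * (\<integral>t. U k (\<zeta> t) / N 0 t \<partial>?T)"
      unfolding a_def integral_mult_right_zero[symmetric]
      by (rule Bochner_Integration.integral_cong[OF refl]) (use fU T4 in auto)
    ultimately show ?thesis
      using C by (simp add: norm_mult norm_divide lattice_point_def divide_right_mono)
  qed
  have a_sum: "(\<lambda>k. norm (a k)) summable_on UNIV"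
    by (rule summable_on_exp_decay[OF a_decay]) (use C b in \<open>auto simp: Q_def\<close>)
  define A where "A = 1 / C * (2 * Q)"
  have a_le: "norm (a k) \<le> A" for k
  proof -
    have "A \<ge> 0" using C by (simp add: A_def Q_def)
    moreover have "exp (- (b / 2 * \<bar>real_of_int (k $ i)\<bar>)) \<le> 1" using b by simp
    ultimately show ?thesis
      using a_decay[of k i, folded A_def] by (meson mult_left_le order_trans)
  qed
  have \<Phi>s: "(\<lambda>k. \<Phi> (y - lattice_point k)) summable_on UNIV" and \<Phi>0: "\<Phi> y \<ge> 0" for y
    unfolding \<Phi>_def by (rule summable_on_scaled_matern[OF dm h0])+
  have bs: "(\<lambda>k. norm (c k * of_real (\<Phi> (y - lattice_point k)) :: complex)) summable_on UNIV"
    if "\<And>k. norm (c k) \<le> B" for c :: "int ^ 'd \<Rightarrow> complex" and B y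
    by (rule summable_on_comparison_test[OF summable_on_cmult_right[OF \<Phi>s[of y], of B]])
       (use that \<Phi>0 in \<open>auto simp: norm_mult mult_right_mono\<close>)
  have rs: "(\<lambda>k. c k * \<Phi> (y - lattice_point k)) summable_on UNIV"
    if "\<And>k. \<bar>c k\<bar> \<le> B" for c :: "int ^ 'd \<Rightarrow> real" and B y
    by (rule abs_summable_summable, rule summable_on_comparison_test[OF summable_on_cmult_right[OF \<Phi>s[of y], of B]])
       (use that \<Phi>0 in \<open>auto simp: abs_mult mult_right_mono\<close>)
  \<comment> \<open>Summation against the kernel under the integral produces the Poisson series at
    \<open>y\<close> divided by the symbol, which is \<open>R y\<close>.\<close>
  have \<chi>: "(\<Sum>\<^sub>\<infinity>k. a k * of_real (\<Phi> (y - lattice_point k))) = (\<integral>t. R y t \<partial>?T)" for y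
  proof -
    define G where "G = (\<lambda>k t. f k t * of_real (\<Phi> (y - lattice_point k)))"
    have Gi: "integrable ?T (G k)" for k
      unfolding G_def by (intro integrable_mult_left fi)
    have Gn: "norm (G k t) = norm (1 / (of_real C * S 0 t)) * \<Phi> (y - lattice_point k)" for k t
      using \<Phi>0 by (simp add: G_def f_def E_def norm_mult norm_divide)
    have "(\<Sum>\<^sub>\<infinity>k. a k * of_real (\<Phi> (y - lattice_point k))) = (\<Sum>\<^sub>\<infinity>k. \<integral>t. G k t \<partial>?T)"
      unfolding a_def G_def by simp
    also have "\<dots> = (\<integral>t. (\<Sum>\<^sub>\<infinity>k. G k t) \<partial>?T)"
    proof (rule integral_infsum[symmetric, OF Gi])
      show "(\<lambda>k. norm (G k t)) summable_on UNIV" for t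
        unfolding Gn by (intro summable_on_cmult_right \<Phi>s)
      have "(\<integral>t. norm (G k t) \<partial>?T) = (\<integral>t. norm (1 / (of_real C * S 0 t)) \<partial>?T) * \<Phi> (y - lattice_point k)" for k
        unfolding Gn by (rule integral_mult_left_zero)
      thus "(\<lambda>k. \<integral>t. norm (G k t) \<partial>?T) summable_on UNIV"
        by (simp only:) (intro summable_on_cmult_right \<Phi>s)
    qed
    also have "\<dots> = (\<integral>t. R y t \<partial>?T)"
    proof (rule Bochner_Integration.integral_cong[OF refl])
      fix t assume "t \<in> space ?T"
      note t = T4[OF this]
      have "(\<Sum>\<^sub>\<infinity>k. G k t) = (\<Sum>\<^sub>\<infinity>k. (1 / (of_real C * S 0 t)) * (of_real (\<Phi> (y - lattice_point k)) * E k t))"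
        by (intro infsum_cong) (simp add: G_def f_def)
      also have "\<dots> = (1 / (of_real C * S 0 t)) * (of_real C * S y t)"
        unfolding infsum_cmult_right' poisson[of t y, OF t] ..
      also have "\<dots> = R y t"
        using C q0[of t] by (simp add: R_def NS[OF t])
      finally show "(\<Sum>\<^sub>\<infinity>k. G k t) = R y t" .
    qed
    finally show ?thesis .
  qed
  \<comment> \<open>\<open>cardinal_space\<close> takes real coefficients; as the kernel is real,
    taking real parts of \<open>a\<close> yields the real part of the interpolant.\<close>
  define c where "c = (\<lambda>k. Re (a k))"
  have c_le: "\<bar>c k\<bar> \<le> A" for k
    unfolding c_def using abs_Re_le_cmod a_le by (rule order_trans)
  define g where "g = (\<lambda>y. \<Sum>\<^sub>\<infinity>k. c k * \<Phi> (y - lattice_point k))"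
  have gR: "g y = Re (\<integral>t. R y t \<partial>?T)" for y
  proof -
    have "(\<lambda>k. a k * of_real (\<Phi> (y - lattice_point k))) summable_on UNIV"
      by (rule abs_summable_summable[OF bs[OF a_le]])
    from infsum_Re[OF this] show ?thesis by (simp add: g_def c_def \<chi>)
  qed
  have g_int: "g (lattice_point j) = (if j = 0 then 1 else 0)" for j
  proof -
    have "(\<integral>t. R (lattice_point j) t \<partial>?T) = (\<integral>t. E j t \<partial>?T)"
    proof (rule Bochner_Integration.integral_cong[OF refl])
      fix t assume "t \<in> space ?T"
      note t = T4[OF this]
      show "R (lattice_point j) t = E j t"
        using q0[of t] S0[OF t] by (simp add: R_def NS[OF t] S_def wave_sum_lattice_point EU)
    qed
    thus ?thesis unfolding gR E_def integral_torus_cis by simp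
  qed
  have "lagrange_fun m h = g"
    unfolding lagrange_fun_def
  proof (rule the_equality, intro conjI allI)
    have "bounded (range c)" unfolding bounded_iff using c_le by auto
    thus "g \<in> cardinal_space m h"
      unfolding cardinal_space_def g_def \<Phi>_def by blast
    show "g (lattice_point j) = (if j = 0 then 1 else 0)" for j by (rule g_int)
    fix g' :: "real ^ 'd \<Rightarrow> real"
    assume g': "g' \<in> cardinal_space m h \<and> (\<forall>j. g' (lattice_point j) = (if j = 0 then 1 else 0))"
    then obtain c' where c': "bounded (range c')" "g' = (\<lambda>x. \<Sum>\<^sub>\<infinity>j. c' j * \<Phi> (x - lattice_point j))"
      by (auto simp: cardinal_space_def \<Phi>_def)
    then obtain B where B: "\<And>k. \<bar>c' k\<bar> \<le> B" by (auto simp: bounded_iff)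
    have "c' l - c l = 0" for l
    \<comment> \<open>\<open>c\<close> is itself the convolution inverse of the kernel on the
      lattice, because \<open>g\<close> takes the values of the Kronecker delta there.\<close>
    proof (rule discrete_convolution_injective[where \<phi> = "\<lambda>k. \<Phi> (lattice_point k)" and c = c and e = "\<lambda>k. c' k - c k" and E = "B + A"])
      have "(\<lambda>k. \<Phi> (lattice_point (- k))) summable_on UNIV"
      proof -
        have "lattice_point (- k) = 0 - lattice_point k" for k :: "int ^ 'd"
          by (simp add: lattice_point_def vec_eq_iff)
        thus ?thesis by (simp only: \<Phi>s)
      qed
      hence "(\<lambda>k. \<Phi> (lattice_point k)) summable_on UNIV"
        using summable_on_reindex_bij_witness[of UNIV uminus uminus UNIV "\<lambda>k. \<Phi> (lattice_point k)" "\<lambda>k. \<Phi> (lattice_point (- k))"]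
        by simp
      thus "(\<lambda>k. \<bar>\<Phi> (lattice_point k)\<bar>) summable_on UNIV" using \<Phi>0 by simp
      show "(\<lambda>k. \<bar>c k\<bar>) summable_on UNIV"
        by (rule summable_on_comparison_test[OF a_sum]) (auto simp: c_def abs_Re_le_cmod)
      show "(\<Sum>\<^sub>\<infinity>n. c n * \<Phi> (lattice_point (l - n))) = (if l = 0 then 1 else 0)" for l
        using g_int[of l] by (simp add: g_def lattice_point_diff)
      show "\<bar>c' k - c k\<bar> \<le> B + A" for k
        using B[of k] c_le[of k] by linarith
      show "(\<Sum>\<^sub>\<infinity>k. (c' k - c k) * \<Phi> (lattice_point (j - k))) = 0" for j
      proof -
        have "(\<Sum>\<^sub>\<infinity>k. (c' k - c k) * \<Phi> (lattice_point (j - k)))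
            = (\<Sum>\<^sub>\<infinity>k. c' k * \<Phi> (lattice_point j - lattice_point k) + - (c k * \<Phi> (lattice_point j - lattice_point k)))"
          by (intro infsum_cong) (simp add: lattice_point_diff left_diff_distrib)
        also have "\<dots> = g' (lattice_point j) - g (lattice_point j)"
          using rs[where c = c' and B = B, OF B, where y = "lattice_point j"]
            rs[where c = c and B = A, OF c_le, where y = "lattice_point j"]
          by (subst infsum_add) (simp_all add: c' g_def infsum_uminus summable_on_uminus)
        finally show ?thesis using g' g_int by simp
      qed
    qed
    hence "c' = c" by auto
    thus "g' = g" using c' by (simp add: g_def)
  qed
  hence "\<bar>lagrange_fun m h y\<bar> \<le> norm (\<integral>t. R y t \<partial>?T)"
    using abs_Re_le_cmod by (simp add: gR)
  thus ?thesis using R_decay order_trans by blast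
qed

theorem theorem3p1:
  fixes m :: nat
  assumes "real m > real CARD('d::finite) / 2"
  shows "\<exists>A B :: real. A > 0 \<and> B > 0 \<and>
    (\<forall>h \<in> {0<..1}. \<forall>y :: real ^ 'd.
       \<bar>lagrange_fun m h y\<bar> \<le> A * exp (- B * (\<Sum>i\<in>UNIV. \<bar>y $ i\<bar>)))"
proof -
  obtain b where b: "b > 0" "b \<le> 1" and lower: "\<And>h (t :: 'd \<Rightarrow> real) i s. h \<in> {0..1} \<Longrightarrow> (\<forall>j. \<bar>t j\<bar> \<le> 4) \<Longrightarrow> \<bar>s\<bar> \<le> b \<Longrightarrow>
      1 / 2 \<le> Re (regularized_sum m h 0 ((\<lambda>j. of_real (t j))(i := of_real (t i) + \<i> * of_real s)))"
    using Re_regularized_sum_ge_half[OF assms] by metis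
  obtain K where K: "K > 0" and upper: "\<And>h (y :: real ^ 'd) \<zeta>. h \<in> {0..1} \<Longrightarrow> \<zeta> \<in> tube \<Longrightarrow>
      norm (regularized_sum m h y \<zeta>) \<le> K * exp (- (\<Sum>j\<in>UNIV. y $ j * Im (\<zeta> j)))"
    using norm_regularized_sum_le[OF assms] by metis
  \<comment> \<open>\<open>b / 2\<close> is the height of the shifted contour; the division by the
    dimension pays for replacing the largest coordinate by the sum of all.\<close>
  define B where "B = b / 2 / real CARD('d)"
  have "\<bar>lagrange_fun m h y\<bar> \<le> 2 * K * exp (- B * (\<Sum>i\<in>UNIV. \<bar>y $ i\<bar>))"
    if h: "h \<in> {0<..1}" for h and y :: "real ^ 'd"
  proof -
    have h01: "h \<in> {0..1}" using h by auto
    have "\<bar>lagrange_fun m h y\<bar> \<le> 2 * K * exp (- (b / 2 * \<bar>y $ i\<bar>))" for i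
      by (rule lagrange_fun_decay[OF assms h b lower[OF h01] upper[OF h01]])
    hence "\<bar>lagrange_fun m h y\<bar> \<le> 2 * K * exp (- (b / 2 / real CARD('d) * (\<Sum>i\<in>UNIV. \<bar>y $ i\<bar>)))"
      using K b by (intro le_exp_sum_of_le_exp_each) auto
    thus ?thesis by (simp add: B_def)
  qed
  moreover have "2 * K > 0" "B > 0" using K b by (auto simp: B_def)
  ultimately show ?thesis by blast
qed

end
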